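(* Let $\mathbf{S}_1,\dots,\mathbf{S}_n$ be independent random self-adjoint $d\times d$ matrices (real or complex), let $\mathbf{X}=\sum_{i=1}^n \mathbf{S}_i$, and let $\mathbf{Z}$ be a Gaussian self-adjoint $d\times d$ matrix with $\mathbb{E}[\mathbf{Z}]=\mathbb{E}[\mathbf{X}]$ and $\mathrm{Var}_{\otimes}[\mathbf{Z}]=\mathrm{Var}_{\otimes}[\mathbf{X}]$. For each $\zeta\in\mathbb{C}\setminus\mathbb{R}$ and each natural number $p\ge 1$, $$\big|\,\|R_\zeta(\mathbf{X})\|_{2p}-\|R_\zeta(\mathbf{Z})\|_{2p}\,\big|\le \frac{48\,p^2\,\sigma^2(\mathbf{X})\,L(\mathbf{X})+72\,p^3\,L(\mathbf{X})^3}{|\mathrm{Im}\,\zeta|^4}.$$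
   Context: A random self-adjoint matrix $\mathbf{Z}$ is Gaussian when the real and imaginary parts of its entries form a jointly Gaussian family of real random variables. The variance tensor is $\mathrm{Var}_{\otimes}[\mathbf{Y}]=\mathbb{E}[(\mathbf{Y}-\mathbb{E}\mathbf{Y})\otimes(\mathbf{Y}-\mathbb{E}\mathbf{Y})]$, with $\otimes$ the Kronecker product. The resolvents of a self-adjoint matrix $\mathbf{A}$ are $R_\zeta(\mathbf{A})=(\zeta\mathbf{I}_d-\mathbf{A})^{-1}$ for $\zeta\in\mathbb{C}\setminus\mathbb{R}$. Write $\|\cdot\|$ (no subscript) for the spectral norm, $\mathrm{tr}[\mathbf{A}]=d^{-1}\sum_i a_{ii}$ for the normalized trace, $|\mathbf{A}|=(\mathbf{A}^*\mathbf{A})^{1/2}$; for a random matrix $\mathbf{Y}$ and $q>0$, $\|\mathbf{Y}\|_q=(\mathbb{E}\,\mathrm{tr}|\mathbf{Y}|^q)^{1/q}$. Matrix variance: $\sigma^2(\mathbf{X})=\|\mathbb{E}[(\mathbf{X}-\mathbb{E}\mathbf{X})^2]\|=\big\|\sum_{i=1}^n\mathbb{E}[(\mathbf{S}_i-\mathbb{E}\mathbf{S}_i)^2]\big\|$. Uniform bound statistic: $L(\mathbf{X})=\sup\max_i\|\mathbf{S}_i-\mathbb{E}\mathbf{S}_i\|$, where $\sup$ is the (essential) supremum over the randomness. All expectations involved are tacitly assumed to be defined and finite. *)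

theory Defs
  imports "HOL-Probability.Probability"
begin

definition conj_transpose :: "complex^'n^'m \<Rightarrow> complex^'m^'n"
  where "conj_transpose A = (\<chi> i j. cnj (A $ j $ i))"

definition self_adjoint :: "complex^'n^'n \<Rightarrow> bool"
  where "self_adjoint A \<longleftrightarrow> conj_transpose A = A"

definition unitary :: "complex^'n^'n \<Rightarrow> bool"
  where "unitary U \<longleftrightarrow> conj_transpose U ** U = mat 1 \<and> U ** conj_transpose U = mat 1"

definition real_diag :: "('n \<Rightarrow> real) \<Rightarrow> complex^'n^'n"
  where "real_diag v = (\<chi> i j. if i = j then complex_of_real (v i) else 0)"

text \<open>
  The library norm on \<^typ>\<open>complex^'n^'n\<close> is the Frobenius norm. The spectral norm is the
  operator norm with respect to the Euclidean norm on \<^typ>\<open>complex^'n\<close>.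
\<close>
definition spectral_norm :: "complex^'n^'n \<Rightarrow> real"
  where "spectral_norm A = onorm (\<lambda>x. A *v x)"

definition ntrace :: "complex^'n^'n \<Rightarrow> complex"
  where "ntrace A = trace A / of_nat CARD('n)"

definition kronecker :: "complex^'n^'n \<Rightarrow> complex^'m^'m \<Rightarrow> complex^('n \<times> 'm)^('n \<times> 'm)"
  where "kronecker A B = (\<chi> r c. A $ fst r $ fst c * B $ snd r $ snd c)"

definition resolvent :: "complex \<Rightarrow> complex^'n^'n \<Rightarrow> complex^'n^'n"
  where "resolvent \<zeta> A = matrix_inv (mat \<zeta> - A)"

text \<open>
  Functional calculus, meaningful for self-adjoint \<open>A\<close>: the value does not depend on the
  unitary diagonalization \<open>A = U diag(v) U\<^sup>*\<close>, which exists by the spectral theorem.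
\<close>
definition matrix_fun :: "(real \<Rightarrow> real) \<Rightarrow> complex^'n^'n \<Rightarrow> complex^'n^'n"
  where "matrix_fun f A = (THE B. \<exists>U v. unitary U
           \<and> A = U ** real_diag v ** conj_transpose U
           \<and> B = U ** real_diag (f \<circ> v) ** conj_transpose U)"

definition matrix_abs :: "complex^'n^'n \<Rightarrow> complex^'n^'n"
  where "matrix_abs A = matrix_fun sqrt (conj_transpose A ** A)"

text \<open>
  For \<open>q > 0\<close>. The trace of \<open>|A|\<^sup>q\<close> is a nonnegative real number, so taking the real part
  only changes the type.
\<close>
definition Lq_norm :: "'w measure \<Rightarrow> real \<Rightarrow> ('w \<Rightarrow> complex^'n^'n) \<Rightarrow> real"
  where "Lq_norm M q Y =
    (LINT \<omega>|M. Re (ntrace (matrix_fun (\<lambda>x. x powr q) (matrix_abs (Y \<omega>))))) powr (1 / q)"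

definition random_self_adjoint :: "'w measure \<Rightarrow> ('w \<Rightarrow> complex^'n^'n) \<Rightarrow> bool"
  where "random_self_adjoint M Y \<longleftrightarrow>
    Y \<in> borel_measurable M \<and> (\<forall>\<omega>\<in>space M. self_adjoint (Y \<omega>))"

text \<open>
  Constants count as Gaussian variables (variance 0); they have no Lebesgue density.
\<close>
definition gaussian_rv :: "'w measure \<Rightarrow> ('w \<Rightarrow> real) \<Rightarrow> bool"
  where "gaussian_rv M X \<longleftrightarrow> X \<in> borel_measurable M \<and>
    ((\<exists>\<mu> \<sigma>. \<sigma> > 0 \<and> distributed M lborel X (normal_density \<mu> \<sigma>)) \<or> (\<exists>\<mu>. AE \<omega> in M. X \<omega> = \<mu>))"

definition jointly_gaussian :: "'w measure \<Rightarrow> 'i set \<Rightarrow> ('i \<Rightarrow> 'w \<Rightarrow> real) \<Rightarrow> bool"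
  where "jointly_gaussian M I X \<longleftrightarrow>
    (\<forall>J c. finite J \<longrightarrow> J \<subseteq> I \<longrightarrow> gaussian_rv M (\<lambda>\<omega>. \<Sum>j\<in>J. c j * X j \<omega>))"

definition gaussian_matrix :: "'w measure \<Rightarrow> ('w \<Rightarrow> complex^'n^'n) \<Rightarrow> bool"
  where "gaussian_matrix M Z \<longleftrightarrow>
    jointly_gaussian M ({Re, Im} \<times> UNIV) (\<lambda>(part, i, j) \<omega>. part (Z \<omega> $ i $ j))"

definition var_tensor :: "'w measure \<Rightarrow> ('w \<Rightarrow> complex^'n^'n) \<Rightarrow> complex^('n \<times> 'n)^('n \<times> 'n)"
  where "var_tensor M Y =
    (let E = integral\<^sup>L M Y in LINT \<omega>|M. kronecker (Y \<omega> - E) (Y \<omega> - E))"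

definition matrix_variance :: "'w measure \<Rightarrow> ('w \<Rightarrow> complex^'n^'n) \<Rightarrow> real"
  where "matrix_variance M X =
    (let E = integral\<^sup>L M X in spectral_norm (LINT \<omega>|M. (X \<omega> - E) ** (X \<omega> - E)))"

text \<open>
  The uniform bound statistic of a finite family of summands; it may be infinite. In
  \<^typ>\<open>ennreal\<close> the supremum over a nonempty finite index set is the maximum.
\<close>
definition uniform_bound :: "'w measure \<Rightarrow> 'i set \<Rightarrow> ('i \<Rightarrow> 'w \<Rightarrow> complex^'n^'n) \<Rightarrow> ennreal"
  where "uniform_bound M I S =
    esssup M (\<lambda>\<omega>. SUP i\<in>I. ennreal (spectral_norm (S i \<omega> - integral\<^sup>L M (S i))))"

end

theory Submission
  imports Defs
begin

text \<open>
  Write \<open>X = A + \<Sum>\<^sub>i Y\<^sub>i\<close> with centred summands and interpolate along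
  \<open>A + sin t (\<Sum>\<^sub>i Y\<^sub>i) + cos t G\<close>, where \<open>G\<close> is centred Gaussian with the covariance of \<open>X\<close>.
  Put \<open>\<eta> = |Im \<zeta>|\<close>. If \<open>4 p L > \<eta>\<close>, the term with \<open>L\<^sup>3\<close> already exceeds the trivial bound
  \<open>1 / \<eta>\<close>, so assume \<open>4 p L \<le> \<eta>\<close>. In the derivative of \<open>E tr |R|\<^sup>2\<^sup>p\<close> Gaussian integration
  by parts cancels the second-order terms, and what remains are third-order traces
  \<open>tr (P\<^sub>1 V\<^sub>1 P\<^sub>2 V\<^sub>2 P\<^sub>3 V\<^sub>3)\<close> with words \<open>P\<^sub>k\<close> in the resolvents and \<open>V\<^sub>k\<close> equal to \<open>Y\<^sub>i\<close> or an
  independent copy. Cauchy--Schwarz bounds them by \<open>L tr |R|\<^sup>q V\<^sup>2\<close>; along the segment that switches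
  \<open>Y\<^sub>i\<close> on and off such traces change by at most a constant factor, because \<open>4 p L \<le> \<eta>\<close>, and this
  removes the dependence between \<open>R\<close> and \<open>Y\<^sub>i\<close>. Summing over \<open>i\<close> produces the matrix variance.
\<close>

section \<open>Matrices and the spectral theorem\<close>

text \<open>The bound must not see the dimension. Third-order words have total length 2p + 3, so the
  natural majorant is \<eta>^(-4) times the odd power t^(2p-1), while only even powers are traces of
  balanced words. The inequality t \<le> (\<kappa> t^2 + 1/\<kappa>)/2 trades the odd power for the
  powers 2p and 2p - 2. The weight \<kappa> stays free until the end, where the reciprocal of the
  current norm balances both terms and makes the speed of the norm bounded independently of its
  size. The obstacle in the decoupling is that the energy at the leave-one-out matrix is bounded by
  the energy at the full matrix plus a multiple of itself. The threshold 4pL \<le> \<eta> fixes a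
  growth rate of 1/4, for which this multiple, (E - 1) E^2, is below 1 and can be absorbed; the
  total cost is a factor 12. The path by sine and cosine keeps the covariance constant and has
  bounded speed at both ends. Its error rate cos t (sin t)^2 integrates to 1/3. With at most 24 p^3
  third-order words and the factor 1/(2p) from the root, 12 * 24 p^3 / (2p) / 3 = 48 p^2.\<close>

lemma matrix_mult_component: "(A ** B) $ i $ j = (\<Sum>k\<in>UNIV. A $ i $ k * B $ k $ j)"
  by (simp add: matrix_matrix_mult_def)

lemma conj_transpose_component [simp]: "conj_transpose A $ i $ j = cnj (A $ j $ i)"
  by (simp add: conj_transpose_def)

lemma matrix_mult_scaleR:
  fixes A :: "complex^'n^'m" and B :: "complex^'k^'n"
  shows "(r *\<^sub>R A) ** B = r *\<^sub>R (A ** B)" "A ** (r *\<^sub>R B) = r *\<^sub>R (A ** B)"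
  by (simp_all add: vec_eq_iff matrix_mult_component scaleR_sum_right)

lemma bounded_bilinear_matrix_mult:
  "bounded_bilinear (\<lambda>(A :: complex^'n^'m) (B :: complex^'k^'n). A ** B)"
  unfolding bilinear_conv_bounded_bilinear[symmetric] bilinear_def
  by (auto intro!: linearI simp: vec_eq_iff matrix_mult_component scaleR_sum_right
      ring_distribs sum.distrib)

interpretation matrix_mult: bounded_bilinear
  "\<lambda>(A :: complex^'n^'m) (B :: complex^'k^'n). A ** B"
  by (rule bounded_bilinear_matrix_mult)

lemmas [continuous_intros] = matrix_mult.continuous_on

lemma bounded_linear_conj_transpose: "bounded_linear (conj_transpose :: complex^'n^'m \<Rightarrow> _)"
  by (auto intro!: linearI simp: linear_conv_bounded_linear[symmetric] vec_eq_iff)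

lemma bounded_linear_trace: "bounded_linear (trace :: complex^'n^'n \<Rightarrow> complex)"
  by (auto intro!: linearI
      simp: linear_conv_bounded_linear[symmetric] trace_def sum.distrib scaleR_sum_right)

lemmas trace_simps = linear_simps[OF bounded_linear_trace]
lemmas conj_transpose_simps = linear_simps[OF bounded_linear_conj_transpose]

lemma conj_transpose_mult: "conj_transpose (A ** B) = conj_transpose B ** conj_transpose A"
  by (simp add: vec_eq_iff matrix_mult_component mult.commute)

lemma conj_transpose_conj_transpose [simp]: "conj_transpose (conj_transpose A) = A"
  by (simp add: vec_eq_iff)

lemma conj_transpose_mat_1 [simp]: "conj_transpose (mat 1) = mat 1"
  by (simp add: vec_eq_iff mat_def)

lemma trace_conj_transpose: "trace (conj_transpose A) = cnj (trace A)"
  by (simp add: trace_def)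

text \<open>The library's real inner product on matrices is the real Hilbert-Schmidt product, so
  Cauchy-Schwarz for traces comes for free.\<close>

lemma inner_matrix_eq_trace:
  fixes A B :: "complex^'n^'m"
  shows "A \<bullet> B = Re (trace (A ** conj_transpose B))"
  by (simp add: inner_vec_def trace_def matrix_mult_component inner_complex_def)

lemma norm_matrix_sq:
  fixes A :: "complex^'n^'m"
  shows "(norm A)\<^sup>2 = (\<Sum>i\<in>UNIV. \<Sum>j\<in>UNIV. (cmod (A $ i $ j))\<^sup>2)"
  by (simp add: power2_norm_eq_inner inner_vec_def)

lemma norm_conj_transpose: "norm (conj_transpose A) = norm (A :: complex^'n^'m)"
proof -
  have "(norm (conj_transpose A))\<^sup>2 = (norm A)\<^sup>2"
    unfolding norm_matrix_sq by (subst sum.swap) simp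
  then show ?thesis by simp
qed

lemma abs_Re_trace_mult_le:
  fixes A :: "complex^'n^'m" and B :: "complex^'m^'n"
  shows "\<bar>Re (trace (A ** B))\<bar> \<le> norm A * norm B"
  using Cauchy_Schwarz_ineq2[of A "conj_transpose B"]
  by (simp add: inner_matrix_eq_trace norm_conj_transpose)

section \<open>Operator norm against Frobenius norm\<close>

lemma bounded_linear_matrix_vector_mult: "bounded_linear ((*v) (A :: complex^'n^'m))"
  by (auto intro!: linearI
      simp: linear_conv_bounded_linear[symmetric] matrix_vector_right_distrib
        matrix_vector_mult_def vec_eq_iff scaleR_sum_right sum.distrib ring_distribs)

lemma norm_mult_vector_le: "norm (A *v x) \<le> spectral_norm A * norm x"
  unfolding spectral_norm_def by (rule onorm[OF bounded_linear_matrix_vector_mult])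

lemma spectral_norm_nonneg: "0 \<le> spectral_norm A"
  unfolding spectral_norm_def by (rule onorm_pos_le[OF bounded_linear_matrix_vector_mult])

text \<open>Column by column. Extracting the operator norm of one factor, and not its Frobenius
  norm, is what keeps the main estimate free of the dimension.\<close>

lemma norm_matrix_mult_le_left:
  fixes A :: "complex^'n^'n" and B :: "complex^'k^'n"
  shows "norm (A ** B) \<le> spectral_norm A * norm B"
proof (rule power2_le_imp_le)
  have col: "(norm (C :: complex^'k^'n))\<^sup>2 = (\<Sum>j\<in>UNIV. (norm (column j C))\<^sup>2)" for C
    unfolding norm_matrix_sq
    by (subst sum.swap) (simp add: power2_norm_eq_inner inner_vec_def column_def)
  have "(norm (A ** B))\<^sup>2 = (\<Sum>j\<in>UNIV. (norm (A *v column j B))\<^sup>2)"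
    unfolding col
    by (simp add: column_def matrix_matrix_mult_def matrix_vector_mult_def)
  also have "\<dots> \<le> (\<Sum>j\<in>UNIV. (spectral_norm A * norm (column j B))\<^sup>2)"
    by (intro sum_mono power_mono norm_mult_vector_le) auto
  also have "\<dots> = (spectral_norm A * norm B)\<^sup>2"
    by (simp add: power_mult_distrib sum_distrib_left col)
  finally show "(norm (A ** B))\<^sup>2 \<le> (spectral_norm A * norm B)\<^sup>2" .
qed (simp add: spectral_norm_nonneg)

lemma spectral_norm_le:
  assumes "\<And>x. norm (A *v x) \<le> c * norm x"
  shows "spectral_norm A \<le> c"
  unfolding spectral_norm_def using assms by (rule onorm_le)

lemma spectral_norm_le_norm: "spectral_norm A \<le> norm A"
proof (rule spectral_norm_le, rule power2_le_imp_le)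
  fix x
  have "(norm (A *v x))\<^sup>2 = (\<Sum>i\<in>UNIV. (cmod (\<Sum>j\<in>UNIV. A $ i $ j * x $ j))\<^sup>2)"
    by (simp add: power2_norm_eq_inner inner_vec_def matrix_vector_mult_def)
  also have "\<dots> \<le> (\<Sum>i\<in>UNIV. (\<Sum>j\<in>UNIV. cmod (A $ i $ j) * cmod (x $ j))\<^sup>2)"
    by (intro sum_mono power_mono order_trans[OF norm_sum]) (auto simp: norm_mult)
  also have "\<dots> \<le> (\<Sum>i\<in>UNIV. (\<Sum>j\<in>UNIV. (cmod (A $ i $ j))\<^sup>2) * (\<Sum>j\<in>UNIV. (cmod (x $ j))\<^sup>2))"
    by (intro sum_mono Cauchy_Schwarz_ineq_sum)
  also have "\<dots> = (norm A * norm x)\<^sup>2"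
    by (simp add: sum_distrib_right[symmetric] power_mult_distrib norm_matrix_sq)
       (simp add: power2_norm_eq_inner inner_vec_def)
  finally show "(norm (A *v x))\<^sup>2 \<le> (norm A * norm x)\<^sup>2" .
qed simp

lemma norm_matrix_mult_le:
  fixes A :: "complex^'n^'n" and B :: "complex^'k^'n"
  shows "norm (A ** B) \<le> norm A * norm B"
  using norm_matrix_mult_le_left[of A B] mult_right_mono[OF spectral_norm_le_norm[of A], of "norm B"]
  by simp

section \<open>Self-adjoint and unitary matrices\<close>

lemma self_adjoint_component: "self_adjoint A \<Longrightarrow> A $ j $ i = cnj (A $ i $ j)"
  unfolding self_adjoint_def by (metis conj_transpose_component)

lemma unitary_conj_transpose: "unitary U \<Longrightarrow> unitary (conj_transpose U)"
  by (simp add: unitary_def)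

lemma unitaryD:
  assumes "unitary U"
  shows "conj_transpose U ** U = mat 1" "U ** conj_transpose U = mat 1"
  using assms by (auto simp: unitary_def)

lemma norm_unitary_mult:
  fixes U :: "complex^'n^'n" and A :: "complex^'k^'n"
  assumes "unitary U"
  shows "norm (U ** A) = norm A"
proof -
  have "trace ((U ** A) ** conj_transpose (U ** A)) = trace (A ** conj_transpose A)"
    using unitaryD[OF assms]
    by (metis conj_transpose_mult matrix_mul_assoc matrix_mul_lid trace_mul_sym)
  then have "(norm (U ** A))\<^sup>2 = (norm A)\<^sup>2"
    by (simp add: power2_norm_eq_inner inner_matrix_eq_trace)
  then show ?thesis by simp
qed

lemma norm_mult_unitary:
  fixes U :: "complex^'n^'n" and A :: "complex^'n^'k"
  assumes "unitary U"
  shows "norm (A ** U) = norm A"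
  using norm_unitary_mult[OF unitary_conj_transpose[OF assms], of "conj_transpose A"]
  by (metis conj_transpose_mult norm_conj_transpose)

lemma norm_unitary_mult_vector:
  fixes U :: "complex^'n^'n"
  assumes "unitary U"
  shows "norm (U *v x) = norm x"
proof -
  \<comment> \<open>The vector becomes a one-column matrix, so that the invariance of the Frobenius
    norm applies to it.\<close>
  define B :: "complex^1^'n" where "B = (\<chi> i j. x $ i)"
  have n: "norm (\<chi> i (j::1). (y :: complex^'n) $ i) = norm y" for y
  proof -
    have "(norm (\<chi> i (j::1). y $ i))\<^sup>2 = (norm y)\<^sup>2"
      unfolding norm_matrix_sq by (simp add: power2_norm_eq_inner inner_vec_def)
    then show ?thesis by simp
  qed
  have "U ** B = (\<chi> i j. (U *v x) $ i)"
    by (simp add: B_def vec_eq_iff matrix_mult_component matrix_vector_mult_def)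
  then show ?thesis
    using norm_unitary_mult[OF assms, of B] n[of "U *v x"] n[of x] by (simp add: B_def)
qed

lemma spectral_norm_unitary_conj_le:
  assumes "unitary U"
  shows "spectral_norm (conj_transpose U ** A ** U) \<le> spectral_norm A"
proof (rule spectral_norm_le)
  fix x
  have "norm ((conj_transpose U ** A ** U) *v x) = norm (A *v (U *v x))"
    by (simp add: matrix_vector_mul_assoc[symmetric]
        norm_unitary_mult_vector[OF unitary_conj_transpose[OF assms]])
  also have "\<dots> \<le> spectral_norm A * norm x"
    using norm_mult_vector_le[of A "U *v x"] norm_unitary_mult_vector[OF assms] by simp
  finally show "norm ((conj_transpose U ** A ** U) *v x) \<le> spectral_norm A * norm x" .
qed

text \<open>The library inner product on this type is only the real part of this form;
  orthonormality over the complex field needs the sesquilinear one.\<close>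

definition cinner :: "complex^'n \<Rightarrow> complex^'n \<Rightarrow> complex"
  where "cinner x y = (\<Sum>i\<in>UNIV. x $ i * cnj (y $ i))"

lemma cinner_simps:
  "cinner (x + y) z = cinner x z + cinner y z" "cinner (x - y) z = cinner x z - cinner y z"
  "cinner (c *s x) z = c * cinner x z" "cinner (r *\<^sub>R x) z = r *\<^sub>R cinner x z"
  by (simp_all add: cinner_def sum.distrib sum_subtractf sum_distrib_left scaleR_sum_right
      ring_distribs mult.assoc)

lemma cinner_commute: "cinner x y = cnj (cinner y x)"
  by (simp add: cinner_def mult.commute)

lemma Re_cinner: "Re (cinner x y) = x \<bullet> y"
  by (simp add: cinner_def inner_vec_def inner_complex_def)

lemma cinner_self: "cinner x x = complex_of_real ((norm x)\<^sup>2)"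
  unfolding power2_norm_eq_inner
  by (simp add: cinner_def inner_vec_def complex_mult_cnj cmod_power2 flip: power2_norm_eq_inner)

lemma self_adjoint_cinner:
  assumes "self_adjoint A"
  shows "cinner (A *v x) y = cinner x (A *v y)"
proof -
  have c: "cnj (A $ i $ j) = A $ j $ i" for i j
    using self_adjoint_component[OF assms] by metis
  have "cinner (A *v x) y = (\<Sum>i\<in>UNIV. \<Sum>j\<in>UNIV. A $ i $ j * x $ j * cnj (y $ i))"
    by (simp add: cinner_def matrix_vector_mult_def sum_distrib_right)
  also have "\<dots> = (\<Sum>j\<in>UNIV. \<Sum>i\<in>UNIV. A $ i $ j * x $ j * cnj (y $ i))"
    by (rule sum.swap)
  also have "\<dots> = cinner x (A *v y)"
    by (simp add: cinner_def matrix_vector_mult_def sum_distrib_left c mult_ac)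
  finally show ?thesis .
qed

text \<open>A maximizer of the quadratic form on the unit sphere of the orthogonal complement of the
  eigenvectors found so far is a further eigenvector.\<close>
lemma self_adjoint_eigenvectors:
  fixes A :: "complex^'n^'n" and J :: "'n set"
  assumes A: "self_adjoint A"
  shows "\<exists>f v. \<forall>i\<in>J. A *v f i = complex_of_real (v i) *s f i
    \<and> (\<forall>j\<in>J. cinner (f i) (f j) = (if i = j then 1 else 0))"
proof -
  have "finite J" by simp
  then show ?thesis
  proof (induction J rule: finite_induct)
    case empty
    then show ?case by simp
  next
    case (insert k J)
    from insert.IH obtain f v where fv: "\<forall>i\<in>J. A *v f i = complex_of_real (v i) *s f i
        \<and> (\<forall>j\<in>J. cinner (f i) (f j) = (if i = j then 1 else 0))"
      by (elim exE) (rule that)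
    have f: "A *v f i = complex_of_real (v i) *s f i" if "i \<in> J" for i
      using fv that by simp
    have o: "cinner (f i) (f j) = (if i = j then 1 else 0)" if "i \<in> J" "j \<in> J" for i j
      using fv that by simp
    \<comment> \<open>\<open>\<phi>\<close> is a real-linear endomorphism recording the coordinates
      along the eigenvectors already found. Coordinate \<open>k\<close> is always 0, so it is not
      onto; hence it is not injective, and its kernel has room for a further vector.\<close>
    define \<phi> where "\<phi> x = (\<chi> i. if i \<in> J then cinner x (f i) else 0)" for x
    define W where "W = {x. \<phi> x = 0}"
    have lin: "linear \<phi>"
      by (auto intro!: linearI simp: \<phi>_def vec_eq_iff cinner_simps)
    have "\<not> surj \<phi>"
    proof
      assume "surj \<phi>"
      then obtain x where "axis k 1 = \<phi> x" by (metis surjD)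
      then have "axis k 1 $ k = \<phi> x $ k" by simp
      then show False using insert.hyps by (simp add: \<phi>_def)
    qed
    then have "\<not> inj \<phi>" using linear_injective_imp_surjective[OF lin] by blast
    then obtain z where z: "z \<noteq> 0" "\<phi> z = 0"
      using linear_injective_0[OF lin] by blast
    have cW: "closed W" unfolding W_def
      by (intro closed_Collect_eq continuous_intros linear_continuous_on
          lin[unfolded linear_conv_bounded_linear])
    have Wiff: "x \<in> W \<longleftrightarrow> (\<forall>i\<in>J. cinner x (f i) = 0)" for x
      by (auto simp: W_def \<phi>_def vec_eq_iff)
    define q where "q x = (A *v x) \<bullet> x" for x
    have cq: "continuous_on S q" for S
      unfolding q_def by (intro continuous_intros linear_continuous_on bounded_linear_matrix_vector_mult)
    have "compact (W \<inter> sphere 0 1)" using cW by (auto simp: closed_Int_compact)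
    moreover have "(1 / norm z) *\<^sub>R z \<in> W \<inter> sphere 0 1"
    proof -
      have "z \<in> W" using z by (simp add: W_def)
      then show ?thesis using z by (simp add: Wiff cinner_simps)
    qed
    ultimately obtain x where "x \<in> W \<inter> sphere 0 1"
      and mx': "\<forall>y\<in>W \<inter> sphere 0 1. q y \<le> q x"
      using continuous_attains_sup[of "W \<inter> sphere 0 1" q] cq by blast
    then have x: "x \<in> W" "norm x = 1" by auto
    have mx: "q y \<le> q x" if "y \<in> W" "norm y = 1" for y
      using mx' that by auto
    define \<mu> where "\<mu> = q x"
    have hom: "q (r *\<^sub>R y) = r\<^sup>2 * q y" for r y
      using bounded_linear_matrix_vector_mult[of A]
      by (simp add: q_def bounded_linear.linear linear_scale power2_eq_square)
    have le: "q y \<le> \<mu> * (y \<bullet> y)" if "y \<in> W" for y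
    proof (cases "y = 0")
      case False
      have "(1 / norm y) *\<^sub>R y \<in> W" using that by (simp add: Wiff cinner_simps)
      then have "q ((1 / norm y) *\<^sub>R y) \<le> \<mu>" using False unfolding \<mu>_def by (intro mx) auto
      then show ?thesis using False
        by (simp add: hom field_simps power2_norm_eq_inner[symmetric])
    qed (simp add: q_def)
    define y where "y = A *v x - \<mu> *\<^sub>R x"
    have AW: "A *v x \<in> W"
      unfolding Wiff
    proof
      fix i assume i: "i \<in> J"
      have "cinner (A *v x) (f i) = cnj (cinner (complex_of_real (v i) *s f i) x)"
        using self_adjoint_cinner[OF A] f[OF i] cinner_commute by metis
      also have "\<dots> = v i * cinner x (f i)"
        by (simp add: cinner_simps cinner_commute[of "f i" x])
      finally show "cinner (A *v x) (f i) = 0" using x i Wiff by auto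
    qed
    have yW: "y \<in> W" using AW x unfolding Wiff y_def by (simp add: cinner_simps)
    have sym: "(A *v a) \<bullet> b = a \<bullet> (A *v b)" for a b
      using self_adjoint_cinner[OF A, of a b] by (metis Re_cinner)
    note linA = bounded_linear.linear[OF bounded_linear_matrix_vector_mult[of A]]
    have addA: "A *v (a + r *\<^sub>R b) = A *v a + r *\<^sub>R (A *v b)"
      "A *v (r *\<^sub>R b) = r *\<^sub>R (A *v b)" for a b r
      by (simp_all only: linear_add[OF linA] linear_scale[OF linA])
    \<comment> \<open>Moving the maximizer \<open>x\<close> by t times the residual \<open>y\<close>
      gains 2t |y|^2 to first order over the multiple \<mu> of the squared norm. Maximality bounds
      the gain by a second-order term, so letting t tend to 0 forces the residual to vanish.\<close>
    have main: "2 * (y \<bullet> y) \<le> t * (\<mu> * (y \<bullet> y) - q y)" if "t > 0" for t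
    proof -
      have "x + t *\<^sub>R y \<in> W" using x yW by (simp add: Wiff cinner_simps)
      then have a: "q (x + t *\<^sub>R y) \<le> \<mu> * ((x + t *\<^sub>R y) \<bullet> (x + t *\<^sub>R y))" by (rule le)
      have b: "q (x + t *\<^sub>R y) = \<mu> + 2 * t * ((A *v x) \<bullet> y) + t\<^sup>2 * q y"
        unfolding \<mu>_def
        using sym[of y x] by (simp add: q_def addA inner_simps power2_eq_square algebra_simps inner_commute)
      have c: "(x + t *\<^sub>R y) \<bullet> (x + t *\<^sub>R y) = 1 + 2 * t * (x \<bullet> y) + t\<^sup>2 * (y \<bullet> y)"
        using x(2) by (simp add: inner_simps power2_eq_square algebra_simps inner_commute norm_eq_sqrt_inner)
      have "t * (2 * ((A *v x) \<bullet> y - \<mu> * (x \<bullet> y)) + t * (q y - \<mu> * (y \<bullet> y))) \<le> t * 0"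
        using a unfolding b c by (simp add: algebra_simps power2_eq_square)
      then have "2 * ((A *v x) \<bullet> y - \<mu> * (x \<bullet> y)) + t * (q y - \<mu> * (y \<bullet> y)) \<le> 0"
        using that by (simp add: mult_le_0_iff)
      moreover have "(A *v x) \<bullet> y - \<mu> * (x \<bullet> y) = y \<bullet> y"
        unfolding y_def by (simp add: inner_simps inner_commute algebra_simps)
      ultimately show ?thesis by (simp add: algebra_simps)
    qed
    define N where "N = y \<bullet> y"
    define D where "D = \<mu> * (y \<bullet> y) - q y"
    have "N \<le> 0"
    proof (rule ccontr)
      assume "\<not> N \<le> 0"
      then have p: "N > 0" by simp
      have m: "2 * N \<le> t * D" if "t > 0" for t
        using main[OF that] by (simp only: N_def D_def)
      have D: "D > 0" using m[of 1] p by simp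
      show False using m[of "N / D"] p D by simp
    qed
    then have "N = 0" using inner_ge_zero[of y] unfolding N_def by (rule antisym)
    then have "y = 0" by (simp add: N_def)
    then have "A *v x = \<mu> *\<^sub>R x" by (simp add: y_def)
    then have ev: "A *v x = complex_of_real \<mu> *s x" by (simp add: vec_eq_iff scaleR_conv_of_real[where 'a = complex])
    define g where "g = f(k := x)"
    define w where "w = v(k := \<mu>)"
    have gs: "g k = x" "w k = \<mu>" "i \<in> J \<Longrightarrow> g i = f i" "i \<in> J \<Longrightarrow> w i = v i" for i
      using insert.hyps by (auto simp: g_def w_def)
    have xf: "cinner x (f i) = 0" "cinner (f i) x = 0" if "i \<in> J" for i
      using x that Wiff cinner_commute[of "f i" x] by auto
    have xx: "cinner x x = 1" using x by (simp add: cinner_self)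
    show ?case
    proof (intro exI ballI conjI)
      fix i assume i: "i \<in> insert k J"
      show "A *v g i = complex_of_real (w i) *s g i" using i f ev gs by auto
      fix j assume j: "j \<in> insert k J"
      show "cinner (g i) (g j) = (if i = j then 1 else 0)"
        using i j insert.hyps gs xf xx o by auto
    qed
  qed
qed

theorem self_adjoint_diagonalization:
  fixes A :: "complex^'n^'n"
  assumes A: "self_adjoint A"
  obtains U v where "unitary U" "A = U ** real_diag v ** conj_transpose U"
proof -
  from self_adjoint_eigenvectors[OF A, of UNIV]
  obtain f :: "'n \<Rightarrow> complex^'n" and v where fv: "\<forall>i\<in>UNIV. A *v f i = complex_of_real (v i) *s f i
      \<and> (\<forall>j\<in>UNIV. cinner (f i) (f j) = (if i = j then 1 else 0))"
    by (elim exE) (rule that)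
  have f: "A *v f i = complex_of_real (v i) *s f i" for i
    using fv by simp
  have o: "cinner (f i) (f j) = (if i = j then 1 else 0)" for i j
    using fv by simp
  define U :: "complex^'n^'n" where "U = (\<chi> i j. f j $ i)"
  have 1: "conj_transpose U ** U = mat 1"
    using o by (auto simp: vec_eq_iff matrix_mult_component U_def mat_def cinner_def mult.commute)
  then have U: "unitary U" using matrix_left_right_inverse unfolding unitary_def by blast
  have "A ** U = U ** real_diag v"
    using f by (auto simp: vec_eq_iff matrix_mult_component matrix_vector_mult_def U_def
        real_diag_def if_distrib mult.commute cong: if_cong)
  then have "A = U ** real_diag v ** conj_transpose U"
    using unitaryD[OF U] by (metis matrix_mul_assoc matrix_mul_rid)
  with U that show ?thesis by blast
qed

section \<open>Words in resolvents\<close>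

definition cdiag :: "('n \<Rightarrow> complex) \<Rightarrow> complex^'n^'n"
  where "cdiag c = (\<chi> i j. if i = j then c i else 0)"

lemma cdiag_mult_component:
  "(cdiag c ** A) $ i $ j = c i * A $ i $ j" "(A ** cdiag c) $ i $ j = A $ i $ j * c j"
  by (simp_all add: matrix_mult_component cdiag_def if_distrib if_distribR cong: if_cong)

lemma cdiag_component: "cdiag c $ i $ j = (if i = j then c i else 0)"
  by (simp add: cdiag_def)

lemma cdiag_mult: "cdiag a ** cdiag b = cdiag (\<lambda>i. a i * b i)"
  by (simp add: vec_eq_iff cdiag_mult_component) (simp add: cdiag_component)

lemma cdiag_1: "cdiag (\<lambda>i. 1) = mat 1"
  by (simp add: vec_eq_iff cdiag_def mat_def)

lemma trace_cdiag: "trace (cdiag c) = (\<Sum>i\<in>UNIV. c i)"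
  by (simp add: trace_def cdiag_component)

lemma trace_unitary_conj:
  assumes "unitary U"
  shows "trace (U ** A ** conj_transpose U) = trace A"
  using unitaryD[OF assms] by (metis matrix_mul_assoc matrix_mul_lid trace_mul_sym)

lemma unitary_conj_mult:
  assumes "unitary U"
  shows "(U ** A ** conj_transpose U) ** (U ** B ** conj_transpose U) = U ** (A ** B) ** conj_transpose U"
  using unitaryD[OF assms] by (metis matrix_mul_assoc matrix_mul_lid)

lemma
  fixes U :: "complex^'n^'n" and v :: "'n \<Rightarrow> real"
  assumes U: "unitary U" and z: "Im z \<noteq> 0"
  defines "A \<equiv> U ** real_diag v ** conj_transpose U"
  shows resolvent_unitary_conj:
      "resolvent z A = U ** cdiag (\<lambda>i. 1 / (z - of_real (v i))) ** conj_transpose U"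
    and mult_resolvent_unitary_conj:
      "(mat z - A) ** resolvent z A = mat 1 \<and> resolvent z A ** (mat z - A) = mat 1"
proof -
  define B where "B = U ** cdiag (\<lambda>i. 1 / (z - of_real (v i))) ** conj_transpose U"
  have ne: "z - of_real (v i) \<noteq> 0" for i using z by (auto simp: complex_eq_iff)
  have "mat z = U ** cdiag (\<lambda>i. z) ** conj_transpose U"
  proof -
    have "U ** cdiag (\<lambda>i. z) = cdiag (\<lambda>i. z) ** U"
      by (simp add: vec_eq_iff cdiag_mult_component)
    moreover have "mat z = cdiag (\<lambda>i. z)" by (simp add: vec_eq_iff cdiag_def mat_def)
    ultimately show ?thesis using unitaryD[OF U] by (metis matrix_mul_assoc matrix_mul_rid)
  qed
  then have "mat z - A = U ** (cdiag (\<lambda>i. z) - real_diag v) ** conj_transpose U"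
    by (simp add: A_def matrix_mult.diff_left matrix_mult.diff_right)
  also have "cdiag (\<lambda>i. z) - real_diag v = cdiag (\<lambda>i. z - of_real (v i))"
    by (simp add: vec_eq_iff cdiag_def real_diag_def)
  finally have A: "mat z - A = U ** cdiag (\<lambda>i. z - of_real (v i)) ** conj_transpose U" .
  have AB: "(mat z - A) ** B = mat 1 \<and> B ** (mat z - A) = mat 1"
    unfolding A B_def unitary_conj_mult[OF U] cdiag_mult using ne unitaryD[OF U]
    by (simp add: cdiag_1)
  \<comment> \<open>\<open>matrix_inv\<close> is a choice operator; exhibiting the two-sided inverse
    \<open>B\<close> makes its value an inverse, and uniqueness of inverses then identifies it with
    \<open>B\<close>.\<close>
  then show inv: "(mat z - A) ** resolvent z A = mat 1 \<and> resolvent z A ** (mat z - A) = mat 1"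
    unfolding resolvent_def matrix_inv_def by (rule someI)
  show "resolvent z A = U ** cdiag (\<lambda>i. 1 / (z - of_real (v i))) ** conj_transpose U"
    using AB inv unfolding B_def[symmetric] by (metis matrix_mul_assoc matrix_mul_lid matrix_mul_rid)
qed

definition herm :: "complex^'n^'n \<Rightarrow> complex^'n^'n"
  where "herm A = (1/2) *\<^sub>R (A + conj_transpose A)"

lemma self_adjoint_herm: "self_adjoint (herm A)"
  by (simp add: self_adjoint_def herm_def vec_eq_iff add.commute)

lemma herm_self_adjoint: "self_adjoint A \<Longrightarrow> herm A = A"
  by (simp add: self_adjoint_def herm_def scaleR_2[symmetric])

lemma bounded_linear_herm: "bounded_linear herm"
  unfolding herm_def
  by (intro bounded_linear_const_scaleR bounded_linear_add bounded_linear_ident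
      bounded_linear_conj_transpose)

lemma norm_herm_le: "norm (herm A) \<le> norm A"
  using norm_triangle_ineq[of A "conj_transpose A"] by (simp add: herm_def norm_conj_transpose)

locale resolvent_words =
  fixes \<zeta> :: complex
  assumes nonreal: "Im \<zeta> \<noteq> 0"
begin

definition \<eta> :: real where "\<eta> = \<bar>Im \<zeta>\<bar>"

lemma \<eta>_pos: "\<eta> > 0" using nonreal by (simp add: \<eta>_def)

text \<open>Inserting \<^const>\<open>herm\<close> makes the resolvent continuous on all matrices without changing it on
  the self-adjoint ones.\<close>
definition res :: "bool \<Rightarrow> complex^'n^'n \<Rightarrow> complex^'n^'n"
  where "res b M = resolvent (if b then \<zeta> else cnj \<zeta>) (herm M)"

text \<open>The letter \<open>True\<close> stands for the resolvent at \<zeta>, \<open>False\<close>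
  for its adjoint, the resolvent at the conjugate point. Products of these are closed under the
  differentiations below.\<close>

definition word :: "bool list \<Rightarrow> complex^'n^'n \<Rightarrow> complex^'n^'n"
  where "word bs M = foldr (\<lambda>b B. res b M ** B) bs (mat 1)"

text \<open>The word of \<open>bal m\<close> is |R|^(2m): the letters commute, and R times its
  adjoint is |R|^2.\<close>

definition bal :: "nat \<Rightarrow> bool list"
  where "bal m = replicate m True @ replicate m False"

lemma word_simps [simp]: "word [] M = mat 1" "word (b # bs) M = res b M ** word bs M"
  by (simp_all add: word_def)

lemma word_append: "word (as @ bs) M = word as M ** word bs M"
  by (induction as) (simp_all add: matrix_mul_assoc)

lemma length_bal [simp]: "length (bal m) = 2 * m"
  by (simp add: bal_def)

text \<open>All words in one matrix are functions of it, so one unitary diagonalizes them together.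
  A real eigenvalue is equally far from \<zeta> and from its conjugate; therefore the modulus of an
  eigenvalue of a word depends on the length alone. This turns trace inequalities into scalar ones
  on the interval from 0 to 1/\<eta>.\<close>

lemma word_diagonalization:
  fixes M :: "complex^'n^'n"
  obtains U :: "complex^'n^'n" and d :: "'n \<Rightarrow> real" and w :: "bool list \<Rightarrow> 'n \<Rightarrow> complex"
  where "unitary U" "\<forall>i. 0 < d i \<and> d i \<le> 1 / \<eta>"
    "\<forall>bs. word bs M = U ** cdiag (w bs) ** conj_transpose U"
    "\<forall>bs i. cmod (w bs i) = d i ^ length bs"
    "\<forall>m i. w (bal m) i = of_real (d i ^ (2 * m))"
proof -
  obtain U v where U: "unitary U" and M: "herm M = U ** real_diag v ** conj_transpose U"
    using self_adjoint_diagonalization[OF self_adjoint_herm] .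
  define r where "r b i = 1 / ((if b then \<zeta> else cnj \<zeta>) - of_real (v i))" for b i
  define d where "d i = 1 / cmod (\<zeta> - of_real (v i))" for i
  define w where "w bs i = (\<Prod>b\<leftarrow>bs. r b i)" for bs i
  have ne: "\<zeta> \<noteq> of_real (v i)" for i using nonreal by auto
  have le: "\<eta> \<le> cmod (\<zeta> - of_real (v i))" for i
    using abs_Im_le_cmod[of "\<zeta> - of_real (v i)"] by (simp add: \<eta>_def)
  have r: "res b M = U ** cdiag (r b) ** conj_transpose U" for b
    unfolding res_def M r_def using nonreal by (intro resolvent_unitary_conj U) auto
  have w_simps: "w [] = (\<lambda>i. 1)" "w (b # bs) = (\<lambda>i. r b i * w bs i)" for b bs
    by (simp_all add: w_def fun_eq_iff)
  have 1: "word bs M = U ** cdiag (w bs) ** conj_transpose U" for bs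
  proof (induction bs)
    case Nil
    have "U ** cdiag (w []) ** conj_transpose U = mat 1"
      using unitaryD[OF U] w_simps by (simp add: cdiag_1)
    then show ?case by simp
  next
    case (Cons b bs)
    have "cdiag (r b) ** cdiag (w bs) = cdiag (w (b # bs))"
      by (simp add: cdiag_mult w_simps)
    then show ?case using Cons r unitary_conj_mult[OF U] by simp
  qed
  have rn: "cmod (r b i) = d i" for b i
  proof -
    have "cmod (cnj \<zeta> - of_real (v i)) = cmod (\<zeta> - of_real (v i))"
      by (metis complex_cnj_complex_of_real complex_cnj_diff complex_mod_cnj)
    then show ?thesis by (simp add: r_def d_def norm_divide)
  qed
  have rr: "r True i * r False i = of_real ((d i)\<^sup>2)" for i
  proof -
    have "r False i = cnj (r True i)" by (simp add: r_def)
    then show ?thesis using rn[of True i] by (simp add: complex_norm_square[symmetric])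
  qed
  have "w (bal m) i = of_real (d i ^ (2 * m))" for m i
    by (simp add: w_def bal_def power_mult_distrib[symmetric] rr power_mult prod_list_replicate)
  moreover have "cmod (w bs i) = d i ^ length bs" for bs i
    by (induction bs) (simp_all add: w_def norm_mult rn)
  moreover have "d i > 0" for i using ne by (simp add: d_def)
  moreover have "d i \<le> 1 / \<eta>" for i
    unfolding d_def using le \<eta>_pos by (intro frac_le) simp_all
  ultimately show ?thesis using that[of U d w] U 1 by simp
qed

text \<open>A crude bound containing the dimension. It serves differentiability and integrability,
  never the final constants.\<close>

lemma norm_word_le: "norm (word bs M :: complex^'n^'n) \<le> CARD('n) * (1 / \<eta>) ^ length bs"
proof -
  obtain U d w where U: "unitary U" and d: "\<forall>i. 0 < d i \<and> d i \<le> 1 / \<eta>"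
    and W: "\<forall>bs. word bs M = U ** cdiag (w bs) ** conj_transpose U"
    and w: "\<forall>bs i. cmod (w bs i) = d i ^ length bs" "\<forall>m i. w (bal m) i = of_real (d i ^ (2 * m))"
    using word_diagonalization[where M = M] .
  have "norm (word bs M) = norm (cdiag (w bs))"
    unfolding W[rule_format] by (simp add: norm_mult_unitary[OF unitary_conj_transpose[OF U]] norm_unitary_mult[OF U])
  also have "\<dots> \<le> (\<Sum>i\<in>UNIV. norm (cdiag (w bs) $ i))"
    unfolding norm_vec_def by (rule L2_set_le_sum) simp
  also have "\<dots> = (\<Sum>i\<in>UNIV. d i ^ length bs)"
  proof (rule sum.cong[OF refl])
    fix i
    have "(norm (cdiag (w bs) $ i))\<^sup>2 = (cmod (w bs i))\<^sup>2"
      by (simp add: power2_norm_eq_inner inner_vec_def cdiag_def if_distrib if_distribR cong: if_cong)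
    then have "norm (cdiag (w bs) $ i) = cmod (w bs i)" by simp
    then show "norm (cdiag (w bs) $ i) = d i ^ length bs" using w(1) by simp
  qed
  also have "\<dots> \<le> (\<Sum>i\<in>(UNIV::'n set). (1 / \<eta>) ^ length bs)"
    using d by (intro sum_mono power_mono) (auto intro: less_imp_le)
  finally show ?thesis by simp
qed

section \<open>Resolvent identity and derivatives of words\<close>

lemma res_diff: "res b M' - res b M = res b M' ** herm (M' - M) ** res b M"
proof -
  define z where "z = (if b then \<zeta> else cnj \<zeta>)"
  have inv: "(mat z - herm A) ** res b A = mat 1 \<and> res b A ** (mat z - herm A) = mat 1" for A :: "complex^'n^'n"
  proof -
    obtain U v where U: "unitary U" and M: "herm A = U ** real_diag v ** conj_transpose U"
      using self_adjoint_diagonalization[OF self_adjoint_herm] .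
    have "Im z \<noteq> 0" using nonreal by (simp add: z_def)
    from mult_resolvent_unitary_conj[OF U this] show ?thesis
      unfolding res_def M z_def by simp
  qed
  have h: "herm (M' - M) = (mat z - herm M) - (mat z - herm M')"
    by (simp add: linear_simps[OF bounded_linear_herm])
  have "res b M' ** (mat z - herm M) ** res b M = res b M'"
    using inv[of M] by (simp only: matrix_mul_assoc[symmetric] matrix_mul_rid)
  moreover have "res b M' ** (mat z - herm M') ** res b M = res b M"
    using inv[of M'] by (simp only: matrix_mul_lid)
  ultimately show ?thesis
    unfolding h by (simp only: matrix_mult.diff_left matrix_mult.diff_right)
qed

text \<open>Two applications of the resolvent identity write the remainder as a product of three
  resolvents and two increments, hence of second order.\<close>

lemma has_derivative_res:
  "(res b has_derivative (\<lambda>V. res b M ** herm V ** res b M)) (at (M :: complex^'n^'n))"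
proof -
  define K where "K = CARD('n) * (1 / \<eta>)"
  have K: "norm (res b A) \<le> K" for A :: "complex^'n^'n"
    using norm_word_le[of "[b]" A] by (simp add: K_def)
  have mm: "norm (A ** B) \<le> norm A * norm B" for A B :: "complex^'n^'n"
    by (rule norm_matrix_mult_le)
  have K0: "0 \<le> K" using K[of 0] norm_ge_zero order_trans by blast
  have lip: "norm (res b A - res b M) \<le> K * K * norm (A - M)" for A
  proof -
    have "norm (res b A - res b M) \<le> norm (res b A) * norm (herm (A - M)) * norm (res b M)"
      unfolding res_diff by (intro order_trans[OF mm] mult_right_mono mm) auto
    also have "\<dots> \<le> K * norm (A - M) * K"
      using K K0 by (intro mult_mono norm_herm_le) auto
    finally show ?thesis by (simp add: mult_ac)
  qed
  have rem: "norm (res b A - res b M - res b M ** herm (A - M) ** res b M)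
      \<le> K * K * K * (norm (A - M))\<^sup>2" for A
  proof -
    have "res b A - res b M - res b M ** herm (A - M) ** res b M
        = (res b A - res b M) ** herm (A - M) ** res b M"
      by (subst res_diff) (simp add: matrix_mult.diff_left)
    also have "norm \<dots> \<le> norm (res b A - res b M) * norm (herm (A - M)) * norm (res b M)"
      by (intro order_trans[OF mm] mult_right_mono mm) auto
    also have "\<dots> \<le> (K * K * norm (A - M)) * norm (A - M) * K"
      using K K0 lip by (intro mult_mono norm_herm_le) auto
    finally show ?thesis by (simp add: mult_ac power2_eq_square)
  qed
  show ?thesis
  proof (rule has_derivativeI_sandwich[where e=1])
    show "bounded_linear (\<lambda>V. res b M ** herm V ** res b M)"
      using matrix_mult.bounded_linear_left matrix_mult.bounded_linear_right bounded_linear_herm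
      by (intro bounded_linear_compose[OF matrix_mult.bounded_linear_left]
          bounded_linear_compose[OF matrix_mult.bounded_linear_right] bounded_linear_herm)
    show "norm (res b A - res b M - res b M ** herm (A - M) ** res b M) / norm (A - M)
        \<le> K * K * K * norm (A - M)" if "A \<noteq> M" for A
      using rem[of A] that by (simp add: divide_le_eq power2_eq_square mult_ac)
    have "((\<lambda>A. K * K * K * norm (A - M)) \<longlongrightarrow> K * K * K * norm (M - M)) (at M)"
      by (intro tendsto_intros)
    then show "((\<lambda>A. K * K * K * norm (A - M)) \<longlongrightarrow> 0) (at M)" by simp
  qed simp
qed

text \<open>Differentiating a letter doubles it, with one copy on each side of the direction. Hence
  \<open>take (Suc l)\<close> and \<open>drop l\<close> overlap in letter \<open>l\<close>, and each
  derivative lengthens the word by one.\<close>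

lemma has_derivative_word:
  "(word bs has_derivative (\<lambda>V. \<Sum>l<length bs. word (take (Suc l) bs) M ** herm V ** word (drop l bs) M))
    (at (M :: complex^'n^'n))"
proof (induction bs)
  case Nil
  then show ?case by simp
next
  case (Cons b bs)
  have "((\<lambda>A. res b A ** word bs A) has_derivative
     (\<lambda>V. res b M ** (\<Sum>l<length bs. word (take (Suc l) bs) M ** herm V ** word (drop l bs) M)
        + (res b M ** herm V ** res b M) ** word bs M)) (at M)"
    by (intro matrix_mult.FDERIV has_derivative_res Cons.IH)
  moreover have "res b M ** (\<Sum>l<length bs. word (take (Suc l) bs) M ** herm V ** word (drop l bs) M)
        + (res b M ** herm V ** res b M) ** word bs M
      = (\<Sum>l<length (b # bs). word (take (Suc l) (b # bs)) M ** herm V ** word (drop l (b # bs)) M)" for V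
    by (simp add: sum.lessThan_Suc_shift matrix_mult.sum_right matrix_mul_assoc del: sum.lessThan_Suc)
  ultimately show ?case by simp
qed

lemma continuous_on_word: "continuous_on S (word bs)"
  by (intro continuous_at_imp_continuous_on ballI has_derivative_continuous[OF has_derivative_word])

end

section \<open>Trace inequalities\<close>

text \<open>Chebyshev's rearrangement: the increments of the powers \<open>s\<close> and
  \<open>t\<close> have the same sign, and symmetry of \<open>w\<close> lets the two orders of the
  indices be averaged.\<close>

lemma symmetric_power_sum_le:
  fixes e :: "'i \<Rightarrow> real" and w :: "'i \<Rightarrow> 'i \<Rightarrow> real"
  assumes e: "\<And>i. 0 \<le> e i" and w: "\<And>i j. 0 \<le> w i j" "\<And>i j. w i j = w j i"
  shows "(\<Sum>i\<in>I. \<Sum>j\<in>I. e i ^ s * e j ^ t * w i j) \<le> (\<Sum>i\<in>I. \<Sum>j\<in>I. e i ^ (s + t) * w i j)"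
proof -
  have le: "e i ^ s * e j ^ t + e j ^ s * e i ^ t \<le> e i ^ (s + t) + e j ^ (s + t)" for i j
  proof -
    have "0 \<le> (e i ^ s - e j ^ s) * (e i ^ t - e j ^ t)"
    proof (cases "e i \<le> e j")
      case True
      then show ?thesis using e by (intro mult_nonpos_nonpos) (simp_all add: power_mono)
    next
      case False
      then show ?thesis using e by (intro mult_nonneg_nonneg) (simp_all add: power_mono)
    qed
    then show ?thesis by (simp add: algebra_simps power_add)
  qed
  have "2 * (\<Sum>i\<in>I. \<Sum>j\<in>I. e i ^ s * e j ^ t * w i j)
      = (\<Sum>i\<in>I. \<Sum>j\<in>I. e i ^ s * e j ^ t * w i j) + (\<Sum>i\<in>I. \<Sum>j\<in>I. e j ^ s * e i ^ t * w i j)"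
    by (subst (3) sum.swap) (simp add: w(2)[of _ i for i] cong: sum.cong)
  also have "\<dots> = (\<Sum>i\<in>I. \<Sum>j\<in>I. (e i ^ s * e j ^ t + e j ^ s * e i ^ t) * w i j)"
    by (simp add: sum.distrib ring_distribs)
  also have "\<dots> \<le> (\<Sum>i\<in>I. \<Sum>j\<in>I. (e i ^ (s + t) + e j ^ (s + t)) * w i j)"
    by (intro sum_mono mult_right_mono le w)
  also have "\<dots> = (\<Sum>i\<in>I. \<Sum>j\<in>I. e i ^ (s + t) * w i j) + (\<Sum>i\<in>I. \<Sum>j\<in>I. e j ^ (s + t) * w i j)"
    by (simp add: sum.distrib ring_distribs)
  also have "(\<Sum>i\<in>I. \<Sum>j\<in>I. e j ^ (s + t) * w i j) = (\<Sum>i\<in>I. \<Sum>j\<in>I. e i ^ (s + t) * w i j)"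
    by (subst sum.swap) (intro sum.cong refl, metis w(2))
  finally show ?thesis by simp
qed

text \<open>Collects the weights from both sides of \<open>V\<close> on one side, so that a matrix
  between words of unequal length is measured by the trace of |R|^q V^2 for the total length
  only.\<close>

lemma norm_cdiag_mult_sq_le:
  fixes V :: "complex^'n^'n"
  assumes e: "\<And>i. 0 < e i" and V: "\<And>i j. cmod (V $ i $ j) = cmod (V $ j $ i)"
    and a: "\<And>i. cmod (a i) = e i ^ s" and b: "\<And>i. cmod (b i) = e i ^ t" and st: "s + t = q"
  shows "(norm (cdiag a ** V ** cdiag b))\<^sup>2 \<le> (\<Sum>i\<in>UNIV. \<Sum>j\<in>UNIV. e i ^ (2 * q) * (cmod (V $ i $ j))\<^sup>2)"
proof -
  have "(norm (cdiag a ** V ** cdiag b))\<^sup>2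
      = (\<Sum>i\<in>UNIV. \<Sum>j\<in>UNIV. e i ^ (2 * s) * e j ^ (2 * t) * (cmod (V $ i $ j))\<^sup>2)"
    unfolding norm_matrix_sq
    by (simp add: cdiag_mult_component norm_mult a b power_mult_distrib power_mult[symmetric] mult_ac)
  also have "\<dots> \<le> (\<Sum>i\<in>UNIV. \<Sum>j\<in>UNIV. e i ^ (2 * s + 2 * t) * (cmod (V $ i $ j))\<^sup>2)"
    using e V by (intro symmetric_power_sum_le) (auto simp: less_imp_le)
  finally show ?thesis using st by (simp add: distrib_left[symmetric])
qed

text \<open>The longest word sits between \<open>V2\<close> and \<open>V3\<close>. It can be split so that the powers on both
  sides of \<open>V2\<close>, and likewise of \<open>V3\<close>, add up to the same total; Cauchy--Schwarz then extracts
  the operator norm of \<open>V1\<close>.\<close>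
lemma trace_three_words_le:
  fixes V1 V2 V3 :: "complex^'n^'n"
  assumes e: "\<And>i. 0 < e i"
    and V2: "\<And>i j. cmod (V2 $ i $ j) = cmod (V2 $ j $ i)"
    and V3: "\<And>i j. cmod (V3 $ i $ j) = cmod (V3 $ j $ i)"
    and r1: "\<And>i. cmod (r1 i) = e i ^ (2 * a)" and r2: "\<And>i. cmod (r2 i) = e i ^ (2 * b)"
    and r3: "\<And>i. cmod (r3 i) = e i ^ (2 * c)"
    and le: "a \<le> c" "b \<le> c" and q: "q = a + b + c"
  shows "\<bar>Re (trace (cdiag r1 ** V1 ** cdiag r2 ** V2 ** cdiag r3 ** V3))\<bar>
    \<le> spectral_norm V1 * (((\<Sum>i\<in>UNIV. \<Sum>j\<in>UNIV. e i ^ (2 * q) * (cmod (V2 $ i $ j))\<^sup>2)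
        + (\<Sum>i\<in>UNIV. \<Sum>j\<in>UNIV. e i ^ (2 * q) * (cmod (V3 $ i $ j))\<^sup>2)) / 2)"
proof -
  \<comment> \<open>Exponents are chosen so that both \<open>V2\<close> and \<open>V3\<close> see
    total weight q: 2b + (q - 2b) and (q - 2a) + 2a. They fit because the two new exponents add up
    to 2c, and they are nonnegative because c is the largest length. The phase of \<open>r3\<close>
    goes into \<open>x\<close>.\<close>
  define y where "y i = complex_of_real (e i ^ (q - 2 * a))" for i
  define x where "x i = r3 i / y i" for i
  have ne: "e i \<noteq> 0" for i using e[of i] by simp
  have yn: "cmod (y i) = e i ^ (q - 2 * a)" for i
    using e[of i] by (simp add: y_def norm_power)
  have "2 * c = (q - 2 * b) + (q - 2 * a)" using le q by simp
  then have xn: "cmod (x i) = e i ^ (q - 2 * b)" for i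
    using ne by (simp add: x_def norm_divide yn r3 power_add)
  have r3': "cdiag r3 = cdiag x ** cdiag y"
    using ne by (simp add: cdiag_mult x_def y_def)
  define B where "B = cdiag r2 ** V2 ** cdiag x"
  define C where "C = cdiag y ** V3 ** cdiag r1"
  have "trace (cdiag r1 ** V1 ** cdiag r2 ** V2 ** cdiag r3 ** V3)
      = trace (cdiag r1 ** (V1 ** cdiag r2 ** V2 ** cdiag x ** cdiag y ** V3))"
    by (simp add: r3' matrix_mul_assoc)
  also have "\<dots> = trace ((V1 ** B) ** C)"
    by (subst trace_mul_sym) (simp add: B_def C_def matrix_mul_assoc)
  finally have "\<bar>Re (trace (cdiag r1 ** V1 ** cdiag r2 ** V2 ** cdiag r3 ** V3))\<bar> \<le> norm (V1 ** B) * norm C"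
    using abs_Re_trace_mult_le by metis
  also have "\<dots> \<le> spectral_norm V1 * (norm B * norm C)"
    using norm_matrix_mult_le_left[of V1 B] by (simp add: mult.assoc[symmetric] mult_right_mono)
  also have "\<dots> \<le> spectral_norm V1 * (((norm B)\<^sup>2 + (norm C)\<^sup>2) / 2)"
    using sum_squares_bound[of "norm B" "norm C"]
    by (intro mult_left_mono spectral_norm_nonneg) simp
  also have "\<dots> \<le> spectral_norm V1 * (((\<Sum>i\<in>UNIV. \<Sum>j\<in>UNIV. e i ^ (2 * q) * (cmod (V2 $ i $ j))\<^sup>2)
        + (\<Sum>i\<in>UNIV. \<Sum>j\<in>UNIV. e i ^ (2 * q) * (cmod (V3 $ i $ j))\<^sup>2)) / 2)"
    unfolding B_def C_def using le q
    by (intro mult_left_mono divide_right_mono add_mono spectral_norm_nonneg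
        norm_cdiag_mult_sq_le[OF e V2 r2 xn] norm_cdiag_mult_sq_le[OF e V3 yn r1]) auto
  finally show ?thesis .
qed

text \<open>Gronwall's inequality in both time directions: exp(ks) g is nondecreasing and exp(-ks) g
  nonincreasing. For k > 0 the hypothesis itself makes g nonnegative, which permits enlarging the
  exponent to k; k = 0 is treated apart.\<close>

lemma abs_derivative_le_imp_exp_bound:
  fixes g :: "real \<Rightarrow> real"
  assumes g: "\<And>s. s \<in> {0..1} \<Longrightarrow> \<exists>D. (g has_real_derivative D) (at s) \<and> \<bar>D\<bar> \<le> k * g s"
    and k: "0 \<le> k" and st: "s \<in> {0..1}" "t \<in> {0..1}"
  shows "g s \<le> exp k * g t"
proof -
  have g0: "0 \<le> k * g s" if "s \<in> {0..1}" for s using g[OF that] by (auto intro: order_trans[OF abs_ge_zero])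
  have le: "exp (k * \<bar>t - s\<bar>) \<le> exp k"
  proof -
    have "\<bar>t - s\<bar> \<le> 1" using st by auto
    then have "k * \<bar>t - s\<bar> \<le> k * 1" using k by (rule mult_left_mono)
    then show ?thesis by simp
  qed
  have *: "g s \<le> exp (k * \<bar>t - s\<bar>) * g t"
  proof (cases "s \<le> t")
    case True
    have "exp (k * s) * g s \<le> exp (k * t) * g t"
    proof (rule DERIV_nonneg_imp_nondecreasing[OF True])
      fix x assume "s \<le> x" "x \<le> t"
      then obtain D where D: "(g has_real_derivative D) (at x)" "\<bar>D\<bar> \<le> k * g x" using g[of x] st by auto
      have "((\<lambda>s. exp (k * s) * g s) has_real_derivative exp (k * x) * (k * g x + D)) (at x)"
        by (rule derivative_eq_intros D refl)+ (simp add: algebra_simps)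
      then show "\<exists>y. ((\<lambda>s. exp (k * s) * g s) has_real_derivative y) (at x) \<and> 0 \<le> y"
        using D(2) by (intro exI conjI) (auto intro!: mult_nonneg_nonneg)
    qed
    then have "exp (- (k * s)) * (exp (k * s) * g s) \<le> exp (- (k * s)) * (exp (k * t) * g t)"
      by (rule mult_left_mono) simp
    moreover have "exp (k * \<bar>t - s\<bar>) = exp (- (k * s)) * exp (k * t)"
      using True by (simp add: mult_exp_exp algebra_simps)
    ultimately show ?thesis by (simp add: mult.assoc[symmetric] mult_exp_exp)
  next
    case False
    then have st': "t \<le> s" by simp
    have "exp (- k * s) * g s \<le> exp (- k * t) * g t"
    proof (rule DERIV_nonpos_imp_nonincreasing[OF st'])
      fix x assume "t \<le> x" "x \<le> s"
      then obtain D where D: "(g has_real_derivative D) (at x)" "\<bar>D\<bar> \<le> k * g x" using g[of x] st by auto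
      have "((\<lambda>s. exp (- k * s) * g s) has_real_derivative exp (- k * x) * (D - k * g x)) (at x)"
        by (rule derivative_eq_intros D refl)+ (simp add: algebra_simps)
      then show "\<exists>y. ((\<lambda>s. exp (- k * s) * g s) has_real_derivative y) (at x) \<and> y \<le> 0"
        using D(2) by (intro exI conjI) (auto intro!: mult_nonneg_nonpos)
    qed
    then have "exp (k * s) * (exp (- k * s) * g s) \<le> exp (k * s) * (exp (- k * t) * g t)"
      by (rule mult_left_mono) simp
    moreover have "exp (k * \<bar>t - s\<bar>) = exp (k * s) * exp (- k * t)"
      using False by (simp add: mult_exp_exp algebra_simps)
    ultimately show ?thesis by (simp add: mult.assoc[symmetric] mult_exp_exp)
  qed
  show ?thesis
  proof (cases "k = 0")
    case False
    then have "0 \<le> g t" using g0[OF st(2)] k by (simp add: zero_le_mult_iff)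
    then show ?thesis using * le by (meson mult_right_mono order_trans)
  qed (use * in simp)
qed

section \<open>Traces with inserted directions\<close>

context resolvent_words
begin

text \<open>In \<open>tr0\<close> to \<open>tr3\<close> the digit counts the directions inserted
  between words. A derivative along a curve turns one into a sum of the next, with one more letter
  in total.\<close>

definition tr0 :: "bool list \<Rightarrow> complex^'n^'n \<Rightarrow> real"
  where "tr0 a M = Re (trace (word a M))"

definition tr1 :: "bool list \<Rightarrow> complex^'n^'n \<Rightarrow> complex^'n^'n \<Rightarrow> real"
  where "tr1 a M V = Re (trace (word a M ** V))"

definition tr2 :: "bool list \<Rightarrow> bool list \<Rightarrow> complex^'n^'n \<Rightarrow> complex^'n^'n \<Rightarrow> complex^'n^'n \<Rightarrow> real"
  where "tr2 a b M U V = Re (trace (word a M ** U ** word b M ** V))"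

definition tr3 :: "bool list \<Rightarrow> bool list \<Rightarrow> bool list \<Rightarrow> complex^'n^'n
    \<Rightarrow> complex^'n^'n \<Rightarrow> complex^'n^'n \<Rightarrow> complex^'n^'n \<Rightarrow> real"
  where "tr3 a b c M U V W = Re (trace (word a M ** U ** word b M ** V ** word c M ** W))"

text \<open>Cyclicity lets any of the three words be moved to the last place, where
  \<open>tr3_le\<close> expects the longest one.\<close>

lemma tr3_rotate: "tr3 a b c M U V W = tr3 b c a M V W U"
proof -
  have "trace (word a M ** U ** word b M ** V ** word c M ** W)
      = trace ((word a M ** U) ** (word b M ** V ** word c M ** W))"
    by (simp add: matrix_mul_assoc)
  also have "\<dots> = trace (word b M ** V ** word c M ** W ** word a M ** U)"
    by (subst trace_mul_sym) (simp add: matrix_mul_assoc)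
  finally show ?thesis by (simp add: tr3_def)
qed

lemma has_vector_derivative_word:
  fixes X :: "real \<Rightarrow> complex^'n^'n"
  assumes X: "(X has_vector_derivative X') (at s within T)" and X': "self_adjoint X'"
  shows "((\<lambda>s. word bs (X s)) has_vector_derivative
    (\<Sum>l<length bs. word (take (Suc l) bs) (X s) ** X' ** word (drop l bs) (X s))) (at s within T)"
proof -
  have "((\<lambda>s. word bs (X s)) has_derivative
      (\<lambda>h. \<Sum>l<length bs. word (take (Suc l) bs) (X s) ** herm (h *\<^sub>R X') ** word (drop l bs) (X s)))
      (at s within T)"
    using has_derivative_compose[OF X[unfolded has_vector_derivative_def] has_derivative_word] .
  then show ?thesis
    unfolding has_vector_derivative_def
    by (simp add: linear_simps[OF bounded_linear_herm] herm_self_adjoint[OF X'] matrix_mult_scaleR scaleR_sum_right)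
qed

lemma bounded_linear_Re_trace: "bounded_linear (\<lambda>A :: complex^'n^'n. Re (trace A))"
  by (rule bounded_linear_compose[OF bounded_linear_Re bounded_linear_trace])

lemma Re_trace_sum: "Re (trace (\<Sum>i\<in>I. f i)) = (\<Sum>i\<in>I. Re (trace (f i :: complex^'n^'n)))"
  by (rule linear_sum[OF bounded_linear.linear[OF bounded_linear_Re_trace]])

context
  fixes X :: "real \<Rightarrow> complex^'n^'n" and X' s T
  assumes X: "(X has_vector_derivative X') (at s within T)" and X': "self_adjoint X'"
begin

lemmas curve_word_derivative = has_vector_derivative_word[OF X X']

lemma has_derivative_tr0:
  "((\<lambda>s. tr0 a (X s)) has_real_derivative
    (\<Sum>l<length a. tr1 (drop l a @ take (Suc l) a) (X s) X')) (at s within T)"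
proof -
  have "trace (word (take (Suc l) a) (X s) ** X' ** word (drop l a) (X s))
      = trace (word (drop l a @ take (Suc l) a) (X s) ** X')" for l
    unfolding word_append by (subst trace_mul_sym) (simp add: matrix_mul_assoc)
  then show ?thesis
    using bounded_linear.has_vector_derivative[OF bounded_linear_Re_trace curve_word_derivative[of a]]
    by (simp add: has_real_derivative_iff_has_vector_derivative tr0_def tr1_def Re_trace_sum)
qed

lemma has_derivative_tr1:
  "((\<lambda>s. tr1 a (X s) V) has_real_derivative
    (\<Sum>k<length a. tr2 (take (Suc k) a) (drop k a) (X s) X' V)) (at s within T)"
proof -
  have "bounded_linear (\<lambda>A. Re (trace (A ** V)))"
    by (rule bounded_linear_compose[OF bounded_linear_Re_trace matrix_mult.bounded_linear_left])
  from bounded_linear.has_vector_derivative[OF this curve_word_derivative[of a]] show ?thesis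
    by (simp add: has_real_derivative_iff_has_vector_derivative tr1_def tr2_def Re_trace_sum matrix_mult.sum_left)
qed

lemma has_derivative_tr2:
  "((\<lambda>s. tr2 a b (X s) U V) has_real_derivative
    ((\<Sum>k<length a. tr3 (take (Suc k) a) (drop k a) b (X s) X' U V)
      + (\<Sum>k<length b. tr3 a (take (Suc k) b) (drop k b) (X s) U X' V))) (at s within T)"
proof -
  have "((\<lambda>s. word a (X s) ** U) has_vector_derivative
      (\<Sum>k<length a. word (take (Suc k) a) (X s) ** X' ** word (drop k a) (X s)) ** U) (at s within T)"
    by (rule bounded_linear.has_vector_derivative[OF matrix_mult.bounded_linear_left curve_word_derivative])
  from matrix_mult.has_vector_derivative[OF this curve_word_derivative[of b]]
  have 1: "((\<lambda>s. (word a (X s) ** U) ** word b (X s)) has_vector_derivative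
      (word a (X s) ** U) ** (\<Sum>k<length b. word (take (Suc k) b) (X s) ** X' ** word (drop k b) (X s))
      + ((\<Sum>k<length a. word (take (Suc k) a) (X s) ** X' ** word (drop k a) (X s)) ** U) ** word b (X s))
      (at s within T)" .
  have "bounded_linear (\<lambda>A. Re (trace (A ** V)))"
    by (rule bounded_linear_compose[OF bounded_linear_Re_trace matrix_mult.bounded_linear_left])
  from bounded_linear.has_vector_derivative[OF this 1] show ?thesis
    by (simp add: has_real_derivative_iff_has_vector_derivative tr3_def tr2_def Re_trace_sum
        matrix_mult.sum_left matrix_mult.sum_right matrix_mult.add_left linear_simps[OF bounded_linear_Re_trace]
        matrix_mul_assoc add.commute)
qed

end

text \<open>In the eigenbasis the energies are sums of powers of the \<open>d i\<close> with
  nonnegative coefficients |V_il|^2, so a scalar inequality between powers passes to them. Its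
  parameters are left free: growth of the energies needs one power, the third derivative a mixture
  of two.\<close>

lemma tr3_le:
  fixes M :: "complex^'n^'n"
  assumes sa: "self_adjoint V2" "self_adjoint V3"
    and V1: "spectral_norm V1 \<le> L"
    and len: "length a \<le> length c" "length b \<le> length c"
    and pw: "\<And>t. 0 < t \<Longrightarrow> t \<le> 1 / \<eta> \<Longrightarrow>
      t ^ (length a + length b + length c) \<le> \<alpha> * t ^ (2 * m) + \<beta> * t ^ (2 * k)"
  shows "\<bar>tr3 a b c M V1 V2 V3\<bar> \<le>
    L * ((\<alpha> * tr1 (bal m) M (V2 ** V2) + \<beta> * tr1 (bal k) M (V2 ** V2)
      + (\<alpha> * tr1 (bal m) M (V3 ** V3) + \<beta> * tr1 (bal k) M (V3 ** V3))) / 2)"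
proof -
  obtain U d w where U: "unitary U" and d: "\<forall>i. 0 < d i \<and> d i \<le> 1 / \<eta>"
    and W: "\<forall>bs. word bs M = U ** cdiag (w bs) ** conj_transpose U"
    and w: "\<forall>bs i. cmod (w bs i) = d i ^ length bs" "\<forall>m i. w (bal m) i = of_real (d i ^ (2 * m))"
    using word_diagonalization[where M = M] .
  \<comment> \<open>Splitting the longest word can require half-integer powers of
    \<open>d i\<close>; square roots make all exponents integers.\<close>
  define e where "e i = sqrt (d i)" for i
  have e: "0 < e i" for i using d by (simp add: e_def)
  have ed: "e i ^ (2 * j) = d i ^ j" for i j
    using d[rule_format, of i] by (simp add: e_def power_mult)
  define cj where "cj V = conj_transpose U ** V ** U" for V
  define S where "S j V = (\<Sum>i\<in>UNIV. \<Sum>l\<in>UNIV. d i ^ j * (cmod (cj V $ i $ l))\<^sup>2)" for j V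
  have cj: "U ** cj V ** conj_transpose U = V" for V
    using unitaryD[OF U] by (simp add: cj_def matrix_mul_assoc) (simp add: matrix_mul_assoc[symmetric])
  have sacj: "self_adjoint (cj V)" if "self_adjoint V" for V
    using that by (simp add: self_adjoint_def cj_def conj_transpose_mult matrix_mul_assoc)
  have sym: "cmod (cj V $ i $ j) = cmod (cj V $ j $ i)" if "self_adjoint V" for V i j
    using self_adjoint_component[OF sacj[OF that], of j i] by simp
  have T: "tr1 (bal j) M (V ** V) = S (2 * j) V" if "self_adjoint V" for j V
  proof -
    have "trace (word (bal j) M ** (V ** V)) = trace (cdiag (w (bal j)) ** (cj V ** cj V))"
      using trace_unitary_conj[OF U, of "cdiag (w (bal j)) ** (cj V ** cj V)"]
      by (simp add: unitary_conj_mult[OF U, symmetric] W cj)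
    also have "\<dots> = (\<Sum>i\<in>UNIV. w (bal j) i * (\<Sum>l\<in>UNIV. cj V $ i $ l * cj V $ l $ i))"
      by (simp add: trace_def cdiag_mult_component) (simp add: matrix_mult_component)
    also have "\<dots> = of_real (S (2 * j) V)"
    proof -
      have "cj V $ i $ l * cj V $ l $ i = of_real ((cmod (cj V $ i $ l))\<^sup>2)" for i l
        using self_adjoint_component[OF sacj[OF that], of l i]
          complex_norm_square[of "cj V $ i $ l"] by simp
      then show ?thesis by (simp add: S_def w sum_distrib_left)
    qed
    finally show ?thesis by (simp add: tr1_def)
  qed
  have S_le: "S (length a + length b + length c) V \<le> \<alpha> * S (2 * m) V + \<beta> * S (2 * k) V" for V
  proof -
    have "S (length a + length b + length c) V
        \<le> (\<Sum>i\<in>UNIV. \<Sum>l\<in>UNIV. (\<alpha> * d i ^ (2 * m) + \<beta> * d i ^ (2 * k)) * (cmod (cj V $ i $ l))\<^sup>2)"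
      unfolding S_def using d pw by (intro sum_mono mult_right_mono) auto
    then show ?thesis by (simp add: S_def sum.distrib ring_distribs sum_distrib_left mult.assoc)
  qed
  have "trace (word a M ** V1 ** word b M ** V2 ** word c M ** V3)
     = trace (cdiag (w a) ** cj V1 ** cdiag (w b) ** cj V2 ** cdiag (w c) ** cj V3)"
    using trace_unitary_conj[OF U, of "cdiag (w a) ** cj V1 ** cdiag (w b) ** cj V2 ** cdiag (w c) ** cj V3"]
    by (simp add: unitary_conj_mult[OF U, symmetric] W cj)
  moreover have "\<bar>Re (trace (cdiag (w a) ** cj V1 ** cdiag (w b) ** cj V2 ** cdiag (w c) ** cj V3))\<bar>
      \<le> spectral_norm (cj V1)
        * (((\<Sum>i\<in>UNIV. \<Sum>l\<in>UNIV. e i ^ (2 * (length a + length b + length c)) * (cmod (cj V2 $ i $ l))\<^sup>2)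
          + (\<Sum>i\<in>UNIV. \<Sum>l\<in>UNIV. e i ^ (2 * (length a + length b + length c)) * (cmod (cj V3 $ i $ l))\<^sup>2)) / 2)"
    using len w(1)
    by (intro trace_three_words_le[where a = "length a" and b = "length b" and c = "length c"]
        e sym sa) (simp_all add: ed)
  ultimately have "\<bar>tr3 a b c M V1 V2 V3\<bar> \<le> spectral_norm (cj V1)
      * ((S (length a + length b + length c) V2 + S (length a + length b + length c) V3) / 2)"
    by (simp only: tr3_def S_def ed)
  also have "\<dots> \<le> L * ((\<alpha> * S (2 * m) V2 + \<beta> * S (2 * k) V2 + (\<alpha> * S (2 * m) V3 + \<beta> * S (2 * k) V3)) / 2)"
  proof (intro mult_mono divide_right_mono add_mono S_le)
    show "spectral_norm (cj V1) \<le> L"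
      using spectral_norm_unitary_conj_le[OF U, of V1] V1 by (simp add: cj_def)
    show "0 \<le> L" using V1 spectral_norm_nonneg[of V1] by simp
    show "0 \<le> (S (length a + length b + length c) V2 + S (length a + length b + length c) V3) / 2"
      unfolding S_def using d
      by (intro divide_nonneg_nonneg add_nonneg_nonneg sum_nonneg mult_nonneg_nonneg zero_le_power)
        (simp_all add: less_imp_le)
  qed simp
  finally show ?thesis by (simp add: T sa)
qed

end

section \<open>Pathwise third-order estimates\<close>

context resolvent_words
begin

lemma word_bal_factorization:
  fixes M :: "complex^'n^'n"
  obtains B :: "complex^'n^'n" where "word (bal m) M = B ** conj_transpose B"
proof -
  obtain U d w where U: "unitary U" and d: "\<forall>i. 0 < d i \<and> d i \<le> 1 / \<eta>"
    and W: "\<forall>bs. word bs M = U ** cdiag (w bs) ** conj_transpose U"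
    and w: "\<forall>bs i. cmod (w bs i) = d i ^ length bs" "\<forall>m i. w (bal m) i = of_real (d i ^ (2 * m))"
    using word_diagonalization[where M = M] .
  define D where "D = (cdiag (\<lambda>i. of_real (d i ^ m)) :: complex^'n^'n)"
  have wb: "w (bal m) = (\<lambda>i. of_real (d i ^ (2 * m)))" using w by auto
  have "conj_transpose D = D" by (simp add: D_def vec_eq_iff cdiag_component)
  moreover have "D ** D = cdiag (w (bal m))"
    by (simp add: D_def cdiag_mult wb power_add[symmetric] mult_2 flip: of_real_mult)
  ultimately have "word (bal m) M = (U ** D) ** conj_transpose (U ** D)"
    by (simp add: W conj_transpose_mult matrix_mul_assoc) (simp add: matrix_mul_assoc[symmetric])
  then show ?thesis by (rule that)
qed

lemma tr0_bal_eq_sum: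
  fixes M :: "complex^'n^'n"
  obtains d :: "'n \<Rightarrow> real" where "\<forall>i. 0 < d i \<and> d i \<le> 1 / \<eta>" "\<forall>m. tr0 (bal m) M = (\<Sum>i\<in>UNIV. d i ^ (2 * m))"
proof -
  obtain U d w where U: "unitary U" and d: "\<forall>i. 0 < d i \<and> d i \<le> 1 / \<eta>"
    and W: "\<forall>bs. word bs M = U ** cdiag (w bs) ** conj_transpose U"
    and w: "\<forall>bs i. cmod (w bs i) = d i ^ length bs" "\<forall>m i. w (bal m) i = of_real (d i ^ (2 * m))"
    using word_diagonalization[where M = M] .
  have "tr0 (bal m) M = (\<Sum>i\<in>UNIV. d i ^ (2 * m))" for m
    by (simp add: tr0_def W trace_unitary_conj[OF U] trace_cdiag w)
  then show ?thesis using that d by blast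
qed

text \<open>For self-adjoint \<open>V\<close> this is the trace of |R|^(2m) V^2, the energy by which
  all third-order terms are measured.\<close>

definition T :: "nat \<Rightarrow> complex^'n^'n \<Rightarrow> complex^'n^'n \<Rightarrow> real"
  where "T m M V = tr1 (bal m) M (V ** V)"

text \<open>With |R|^(2m) = B B^* the trace is the inner product of S B with B. Applied to the sum
  of the second moments, this step brings in the matrix variance as an operator norm.\<close>

lemma tr1_bal_le:
  fixes M :: "complex^'n^'n"
  shows "tr1 (bal m) M S \<le> spectral_norm S * tr0 (bal m) M"
proof -
  obtain B :: "complex^'n^'n" where B: "word (bal m) M = B ** conj_transpose B" using word_bal_factorization .
  have "tr1 (bal m) M S = (S ** B) \<bullet> B"
    unfolding tr1_def B inner_matrix_eq_trace by (subst trace_mul_sym) (simp add: matrix_mul_assoc)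
  also have "\<dots> \<le> norm (S ** B) * norm B" by (rule norm_cauchy_schwarz)
  also have "\<dots> \<le> spectral_norm S * norm B * norm B"
    by (intro mult_right_mono norm_matrix_mult_le_left) simp
  also have "\<dots> = spectral_norm S * (norm B * norm B)" by (rule mult.assoc)
  also have "norm B * norm B = tr0 (bal m) M"
    by (simp add: tr0_def B inner_matrix_eq_trace[symmetric] power2_norm_eq_inner[symmetric] power2_eq_square)
  finally show ?thesis .
qed

lemma T_nonneg:
  fixes M :: "complex^'n^'n"
  assumes "self_adjoint V"
  shows "0 \<le> T m M V"
proof -
  obtain B :: "complex^'n^'n" where B: "word (bal m) M = B ** conj_transpose B" using word_bal_factorization .
  have "trace (B ** conj_transpose B ** (V ** V)) = trace (V ** B ** conj_transpose (V ** B))"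
    using assms unfolding self_adjoint_def conj_transpose_mult
    by (metis matrix_mul_assoc trace_mul_sym)
  then have "T m M V = (V ** B) \<bullet> (V ** B)"
    by (simp add: T_def tr1_def B inner_matrix_eq_trace)
  then show ?thesis by simp
qed

text \<open>The matrix opposite a longest word is estimated in operator norm, the other two keep
  their energies. What remains is either twice the energy of \<open>V\<close> or one energy each,
  and half of either is at most \<open>G V + G Y / 2\<close>. In the second claim \<open>Y\<close>
  stands opposite word \<open>c\<close>, which is not longest, so \<open>Y\<close> keeps its
  energy.\<close>

lemma tr3_le_two:
  fixes M :: "complex^'n^'n"
  assumes sa: "self_adjoint Y" "self_adjoint V"
    and L: "spectral_norm Y \<le> L" "spectral_norm V \<le> L"
    and \<alpha>\<beta>: "0 \<le> \<alpha>" "0 \<le> \<beta>"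
    and pw: "\<And>t. 0 < t \<Longrightarrow> t \<le> 1 / \<eta> \<Longrightarrow>
      t ^ (length a + length b + length c) \<le> \<alpha> * t ^ (2 * m) + \<beta> * t ^ (2 * k)"
    and V123: "(V1, V2, V3) \<in> {(Y, V, V), (V, Y, V), (V, V, Y)}"
  defines "G \<equiv> \<lambda>V. \<alpha> * T m M V + \<beta> * T k M V"
  shows "\<bar>tr3 a b c M V1 V2 V3\<bar> \<le> L * (G V + G Y / 2)"
    and "V1 = Y \<Longrightarrow> length c < length a \<or> length c < length b \<Longrightarrow>
      \<bar>tr3 a b c M V1 V2 V3\<bar> \<le> L * ((G Y + G V) / 2)"
proof -
  have G0: "0 \<le> G Y" "0 \<le> G V"
    unfolding G_def using \<alpha>\<beta> by (intro add_nonneg_nonneg mult_nonneg_nonneg T_nonneg sa; simp)+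
  have L0: "0 \<le> L" using L spectral_norm_nonneg[of Y] by simp
  have V: "self_adjoint V1" "self_adjoint V2" "self_adjoint V3"
    "spectral_norm V1 \<le> L" "spectral_norm V2 \<le> L" "spectral_norm V3 \<le> L"
    using V123 sa L by auto
  have c: "\<bar>tr3 a b c M V1 V2 V3\<bar> \<le> L * ((G V2 + G V3) / 2)" if "length a \<le> length c" "length b \<le> length c"
    unfolding G_def T_def by (rule tr3_le[OF V(2,3,4) that pw])
  have a: "\<bar>tr3 a b c M V1 V2 V3\<bar> \<le> L * ((G V3 + G V1) / 2)" if "length b \<le> length a" "length c \<le> length a"
    unfolding G_def T_def tr3_rotate[of a b c] using pw
    by (intro tr3_le V that) (simp add: add_ac)
  have b: "\<bar>tr3 a b c M V1 V2 V3\<bar> \<le> L * ((G V1 + G V2) / 2)" if "length c \<le> length b" "length a \<le> length b"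
    unfolding G_def T_def tr3_rotate[of a b c] tr3_rotate[of b c a] using pw
    by (intro tr3_le V that) (simp add: add_ac)
  have cases3: "length a \<le> length c \<and> length b \<le> length c \<or> length b \<le> length a \<and> length c \<le> length a
      \<or> length c \<le> length b \<and> length a \<le> length b" by linarith
  have le: "L * ((G V2 + G V3) / 2) \<le> L * (G V + G Y / 2)" "L * ((G V3 + G V1) / 2) \<le> L * (G V + G Y / 2)"
    "L * ((G V1 + G V2) / 2) \<le> L * (G V + G Y / 2)"
    using V123 G0 L0 by (auto intro!: mult_left_mono simp: field_simps)
  show "\<bar>tr3 a b c M V1 V2 V3\<bar> \<le> L * (G V + G Y / 2)"
    using cases3 a b c le by (meson order_trans)
  show "\<bar>tr3 a b c M V1 V2 V3\<bar> \<le> L * ((G Y + G V) / 2)"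
    if 1: "V1 = Y" and 2: "length c < length a \<or> length c < length b"
  proof (cases "length b \<le> length a")
    case True
    have "G V3 + G V1 = G Y + G V" using 1 V123 by auto
    moreover have "length c \<le> length a" using True 2 by linarith
    ultimately show ?thesis using a[OF True] by simp
  next
    case False
    have "G V1 + G V2 = G Y + G V" using 1 V123 by auto
    moreover have "length c \<le> length b" "length a \<le> length b" using False 2 by linarith+
    ultimately show ?thesis using b by simp
  qed
qed

section \<open>Derivatives of the trace of |R|^(2p)\<close>

definition rot :: "nat \<Rightarrow> nat \<Rightarrow> bool list"
  where "rot p l = drop l (bal p) @ take (Suc l) (bal p)"

lemma length_rot: "l < 2 * p \<Longrightarrow> length (rot p l) = 2 * p + 1"
  by (simp add: rot_def)

text \<open>F is the function \<open>tr0 (bal p)\<close>. \<open>dF\<close> and \<open>d2F\<close>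
  are its first and second directional derivatives at self-adjoint directions, written out as sums
  of words.\<close>

definition dF :: "nat \<Rightarrow> complex^'n^'n \<Rightarrow> complex^'n^'n \<Rightarrow> real"
  where "dF p M V = (\<Sum>l<2 * p. tr1 (rot p l) M V)"

definition d2F :: "nat \<Rightarrow> complex^'n^'n \<Rightarrow> complex^'n^'n \<Rightarrow> complex^'n^'n \<Rightarrow> real"
  where "d2F p M U V =
    (\<Sum>l<2 * p. \<Sum>k<2 * p + 1. tr2 (take (Suc k) (rot p l)) (drop k (rot p l)) M U V)"

text \<open>The number of words in the third derivative.\<close>
definition words3 :: "nat \<Rightarrow> real"
  where "words3 p = 2 * p * (2 * p + 1) * (2 * p + 2)"

context
  fixes X :: "real \<Rightarrow> complex^'n^'n" and X' s A
  assumes X: "(X has_vector_derivative X') (at s within A)" and X': "self_adjoint X'"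
begin

lemma has_derivative_tr0_bal: "((\<lambda>s. tr0 (bal p) (X s)) has_real_derivative dF p (X s) X') (at s within A)"
  using has_derivative_tr0[OF X X', of "bal p"] by (simp add: dF_def rot_def)

lemma has_derivative_dF: "((\<lambda>s. dF p (X s) V) has_real_derivative d2F p (X s) X' V) (at s within A)"
  unfolding dF_def d2F_def
proof (intro DERIV_sum)
  fix l assume "l \<in> {..<2 * p}"
  then show "((\<lambda>s. tr1 (rot p l) (X s) V) has_real_derivative
      (\<Sum>k<2 * p + 1. tr2 (take (Suc k) (rot p l)) (drop k (rot p l)) (X s) X' V)) (at s within A)"
    using has_derivative_tr1[OF X X', of "rot p l" V] by (simp add: length_rot)
qed

text \<open>Counting terms: 2p words of length 2p + 1, each cut at 2p + 1 places into two words of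
  joint length 2p + 2, every letter of which can be differentiated.\<close>

lemma has_derivative_d2F:
  assumes bd: "\<And>a b c. length a + length b + length c = 2 * p + 3 \<Longrightarrow>
    \<bar>tr3 a b c (X s) X' V V\<bar> \<le> \<beta> \<and> \<bar>tr3 a b c (X s) V X' V\<bar> \<le> \<beta>"
  shows "\<exists>D. ((\<lambda>s. d2F p (X s) V V) has_real_derivative D) (at s within A) \<and> \<bar>D\<bar> \<le> words3 p * \<beta>"
proof -
  let ?a = "\<lambda>l k. take (Suc k) (rot p l)" and ?b = "\<lambda>l k. drop k (rot p l)"
  define D where "D l k = (\<Sum>j<length (?a l k). tr3 (take (Suc j) (?a l k)) (drop j (?a l k)) (?b l k) (X s) X' V V)
    + (\<Sum>j<length (?b l k). tr3 (?a l k) (take (Suc j) (?b l k)) (drop j (?b l k)) (X s) V X' V)" for l k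
  have "((\<lambda>s. d2F p (X s) V V) has_real_derivative (\<Sum>l<2 * p. \<Sum>k<2 * p + 1. D l k)) (at s within A)"
    unfolding d2F_def D_def by (intro DERIV_sum has_derivative_tr2 X X')
  moreover have "\<bar>\<Sum>l<2 * p. \<Sum>k<2 * p + 1. D l k\<bar> \<le> words3 p * \<beta>"
  proof -
    have D: "\<bar>D l k\<bar> \<le> (2 * p + 2) * \<beta>" if lk: "l < 2 * p" "k < 2 * p + 1" for l k
    proof -
      have len: "length (?a l k) = Suc k" "length (?b l k) = 2 * p + 1 - k"
        using lk by (simp_all add: length_rot)
      have "\<bar>D l k\<bar> \<le> (\<Sum>j<length (?a l k). \<beta>) + (\<Sum>j<length (?b l k). \<beta>)"
        unfolding D_def
        by (intro order_trans[OF abs_triangle_ineq] add_mono order_trans[OF sum_abs] sum_mono)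
           (use bd len lk in auto)
      also have "\<dots> = (real (Suc k) + real (2 * p + 1 - k)) * \<beta>"
        unfolding len by (simp add: ring_distribs)
      also have "real (Suc k) + real (2 * p + 1 - k) = 2 * p + 2"
        using lk by (simp add: of_nat_diff)
      finally show ?thesis .
    qed
    have "\<bar>\<Sum>l<2 * p. \<Sum>k<2 * p + 1. D l k\<bar> \<le> (\<Sum>l<2 * p. \<Sum>k<2 * p + 1. (2 * p + 2) * \<beta>)"
      by (intro order_trans[OF sum_abs] sum_mono D) auto
    also have "\<dots> = words3 p * \<beta>"
      by (simp add: words3_def ring_distribs mult_ac)
    finally show ?thesis .
  qed
  ultimately show ?thesis by blast
qed

text \<open>The square of \<open>V\<close> is read as two copies of \<open>V\<close> around an empty
  word. \<open>X'\<close> is opposite that word, so it keeps an energy and one \<open>V\<close> pays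
  the operator norm. The additional letter costs 1/\<eta>, and the 2m terms with the weight 1/2 give
  mL/\<eta>.\<close>

lemma has_derivative_T:
  assumes V: "self_adjoint V" and L: "spectral_norm X' \<le> L" "spectral_norm V \<le> L"
  shows "\<exists>D. ((\<lambda>s. T m (X s) V) has_real_derivative D) (at s within A)
    \<and> \<bar>D\<bar> \<le> m * L / \<eta> * (T m (X s) X' + T m (X s) V)"
proof (intro exI conjI)
  let ?D = "\<Sum>k<2 * m. tr2 (take (Suc k) (bal m)) (drop k (bal m)) (X s) X' (V ** V)"
  show "((\<lambda>s. T m (X s) V) has_real_derivative ?D) (at s within A)"
    using has_derivative_tr1[OF X X', of "bal m" "V ** V"] by (simp add: T_def)
  have "\<bar>tr2 (take (Suc k) (bal m)) (drop k (bal m)) (X s) X' (V ** V)\<bar>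
      \<le> L * ((T m (X s) X' + T m (X s) V) / (2 * \<eta>))" if k: "k < 2 * m" for k
  proof -
    have "tr2 (take (Suc k) (bal m)) (drop k (bal m)) (X s) X' (V ** V)
      = tr3 (take (Suc k) (bal m)) (drop k (bal m)) [] (X s) X' V V"
      by (simp add: tr2_def tr3_def matrix_mul_assoc)
    moreover have "t ^ (length (take (Suc k) (bal m)) + length (drop k (bal m)) + length ([] :: bool list))
        \<le> 1 / \<eta> * t ^ (2 * m) + 0 * t ^ (2 * m)" if "0 < t" "t \<le> 1 / \<eta>" for t
    proof -
      have "length (take (Suc k) (bal m)) + length (drop k (bal m)) + length ([] :: bool list) = Suc (2 * m)"
        using k by simp
      moreover have "t * t ^ (2 * m) \<le> 1 / \<eta> * t ^ (2 * m)"
        using that by (intro mult_right_mono) auto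
      ultimately show ?thesis by simp
    qed
    ultimately show ?thesis
      using tr3_le_two(2)[OF X' V L, of "1 / \<eta>" 0 "take (Suc k) (bal m)" "drop k (bal m)" "[]" m m X' V V "X s"]
        k \<eta>_pos by (simp add: add_divide_distrib mult.commute)
  qed
  then have "\<bar>?D\<bar> \<le> (\<Sum>k<2 * m. L * ((T m (X s) X' + T m (X s) V) / (2 * \<eta>)))"
    by (intro order_trans[OF sum_abs] sum_mono) auto
  also have "\<dots> = m * L / \<eta> * (T m (X s) X' + T m (X s) V)"
    using \<eta>_pos by (simp add: field_simps)
  finally show "\<bar>?D\<bar> \<le> m * L / \<eta> * (T m (X s) X' + T m (X s) V)" .
qed

end

text \<open>The average of two even powers replacing the missing odd power 2p - 1, by the inequality
  between arithmetic and geometric means. The weight \<open>\<kappa>\<close> is later the reciprocal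
  of the norm at the current time.\<close>

definition tau :: "nat \<Rightarrow> real \<Rightarrow> complex^'n^'n \<Rightarrow> complex^'n^'n \<Rightarrow> real"
  where "tau p \<kappa> M V = (\<kappa> * T p M V + T (p - 1) M V / \<kappa>) / 2"

lemma tau_nonneg: "self_adjoint V \<Longrightarrow> 0 < \<kappa> \<Longrightarrow> 0 \<le> tau p \<kappa> M V"
  by (simp add: tau_def T_nonneg)

text \<open>Of the 2p + 3 letters, four are bounded by 1/\<eta> each. The remaining power 2p - 1 is
  t times an even power, and (\<kappa> t - 1)^2 \<ge> 0 splits the factor t.\<close>

lemma tr3_le_tau:
  fixes M :: "complex^'n^'n"
  assumes sa: "self_adjoint Y" "self_adjoint V"
    and L: "spectral_norm Y \<le> L" "spectral_norm V \<le> L"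
    and len: "length a + length b + length c = 2 * p + 3" and p: "p \<ge> 1" and \<kappa>: "0 < \<kappa>"
    and V123: "(V1, V2, V3) \<in> {(Y, V, V), (V, Y, V), (V, V, Y)}"
  shows "\<bar>tr3 a b c M V1 V2 V3\<bar> \<le> L / \<eta> ^ 4 * (tau p \<kappa> M V + tau p \<kappa> M Y / 2)"
proof -
  obtain r where r: "p = Suc r" using p by (cases p) auto
  have "t ^ (length a + length b + length c)
      \<le> \<kappa> / (2 * \<eta> ^ 4) * t ^ (2 * p) + 1 / (2 * \<kappa> * \<eta> ^ 4) * t ^ (2 * (p - 1))" if t: "0 < t" "t \<le> 1 / \<eta>" for t
  proof -
    have "0 \<le> (\<kappa> * t - 1)\<^sup>2 / \<kappa>" using \<kappa> by simp
    also have "(\<kappa> * t - 1)\<^sup>2 / \<kappa> = \<kappa> * t\<^sup>2 - 2 * t + 1 / \<kappa>"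
      using \<kappa> by (simp add: field_simps power2_eq_square)
    finally have 1: "t \<le> (\<kappa> * t\<^sup>2 + 1 / \<kappa>) / 2" by simp
    have 2: "t ^ 4 \<le> 1 / \<eta> ^ 4" using power_mono[OF t(2), of 4] t by (simp add: power_divide)
    have "t ^ (length a + length b + length c) = t ^ (2 * r) * (t ^ 4 * t)"
      unfolding len r by (simp add: power_add[symmetric] add.commute flip: power_Suc2)
    also have "\<dots> \<le> t ^ (2 * r) * (1 / \<eta> ^ 4 * ((\<kappa> * t\<^sup>2 + 1 / \<kappa>) / 2))"
      using t \<kappa> by (intro mult_left_mono mult_mono 1 2) auto
    also have "\<dots> = \<kappa> / (2 * \<eta> ^ 4) * t ^ (2 * p) + 1 / (2 * \<kappa> * \<eta> ^ 4) * t ^ (2 * (p - 1))"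
      using \<kappa> \<eta>_pos by (simp add: r field_simps power2_eq_square)
    finally show ?thesis .
  qed
  from tr3_le_two(1)[OF sa L _ _ this V123] \<kappa> \<eta>_pos
  have "\<bar>tr3 a b c M V1 V2 V3\<bar>
    \<le> L * (\<kappa> / (2 * \<eta> ^ 4) * T p M V + 1 / (2 * \<kappa> * \<eta> ^ 4) * T (p - 1) M V
       + (\<kappa> / (2 * \<eta> ^ 4) * T p M Y + 1 / (2 * \<kappa> * \<eta> ^ 4) * T (p - 1) M Y) / 2)"
    by simp
  also have "\<dots> = L / \<eta> ^ 4 * (tau p \<kappa> M V + tau p \<kappa> M Y / 2)"
    using \<kappa> \<eta>_pos by (simp add: tau_def field_simps)
  finally show ?thesis .
qed

text \<open>\<open>E\<close> bounds \<open>exp (1/4)\<close>, since \<open>exp x \<le> 1 + x + x\<^sup>2\<close> on the unit interval.\<close>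
definition E :: real where "E = 21 / 16"

lemma exp_le_E: "exp (1 / 4) \<le> E" "exp (1 / 2) \<le> E\<^sup>2"
proof -
  show 1: "exp (1 / 4) \<le> E" using exp_bound[of "1 / 4"] by (simp add: E_def power2_eq_square)
  have "exp (1 / 2 :: real) = (exp (1 / 4))\<^sup>2" by (simp add: power2_eq_square mult_exp_exp)
  then show "exp (1 / 2) \<le> E\<^sup>2" using power_mono[OF 1, of 2] by simp
qed

section \<open>Growth of energies while one summand is switched on\<close>

context
  fixes W Y V :: "complex^'n^'n" and L \<kappa> :: real and p :: nat
  assumes sa: "self_adjoint Y" "self_adjoint V"
    and L: "spectral_norm Y \<le> L" "spectral_norm V \<le> L"
    and small: "4 * p * L \<le> \<eta>" and p: "p \<ge> 1" and \<kappa>: "0 < \<kappa>"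
begin

definition ray where "ray s = W + s *\<^sub>R Y"

lemma ray_derivative: "(ray has_vector_derivative Y) (at s within A)"
  unfolding ray_def by (auto intro!: derivative_eq_intros)

lemma L_nonneg: "0 \<le> L" using L spectral_norm_nonneg[of Y] by simp

text \<open>The two energies in \<open>tau\<close> have orders p and p - 1, and 4pL \<le> \<eta>
  bounds both rates mL/\<eta> by 1/4.\<close>

lemma has_derivative_tau:
  assumes U: "self_adjoint U" "spectral_norm U \<le> L"
  shows "\<exists>D. ((\<lambda>s. tau p \<kappa> (ray s) U) has_real_derivative D) (at s)
    \<and> \<bar>D\<bar> \<le> 1 / 4 * (tau p \<kappa> (ray s) Y + tau p \<kappa> (ray s) U)"
proof -
  have k: "real m * L / \<eta> \<le> 1 / 4" if "m \<le> p" for m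
  proof -
    have "real m * L \<le> real p * L" using that L_nonneg by (intro mult_right_mono) auto
    then show ?thesis using small \<eta>_pos by (simp add: field_simps)
  qed
  have der: "\<exists>D. ((\<lambda>s. T m (ray s) U) has_real_derivative D) (at s)
      \<and> \<bar>D\<bar> \<le> 1 / 4 * (T m (ray s) Y + T m (ray s) U)" if "m \<le> p" for m
  proof -
    obtain D where D': "((\<lambda>s. T m (ray s) U) has_real_derivative D) (at s)"
      and D: "\<bar>D\<bar> \<le> m * L / \<eta> * (T m (ray s) Y + T m (ray s) U)"
      using has_derivative_T[OF ray_derivative sa(1) U(1) L(1) U(2)] by blast
    note D
    also have "m * L / \<eta> * (T m (ray s) Y + T m (ray s) U) \<le> 1 / 4 * (T m (ray s) Y + T m (ray s) U)"
      using k[OF that] by (intro mult_right_mono add_nonneg_nonneg T_nonneg sa U)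
    finally show ?thesis using D' by blast
  qed
  obtain D1 where D1: "((\<lambda>s. T p (ray s) U) has_real_derivative D1) (at s)"
    "\<bar>D1\<bar> \<le> 1 / 4 * (T p (ray s) Y + T p (ray s) U)" using der[of p] by blast
  obtain D2 where D2: "((\<lambda>s. T (p - 1) (ray s) U) has_real_derivative D2) (at s)"
    "\<bar>D2\<bar> \<le> 1 / 4 * (T (p - 1) (ray s) Y + T (p - 1) (ray s) U)" using der[of "p - 1"] by auto
  have der: "((\<lambda>s. tau p \<kappa> (ray s) U) has_real_derivative (\<kappa> * D1 + D2 / \<kappa>) / 2) (at s)"
    unfolding tau_def by (intro DERIV_cdivide DERIV_add DERIV_cmult D1 D2)
  have "\<bar>(\<kappa> * D1 + D2 / \<kappa>) / 2\<bar> \<le> (\<kappa> * \<bar>D1\<bar> + \<bar>D2\<bar> / \<kappa>) / 2"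
    using abs_triangle_ineq[of "\<kappa> * D1" "D2 / \<kappa>"] \<kappa> by (simp add: abs_mult)
  also have "\<dots> \<le> (\<kappa> * (1 / 4 * (T p (ray s) Y + T p (ray s) U))
      + (1 / 4 * (T (p - 1) (ray s) Y + T (p - 1) (ray s) U)) / \<kappa>) / 2"
    using \<kappa> by (intro divide_right_mono add_mono mult_left_mono D1 D2) auto
  also have "\<dots> = 1 / 4 * (tau p \<kappa> (ray s) Y + tau p \<kappa> (ray s) U)"
    using \<kappa> by (simp add: tau_def field_simps)
  finally show ?thesis using der by blast
qed

text \<open>For the moving direction itself both terms of the derivative bound coincide, so the rate
  doubles to 1/2; hence the square of \<open>E\<close>.\<close>

lemma tau_growth_self:
  assumes "s \<in> {0..1}" "t \<in> {0..1}"
  shows "tau p \<kappa> (ray s) Y \<le> E\<^sup>2 * tau p \<kappa> (ray t) Y"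
proof -
  have "tau p \<kappa> (ray s) Y \<le> exp (1 / 2) * tau p \<kappa> (ray t) Y"
    by (rule abs_derivative_le_imp_exp_bound[OF _ _ assms]) (use has_derivative_tau[OF sa(1) L(1)] in auto)
  also have "\<dots> \<le> E\<^sup>2 * tau p \<kappa> (ray t) Y"
    by (intro mult_right_mono exp_le_E tau_nonneg sa \<kappa>)
  finally show ?thesis .
qed

text \<open>The energy of \<open>Y\<close> enters as an inhomogeneous term. Adding its upper bound
  \<open>K\<close> makes the differential inequality homogeneous, and removing \<open>K\<close>
  again leaves (E - 1) K.\<close>

lemma tau_growth_other:
  assumes "s \<in> {0..1}" "t \<in> {0..1}"
  shows "tau p \<kappa> (ray s) V \<le> E * tau p \<kappa> (ray t) V + (E - 1) * E\<^sup>2 * tau p \<kappa> W Y"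
proof -
  define K where "K = E\<^sup>2 * tau p \<kappa> W Y"
  have ray_0: "ray 0 = W" by (simp add: ray_def)
  have K: "tau p \<kappa> (ray s) Y \<le> K" if "s \<in> {0..1}" for s
    using tau_growth_self[OF that, of 0] by (simp add: K_def ray_0)
  have K0: "0 \<le> K" by (simp add: K_def tau_nonneg sa \<kappa>)
  have "tau p \<kappa> (ray s) V + K \<le> exp (1 / 4) * (tau p \<kappa> (ray t) V + K)"
  proof (rule abs_derivative_le_imp_exp_bound[OF _ _ assms])
    fix s :: real assume s: "s \<in> {0..1}"
    obtain D where D: "((\<lambda>s. tau p \<kappa> (ray s) V) has_real_derivative D) (at s)"
      "\<bar>D\<bar> \<le> 1 / 4 * (tau p \<kappa> (ray s) Y + tau p \<kappa> (ray s) V)"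
      using has_derivative_tau[OF sa(2) L(2)] by blast
    have "((\<lambda>s. tau p \<kappa> (ray s) V + K) has_real_derivative D) (at s)"
      using DERIV_add[OF D(1) DERIV_const[of K]] by simp
    then show "\<exists>D. ((\<lambda>s. tau p \<kappa> (ray s) V + K) has_real_derivative D) (at s)
        \<and> \<bar>D\<bar> \<le> 1 / 4 * (tau p \<kappa> (ray s) V + K)"
      using D(2) K[OF s] by (intro exI[of _ D] conjI) auto
  qed simp
  also have "\<dots> \<le> E * (tau p \<kappa> (ray t) V + K)"
    using K0 by (intro mult_right_mono exp_le_E add_nonneg_nonneg tau_nonneg sa \<kappa>)
  finally show ?thesis by (simp add: K_def algebra_simps)
qed

lemma tau_start_le:
  assumes "r \<in> {0..1}"
  shows "tau p \<kappa> W V \<le> E * tau p \<kappa> (W + r *\<^sub>R Y) V + (E - 1) * E\<^sup>2 * tau p \<kappa> W Y"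
  using tau_growth_other[of 0 r] assms by (simp add: ray_def)

text \<open>The coefficient of the energy of \<open>Y\<close> joins (E - 1) E^2 from the growth of
  the other energy with E^2 / 2 from the half weight in \<open>tr3_le_tau\<close>.\<close>

lemma d2F_difference_le:
  assumes r: "r \<in> {0..1}"
  shows "\<bar>d2F p (W + r *\<^sub>R Y) V V - d2F p W V V\<bar>
    \<le> r * (words3 p * (L / \<eta> ^ 4 * (E * tau p \<kappa> W V + (E - 1 / 2) * E\<^sup>2 * tau p \<kappa> W Y)))"
proof -
  define K where "K = words3 p * (L / \<eta> ^ 4 * (E * tau p \<kappa> W V + (E - 1 / 2) * E\<^sup>2 * tau p \<kappa> W Y))"
  have ray_0: "ray 0 = W" by (simp add: ray_def)
  have "\<exists>D. ((\<lambda>s. d2F p (ray s) V V) has_real_derivative D) (at s) \<and> \<bar>D\<bar> \<le> K" if s: "s \<in> {0..1}" for s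
    unfolding K_def
  proof (rule has_derivative_d2F[OF ray_derivative sa(1)])
    fix a b c :: "bool list" assume len: "length a + length b + length c = 2 * p + 3"
    have "tau p \<kappa> (ray s) V + tau p \<kappa> (ray s) Y / 2
        \<le> (E * tau p \<kappa> W V + (E - 1) * E\<^sup>2 * tau p \<kappa> W Y) + E\<^sup>2 * tau p \<kappa> W Y / 2"
      using tau_growth_other[OF s, of 0] tau_growth_self[OF s, of 0] by (simp add: ray_0)
    also have "\<dots> = E * tau p \<kappa> W V + (E - 1 / 2) * E\<^sup>2 * tau p \<kappa> W Y" by (simp add: algebra_simps)
    finally have "L / \<eta> ^ 4 * (tau p \<kappa> (ray s) V + tau p \<kappa> (ray s) Y / 2)
        \<le> L / \<eta> ^ 4 * (E * tau p \<kappa> W V + (E - 1 / 2) * E\<^sup>2 * tau p \<kappa> W Y)"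
      using L_nonneg \<eta>_pos by (intro mult_left_mono) auto
    then show "\<bar>tr3 a b c (ray s) Y V V\<bar> \<le> L / \<eta> ^ 4 * (E * tau p \<kappa> W V + (E - 1 / 2) * E\<^sup>2 * tau p \<kappa> W Y)
      \<and> \<bar>tr3 a b c (ray s) V Y V\<bar> \<le> L / \<eta> ^ 4 * (E * tau p \<kappa> W V + (E - 1 / 2) * E\<^sup>2 * tau p \<kappa> W Y)"
      using tr3_le_tau[OF sa L len p \<kappa>, of Y V V "ray s"] tr3_le_tau[OF sa L len p \<kappa>, of V Y V "ray s"]
      by auto
  qed
  then have "\<forall>s. \<exists>D. s \<in> {0..1} \<longrightarrow> ((\<lambda>s. d2F p (ray s) V V) has_real_derivative D) (at s) \<and> \<bar>D\<bar> \<le> K" by blast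
  then obtain D where D: "\<And>s. s \<in> {0..1} \<Longrightarrow> ((\<lambda>s. d2F p (ray s) V V) has_real_derivative D s) (at s)"
    "\<And>s. s \<in> {0..1} \<Longrightarrow> \<bar>D s\<bar> \<le> K" by metis
  have "norm (d2F p (ray r) V V - d2F p (ray 0) V V) \<le> K * norm (r - 0)"
    by (rule field_differentiable_bound[of "{0..1}" _ D])
       (use D r in \<open>auto intro: DERIV_subset\<close>)
  then show ?thesis using r by (simp add: ray_def K_def mult.commute)
qed

text \<open>A Taylor remainder from the Lipschitz bound on the second derivative. With both
  directions equal to \<open>Y\<close> the weights 1 and 1/2 add up to the factor 3/2.\<close>

lemma dF_remainder_le:
  assumes r: "r \<in> {0..1}"
  shows "\<bar>dF p (W + r *\<^sub>R Y) Y - dF p W Y - r * d2F p W Y Y\<bar>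
    \<le> r\<^sup>2 / 2 * (words3 p * (L / \<eta> ^ 4 * (3 / 2 * E\<^sup>2 * tau p \<kappa> W Y)))"
proof -
  define K where "K = words3 p * (L / \<eta> ^ 4 * (3 / 2 * E\<^sup>2 * tau p \<kappa> W Y))"
  have ray_0: "ray 0 = W" by (simp add: ray_def)
  have "\<exists>D. ((\<lambda>s. d2F p (ray s) Y Y) has_real_derivative D) (at s) \<and> \<bar>D\<bar> \<le> K" if s: "s \<in> {0..1}" for s
    unfolding K_def
  proof (rule has_derivative_d2F[OF ray_derivative sa(1)])
    fix a b c :: "bool list" assume len: "length a + length b + length c = 2 * p + 3"
    have "tau p \<kappa> (ray s) Y + tau p \<kappa> (ray s) Y / 2 \<le> 3 / 2 * E\<^sup>2 * tau p \<kappa> W Y"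
      using tau_growth_self[OF s, of 0] by (simp add: ray_0)
    then have "L / \<eta> ^ 4 * (tau p \<kappa> (ray s) Y + tau p \<kappa> (ray s) Y / 2)
        \<le> L / \<eta> ^ 4 * (3 / 2 * E\<^sup>2 * tau p \<kappa> W Y)"
      using L_nonneg \<eta>_pos by (intro mult_left_mono) auto
    then show "\<bar>tr3 a b c (ray s) Y Y Y\<bar> \<le> L / \<eta> ^ 4 * (3 / 2 * E\<^sup>2 * tau p \<kappa> W Y)
      \<and> \<bar>tr3 a b c (ray s) Y Y Y\<bar> \<le> L / \<eta> ^ 4 * (3 / 2 * E\<^sup>2 * tau p \<kappa> W Y)"
      using tr3_le_tau[OF sa(1) sa(1) L(1) L(1) len p \<kappa>, of Y Y Y "ray s"] by auto
  qed
  then have "\<forall>s. \<exists>D. s \<in> {0..1} \<longrightarrow> ((\<lambda>s. d2F p (ray s) Y Y) has_real_derivative D) (at s) \<and> \<bar>D\<bar> \<le> K" by blast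
  then obtain D where D: "\<And>s. s \<in> {0..1} \<Longrightarrow> ((\<lambda>s. d2F p (ray s) Y Y) has_real_derivative D s) (at s)"
    "\<And>s. s \<in> {0..1} \<Longrightarrow> \<bar>D s\<bar> \<le> K" by metis
  have lip: "\<bar>d2F p (ray s) Y Y - d2F p (ray 0) Y Y\<bar> \<le> K * s" if "s \<in> {0..1}" for s
  proof -
    have "norm (d2F p (ray s) Y Y - d2F p (ray 0) Y Y) \<le> K * norm (s - 0)"
      by (rule field_differentiable_bound[of "{0..1}" _ D])
         (use D that in \<open>auto intro: DERIV_subset\<close>)
    then show ?thesis using that by simp
  qed
  \<comment> \<open>The quadratic majorant of the remainder is subtracted; monotonicity for c = 1
    and c = -1 gives the two one-sided bounds.\<close>
  define h where "h c s = c * (dF p (ray s) Y - s * d2F p W Y Y) - K * s\<^sup>2 / 2" for c s :: real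
  have h: "h c r \<le> h c 0" if c: "c = 1 \<or> c = -1" for c
  proof (rule DERIV_nonpos_imp_nonincreasing[where f = "h c"])
    show "0 \<le> r" using r by simp
    fix s assume s: "0 \<le> s" "s \<le> r"
    have "(h c has_real_derivative c * (d2F p (ray s) Y Y - d2F p W Y Y) - K * s) (at s)"
      unfolding h_def
      by (auto intro!: derivative_eq_intros has_derivative_dF[OF ray_derivative sa(1)])
    moreover have "c * (d2F p (ray s) Y Y - d2F p W Y Y) - K * s \<le> 0"
      using lip[of s] s r c by (auto simp: ray_0)
    ultimately show "\<exists>y. (h c has_real_derivative y) (at s) \<and> y \<le> 0" by blast
  qed
  have "\<bar>dF p (ray r) Y - dF p W Y - r * d2F p W Y Y\<bar> \<le> r\<^sup>2 / 2 * K"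
    unfolding abs_le_iff using h[of 1] h[of "-1"] by (simp add: h_def ray_0 algebra_simps)
  then show ?thesis by (simp only: K_def ray_def)
qed

end

end

section \<open>Independence, Gaussian integration by parts and uniqueness of laws\<close>

lemma (in prob_space) indep_var_sum_other:
  fixes Y :: "'i \<Rightarrow> 'a \<Rightarrow> 'e :: euclidean_space"
  assumes Y: "indep_vars (\<lambda>_. borel) Y I" and i: "i \<in> I" "finite I"
  shows "indep_var borel (\<lambda>\<omega>. \<Sum>j\<in>I - {i}. Y j \<omega>) borel (Y i)"
proof -
  have "indep_var borel ((\<lambda>f. \<Sum>j\<in>I - {i}. f j) \<circ> (\<lambda>\<omega>. restrict (\<lambda>j. Y j \<omega>) (I - {i})))
      borel ((\<lambda>f. f i) \<circ> (\<lambda>\<omega>. restrict (\<lambda>j. Y j \<omega>) {i}))"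
    using i by (intro indep_var_compose[OF indep_var_restrict[OF Y]]) auto
  moreover have "(\<lambda>f. \<Sum>j\<in>I - {i}. f j) \<circ> (\<lambda>\<omega>. restrict (\<lambda>j. Y j \<omega>) (I - {i})) = (\<lambda>\<omega>. \<Sum>j\<in>I - {i}. Y j \<omega>)"
    by (auto intro!: sum.cong)
  moreover have "(\<lambda>f. f i) \<circ> (\<lambda>\<omega>. restrict (\<lambda>j. Y j \<omega>) {i}) = Y i" by auto
  ultimately show ?thesis by metis
qed

lemma (in prob_space) indep_var_integral_decouple:
  fixes F :: "'b \<times> 'b \<Rightarrow> real"
  assumes UV: "indep_var S U R V" and F: "F \<in> borel_measurable (S \<Otimes>\<^sub>M R)"
    and int: "integrable M (\<lambda>\<omega>. F (U \<omega>, V \<omega>))"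
  shows "(\<integral>\<omega>. F (U \<omega>, V \<omega>) \<partial>M) = (\<integral>\<omega>. \<integral>\<omega>'. F (U \<omega>, V \<omega>') \<partial>M \<partial>M)"
    and "integrable M (\<lambda>\<omega>. \<integral>\<omega>'. F (U \<omega>, V \<omega>') \<partial>M)"
proof -
  have U[measurable]: "U \<in> M \<rightarrow>\<^sub>M S" and V[measurable]: "V \<in> M \<rightarrow>\<^sub>M R"
    and D: "distr M S U \<Otimes>\<^sub>M distr M R V = distr M (S \<Otimes>\<^sub>M R) (\<lambda>\<omega>. (U \<omega>, V \<omega>))"
    using UV by (auto simp: indep_var_distribution_eq)
  note F[measurable]
  interpret U: prob_space "distr M S U" by (rule prob_space_distr) simp
  interpret V: prob_space "distr M R V" by (rule prob_space_distr) simp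
  interpret UV: pair_prob_space "distr M S U" "distr M R V" ..
  have i: "integrable (distr M S U \<Otimes>\<^sub>M distr M R V) F"
    unfolding D using int by (subst integrable_distr_eq) simp_all
  have in_eq: "(\<integral>y. F (x, y) \<partial>distr M R V) = (\<integral>\<omega>'. F (x, V \<omega>') \<partial>M)" if "x \<in> space S" for x
    using that by (subst integral_distr) simp_all
  have "(\<integral>\<omega>. F (U \<omega>, V \<omega>) \<partial>M) = integral\<^sup>L (distr M S U \<Otimes>\<^sub>M distr M R V) F"
    unfolding D by (subst integral_distr) simp_all
  also have "\<dots> = (\<integral>x. \<integral>y. F (x, y) \<partial>distr M R V \<partial>distr M S U)"
    by (rule UV.integral_fst'[OF i, symmetric])
  also have "\<dots> = (\<integral>\<omega>. \<integral>y. F (U \<omega>, y) \<partial>distr M R V \<partial>M)"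
    by (subst integral_distr) (auto intro!: V.borel_measurable_lebesgue_integral)
  also have "\<dots> = (\<integral>\<omega>. \<integral>\<omega>'. F (U \<omega>, V \<omega>') \<partial>M \<partial>M)"
    using measurable_space[OF U] by (intro Bochner_Integration.integral_cong refl in_eq) auto
  finally show "(\<integral>\<omega>. F (U \<omega>, V \<omega>) \<partial>M) = (\<integral>\<omega>. \<integral>\<omega>'. F (U \<omega>, V \<omega>') \<partial>M \<partial>M)" .
  have "integrable (distr M S U) (\<lambda>x. \<integral>y. F (x, y) \<partial>distr M R V)"
    using UV.integrable_fst'[OF i] by simp
  then have "integrable M (\<lambda>\<omega>. \<integral>y. F (U \<omega>, y) \<partial>distr M R V)"
    by (rule integrable_distr[OF U])
  then show "integrable M (\<lambda>\<omega>. \<integral>\<omega>'. F (U \<omega>, V \<omega>') \<partial>M)"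
    using measurable_space[OF U] in_eq by (subst (asm) Bochner_Integration.integrable_cong[OF refl]) auto
qed

text \<open>The mean value inequality bounds the difference quotients by \<open>B\<close>, after
  which dominated convergence applies along every sequence.\<close>

lemma has_real_derivative_integral:
  fixes f :: "real \<Rightarrow> 'a \<Rightarrow> real"
  assumes f: "\<And>t \<omega>. \<omega> \<in> space M \<Longrightarrow> ((\<lambda>t. f t \<omega>) has_real_derivative f' t \<omega>) (at t)"
    and f': "\<And>t \<omega>. \<omega> \<in> space M \<Longrightarrow> \<bar>f' t \<omega>\<bar> \<le> B \<omega>" "f' t \<in> borel_measurable M"
    and B: "integrable M B" and fi: "\<And>t. integrable M (f t)"
  shows "((\<lambda>t. \<integral>\<omega>. f t \<omega> \<partial>M) has_real_derivative (\<integral>\<omega>. f' t \<omega> \<partial>M)) (at t)"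
  unfolding has_field_derivative_iff
proof (subst tendsto_at_iff_sequentially, intro allI impI)
  fix X :: "nat \<Rightarrow> real" assume X: "\<forall>i. X i \<in> UNIV - {t}" "X \<longlonglongrightarrow> t"
  have "(\<lambda>i. \<integral>\<omega>. (f (X i) \<omega> - f t \<omega>) / (X i - t) \<partial>M) \<longlonglongrightarrow> (\<integral>\<omega>. f' t \<omega> \<partial>M)"
  proof (rule integral_dominated_convergence[where w = B])
    show "AE \<omega> in M. (\<lambda>i. (f (X i) \<omega> - f t \<omega>) / (X i - t)) \<longlonglongrightarrow> f' t \<omega>"
    proof (rule AE_I2)
      fix \<omega> assume "\<omega> \<in> space M"
      from f[OF this, of t] have "((\<lambda>y. (f y \<omega> - f t \<omega>) / (y - t)) \<longlongrightarrow> f' t \<omega>) (at t)"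
        by (simp add: has_field_derivative_iff)
      then show "(\<lambda>i. (f (X i) \<omega> - f t \<omega>) / (X i - t)) \<longlonglongrightarrow> f' t \<omega>"
        using X unfolding tendsto_at_iff_sequentially by (auto simp: comp_def)
    qed
    show "AE \<omega> in M. norm ((f (X i) \<omega> - f t \<omega>) / (X i - t)) \<le> B \<omega>" for i
    proof (rule AE_I2)
      fix \<omega> assume \<omega>: "\<omega> \<in> space M"
      have "norm (f (X i) \<omega> - f t \<omega>) \<le> B \<omega> * norm (X i - t)"
        by (rule field_differentiable_bound[of UNIV _ "\<lambda>t. f' t \<omega>"]) (use f[OF \<omega>] f'(1)[OF \<omega>] in auto)
      then show "norm ((f (X i) \<omega> - f t \<omega>) / (X i - t)) \<le> B \<omega>"
        using X by (simp add: divide_le_eq)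
    qed
  qed (use f' B fi in auto)
  then show "((\<lambda>y. ((\<integral>\<omega>. f y \<omega> \<partial>M) - (\<integral>\<omega>. f t \<omega> \<partial>M)) / (y - t)) \<circ> X) \<longlonglongrightarrow> (\<integral>\<omega>. f' t \<omega> \<partial>M)"
    using fi by (simp add: comp_def)
qed

section \<open>Stein's identity for the standard normal law\<close>

lemma std_normal_density_tendsto_0:
  "(std_normal_density \<longlongrightarrow> 0) at_top" "(std_normal_density \<longlongrightarrow> 0) at_bot"
proof -
  have sq: "LIM x at_top. - (x\<^sup>2 / 2 :: real) :> at_bot"
    using filterlim_tendsto_pos_mult_at_top[OF tendsto_const[of "1/2::real"] _ filterlim_pow_at_top[OF _ filterlim_ident, of 2]]
    by (simp add: filterlim_uminus_at_bot mult.commute)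
  have "((\<lambda>x. 1 / sqrt (2 * pi) * exp (- (x\<^sup>2 / 2))) \<longlongrightarrow> 1 / sqrt (2 * pi) * 0) at_top"
    by (intro tendsto_mult tendsto_const filterlim_compose[OF exp_at_bot sq])
  then show 1: "(std_normal_density \<longlongrightarrow> 0) at_top"
    by (simp add: std_normal_density_def[abs_def])
  show "(std_normal_density \<longlongrightarrow> 0) at_bot"
    unfolding at_bot_mirror filterlim_filtermap using 1 by (simp add: std_normal_density_def[abs_def])
qed

text \<open>The density satisfies \<phi>' = -x \<phi>, so \<phi> g is an antiderivative of the
  difference of the two integrands; it vanishes at both infinities because \<open>g\<close> is
  bounded.\<close>

lemma std_normal_stein:
  fixes g g' :: "real \<Rightarrow> real"
  assumes g: "\<And>x. (g has_real_derivative g' x) (at x)" and g': "continuous_on UNIV g'"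
    and bd: "\<And>x. \<bar>g x\<bar> \<le> C" "\<And>x. \<bar>g' x\<bar> \<le> C"
  shows "(\<integral>x. x * g x \<partial>std_normal_distribution) = (\<integral>x. g' x \<partial>std_normal_distribution)"
proof -
  let ?\<phi> = std_normal_density
  have C: "0 \<le> C" using bd(1)[of 0] by simp
  have cg: "continuous_on UNIV g"
    using g by (intro continuous_at_imp_continuous_on ballI) (auto intro: DERIV_isCont)
  have [measurable]: "g \<in> borel_measurable borel" "g' \<in> borel_measurable borel"
    using cg g' by (auto intro: borel_measurable_continuous_onI)
  have \<phi>0: "0 \<le> ?\<phi> x" for x by simp
  have i1: "integrable lborel (\<lambda>x. ?\<phi> x * (x * g x))"
  proof (rule Bochner_Integration.integrable_bound)
    show "integrable lborel (\<lambda>x. C * (?\<phi> x * \<bar>x\<bar> ^ 1))"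
      using integrable_std_normal_moment_abs by (intro integrable_mult_right)
    have "?\<phi> x * (\<bar>x\<bar> * \<bar>g x\<bar>) \<le> ?\<phi> x * (\<bar>x\<bar> * C)" for x
      by (intro mult_left_mono bd \<phi>0) simp
    then show "AE x in lborel. norm (?\<phi> x * (x * g x)) \<le> norm (C * (?\<phi> x * \<bar>x\<bar> ^ 1))"
      using C by (simp add: abs_mult mult_ac)
  qed simp
  have i2: "integrable lborel (\<lambda>x. ?\<phi> x * g' x)"
  proof (rule Bochner_Integration.integrable_bound)
    show "integrable lborel (\<lambda>x. C * (?\<phi> x * \<bar>x\<bar> ^ 0))"
      using integrable_std_normal_moment_abs by (intro integrable_mult_right)
    have "?\<phi> x * \<bar>g' x\<bar> \<le> ?\<phi> x * C" for x
      by (intro mult_left_mono bd \<phi>0)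
    then show "AE x in lborel. norm (?\<phi> x * g' x) \<le> norm (C * (?\<phi> x * \<bar>x\<bar> ^ 0))"
      using C by (simp add: abs_mult mult_ac)
  qed simp
  have d\<phi>: "(?\<phi> has_real_derivative - x * ?\<phi> x) (at x)" for x
  proof -
    have "((\<lambda>x. 1 / sqrt (2 * pi) * exp (- x\<^sup>2 / 2)) has_real_derivative
        1 / sqrt (2 * pi) * (exp (- x\<^sup>2 / 2) * - x)) (at x)"
      by (intro DERIV_cmult) (auto intro!: derivative_eq_intros)
    then show ?thesis by (simp add: std_normal_density_def[abs_def] mult_ac)
  qed
  have F: "((\<lambda>x. ?\<phi> x * g x) has_real_derivative ?\<phi> x * g' x - ?\<phi> x * (x * g x)) (at x)" for x
    using DERIV_mult[OF d\<phi> g, of x] by (simp add: algebra_simps)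
  have lim: "((\<lambda>x. ?\<phi> x * g x) \<longlongrightarrow> 0) G" if "(?\<phi> \<longlongrightarrow> 0) G" for G
  proof (rule Lim_null_comparison)
    show "\<forall>\<^sub>F x in G. norm (?\<phi> x * g x) \<le> ?\<phi> x * C"
      using bd(1) by (intro always_eventually allI) (simp add: abs_mult mult_left_mono)
    show "((\<lambda>x. ?\<phi> x * C) \<longlongrightarrow> 0) G" using tendsto_mult_left_zero[OF that] .
  qed
  have "(LBINT x=-\<infinity>..\<infinity>. ?\<phi> x * g' x - ?\<phi> x * (x * g x)) = 0 - 0"
  proof (rule interval_integral_FTC_integrable)
    show "((\<lambda>x. ?\<phi> x * g x) has_vector_derivative ?\<phi> x * g' x - ?\<phi> x * (x * g x)) (at x)" for x
      using F has_real_derivative_iff_has_vector_derivative by blast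
    have "continuous_on UNIV ?\<phi>" unfolding std_normal_density_def by (intro continuous_intros) auto
    then have "continuous_on UNIV (\<lambda>x. ?\<phi> x * g' x - ?\<phi> x * (x * g x))"
      by (intro continuous_intros cg g')
    then show "isCont (\<lambda>x. ?\<phi> x * g' x - ?\<phi> x * (x * g x)) x" for x
      by (simp add: continuous_on_eq_continuous_at)
    show "set_integrable lborel (einterval (-\<infinity>) \<infinity>) (\<lambda>x. ?\<phi> x * g' x - ?\<phi> x * (x * g x))"
      unfolding set_integrable_def using i1 i2 by (simp add: einterval_eq_UNIV)
    show "(((\<lambda>x. ?\<phi> x * g x) \<circ> real_of_ereal) \<longlongrightarrow> 0) (at_right (-\<infinity>))"
      "(((\<lambda>x. ?\<phi> x * g x) \<circ> real_of_ereal) \<longlongrightarrow> 0) (at_left \<infinity>)"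
      using lim std_normal_density_tendsto_0 by (simp_all add: ereal_tendsto_simps)
  qed simp
  then have "(\<integral>x. ?\<phi> x * g' x - ?\<phi> x * (x * g x) \<partial>lborel) = 0"
    by (simp add: interval_lebesgue_integral_def set_lebesgue_integral_def einterval_eq_UNIV)
  then have "(\<integral>x. ?\<phi> x * g' x \<partial>lborel) = (\<integral>x. ?\<phi> x * (x * g x) \<partial>lborel)"
    using i1 i2 by simp
  then show ?thesis by (simp add: integral_density)
qed

section \<open>Laws determined by their cosine transforms\<close>

lemma (in prob_space) integrable_mult_bounded:
  fixes u f :: "'a \<Rightarrow> real"
  assumes "u \<in> borel_measurable M" "f \<in> borel_measurable M"
    and "\<And>x. 0 \<le> u x \<and> u x \<le> C" "\<And>x. \<bar>f x\<bar> \<le> 1"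
  shows "integrable M (\<lambda>x. u x * f x)"
proof -
  have "\<bar>u x * f x\<bar> \<le> C" for x
    using mult_mono[of "\<bar>u x\<bar>" C "\<bar>f x\<bar>" 1] assms(3)[of x] assms(4)[of x] by (simp add: abs_mult)
  then show ?thesis using assms(1,2) by (intro integrable_const_bound[of _ C]) auto
qed

text \<open>Reweighting by \<open>u / Z\<close> before pushing forward makes Levy's theorem for
  probability measures available for bounded nonnegative weights.\<close>

lemma (in prob_space) distr_density_char:
  fixes u f :: "'a \<Rightarrow> real"
  assumes um[measurable]: "u \<in> borel_measurable M" and fm[measurable]: "f \<in> borel_measurable M"
    and u: "\<And>x. 0 \<le> u x \<and> u x \<le> C" and uZ: "(\<integral>x. u x \<partial>M) = Z" and Zpos: "0 < Z"
  defines "D \<equiv> distr (density M (\<lambda>x. ennreal (u x / Z))) borel f"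
  shows "real_distribution D"
    and "char D s = (complex_of_real (\<integral>x. u x * cos (s * f x) \<partial>M)
      + \<i> * complex_of_real (\<integral>x. u x * sin (s * f x) \<partial>M)) / Z"
    and "B \<in> sets borel \<Longrightarrow> measure D B = (\<integral>x. u x * indicator B (f x) \<partial>M) / Z"
proof -
  have em: "emeasure D A = ennreal ((\<integral>x. u x * indicator A (f x) \<partial>M) / Z)"
    if A[measurable]: "A \<in> sets borel" for A
  proof -
    have "emeasure D A = (\<integral>\<^sup>+x. ennreal (u x / Z) * indicator (f -` A \<inter> space M) x \<partial>M)"
      unfolding D_def by (simp add: emeasure_distr emeasure_density)
    also have "\<dots> = (\<integral>\<^sup>+x. ennreal (u x * indicator A (f x) / Z) \<partial>M)"
      by (intro nn_integral_cong) (simp split: split_indicator)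
    also have "\<dots> = ennreal (\<integral>x. u x * indicator A (f x) / Z \<partial>M)"
      using u Zpos integrable_mult_bounded[OF um _ u, of "\<lambda>x. indicator A (f x)"]
      by (intro nn_integral_eq_integral) (auto split: split_indicator)
    finally show ?thesis by simp
  qed
  have "prob_space D"
    using em[of UNIV] uZ Zpos by (intro prob_spaceI) (simp add: D_def)
  then show "real_distribution D"
    by (simp add: real_distribution_def real_distribution_axioms_def D_def)
  show "measure D B = (\<integral>x. u x * indicator B (f x) \<partial>M) / Z" if B: "B \<in> sets borel"
    using em[OF B] u Zpos by (simp add: measure_def integral_nonneg_AE)
  have "char D s = (CLINT x|M. (u x / Z) *\<^sub>R iexp (s * f x))"
    unfolding D_def char_def using u Zpos
    by (simp add: integral_distr integral_density)
  also have "\<dots> = (CLINT x|M. (u x * cos (s * f x)) + \<i> * (u x * sin (s * f x))) / Z"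
  proof -
    have e: "iexp a = complex_of_real (cos a) + \<i> * complex_of_real (sin a)" for a
      by (simp add: cis_conv_exp[symmetric] complex_eq_iff)
    have "(u x / Z) *\<^sub>R iexp (s * f x) = ((u x * cos (s * f x)) + \<i> * (u x * sin (s * f x))) / Z" for x
      unfolding e by (simp add: scaleR_conv_of_real algebra_simps add_divide_distrib)
    then show ?thesis by simp
  qed
  also have "\<dots> = ((\<integral>x. u x * cos (s * f x) \<partial>M) + \<i> * (\<integral>x. u x * sin (s * f x) \<partial>M)) / Z"
  proof -
    have i: "integrable M (\<lambda>x. complex_of_real (u x * cos (s * f x)))"
      "integrable M (\<lambda>x. complex_of_real (u x * sin (s * f x)))"
      using integrable_mult_bounded[OF um _ u, of "\<lambda>x. cos (s * f x)"] integrable_mult_bounded[OF um _ u, of "\<lambda>x. sin (s * f x)"] u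
      by (auto intro!: integrable_of_real simp del: of_real_mult)
    show ?thesis
      by (simp only: Bochner_Integration.integral_add[OF i(1) integrable_mult_right[OF i(2)]]
          integral_mult_right_zero integral_complex_of_real)
  qed
  finally show "char D s = (complex_of_real (\<integral>x. u x * cos (s * f x) \<partial>M)
      + \<i> * complex_of_real (\<integral>x. u x * sin (s * f x) \<partial>M)) / Z" .
qed

text \<open>Frequency 0 shows that both weights have the same mass, by which they are normalized.
  Mass zero admits no normalization, but then both weights vanish almost everywhere.\<close>

lemma weighted_Levy_uniqueness:
  fixes X :: "'a \<Rightarrow> real" and Y :: "'b \<Rightarrow> real"
  assumes M: "prob_space M" and N: "prob_space N"
    and [measurable]: "X \<in> borel_measurable M" "Y \<in> borel_measurable N"
      "v \<in> borel_measurable M" "w \<in> borel_measurable N"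
    and v: "\<And>x. 0 \<le> v x \<and> v x \<le> C" and w: "\<And>x. 0 \<le> w x \<and> w x \<le> C"
    and cos: "\<And>s. (\<integral>x. v x * cos (s * X x) \<partial>M) = (\<integral>x. w x * cos (s * Y x) \<partial>N)"
    and sin: "\<And>s. (\<integral>x. v x * sin (s * X x) \<partial>M) = (\<integral>x. w x * sin (s * Y x) \<partial>N)"
    and B: "B \<in> sets borel"
  shows "(\<integral>x. v x * indicator B (X x) \<partial>M) = (\<integral>x. w x * indicator B (Y x) \<partial>N)"
proof -
  interpret M: prob_space M by fact
  interpret N: prob_space N by fact
  define Z where "Z = (\<integral>x. v x \<partial>M)"
  have Zv: "(\<integral>x. w x \<partial>N) = Z" using cos[of 0] by (simp add: Z_def)
  have iv: "integrable M v" using M.integrable_mult_bounded[of v "\<lambda>_. 1" C] v by simp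
  have iw: "integrable N w" using N.integrable_mult_bounded[of w "\<lambda>_. 1" C] w by simp
  have Z0: "0 \<le> Z" unfolding Z_def using v by (intro integral_nonneg_AE) auto
  show ?thesis
  proof (cases "Z = 0")
    case True
    have "AE x in M. v x = 0" using integral_nonneg_eq_0_iff_AE[OF iv] v True by (simp add: Z_def)
    moreover have "AE x in N. w x = 0" using integral_nonneg_eq_0_iff_AE[OF iw] w True by (simp add: Zv)
    ultimately have "(\<integral>x. v x * indicator B (X x) \<partial>M) = 0" "(\<integral>x. w x * indicator B (Y x) \<partial>N) = 0"
      by (auto intro!: integral_eq_zero_AE)
    then show ?thesis by simp
  next
    case False
    then have Zpos: "0 < Z" using Z0 by simp
    note pv = M.distr_density_char[where u = v and f = X, OF _ _ v Z_def[symmetric] Zpos]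
      and pw = N.distr_density_char[where u = w and f = Y, OF _ _ w Zv Zpos]
    have "distr (density M (\<lambda>x. ennreal (v x / Z))) borel X = distr (density N (\<lambda>x. ennreal (w x / Z))) borel Y"
      by (rule Levy_uniqueness) (simp_all add: pv(1,2) pw(1,2) fun_eq_iff cos sin)
    then show ?thesis using pv(3)[OF _ _ B] pw(3)[OF _ _ B] Zpos by simp
  qed
qed

text \<open>Coordinates are converted one at a time from frequencies into Borel sets, by Levy's
  one-dimensional theorem for the finite measures with densities of the form \<open>u * (1 + cos)\<close>.\<close>
theorem distr_eqI_cos:
  fixes g :: "'a \<Rightarrow> 'e :: euclidean_space" and h :: "'b \<Rightarrow> 'e"
  assumes M: "prob_space M" and N: "prob_space N"
    and g[measurable]: "g \<in> borel_measurable M" and h[measurable]: "h \<in> borel_measurable N"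
    and eq: "\<And>\<theta> c. (\<integral>x. cos (g x \<bullet> \<theta> + c) \<partial>M) = (\<integral>x. cos (h x \<bullet> \<theta> + c) \<partial>N)"
  shows "distr M borel g = distr N borel h"
proof -
  interpret M: prob_space M by fact
  interpret N: prob_space N by fact
  have main: "(\<integral>x. (\<Prod>j\<in>J. indicator (B j) (g x \<bullet> j)) * cos (g x \<bullet> \<theta> + c) \<partial>M)
      = (\<integral>x. (\<Prod>j\<in>J. indicator (B j) (h x \<bullet> j)) * cos (h x \<bullet> \<theta> + c) \<partial>N)"
    if "finite J" "\<And>j. B j \<in> sets borel" for J B \<theta> c
    using that
  proof (induction J arbitrary: \<theta> c rule: finite_induct)
    case empty
    then show ?case using eq by simp
  next
    case (insert k J)
    note [measurable] = insert.prems
    define u where "u y = (\<Prod>j\<in>J. indicator (B j) (y \<bullet> j) :: real)" for y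
    have [measurable]: "u \<in> borel_measurable borel" unfolding u_def by measurable
    have u: "0 \<le> u y \<and> u y \<le> 1" for y
      unfolding u_def by (intro conjI prod_nonneg prod_le_1) (auto split: split_indicator)
    have IH: "(\<integral>x. u (g x) * cos (g x \<bullet> \<theta> + c) \<partial>M) = (\<integral>x. u (h x) * cos (h x \<bullet> \<theta> + c) \<partial>N)" for \<theta> c
      using insert.IH insert.prems by (simp add: u_def)
    have ub: "\<bar>u y * cos a\<bar> \<le> 1" for y a
      using mult_mono[of "\<bar>u y\<bar>" 1 "\<bar>cos a\<bar>" 1] u[of y] by (simp add: abs_mult)
    have iM: "integrable M (\<lambda>x. u (g x) * cos (g x \<bullet> \<theta> + c))" for \<theta> c
      by (rule M.integrable_const_bound[of _ 1]) (use ub in auto)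
    have iN: "integrable N (\<lambda>x. u (h x) * cos (h x \<bullet> \<theta> + c))" for \<theta> c
      by (rule N.integrable_const_bound[of _ 1]) (use ub in auto)
    \<comment> \<open>The product formula for cosines reduces each product to single cosines at
      shifted frequencies, which the induction hypothesis covers since it holds for all
      \<open>\<theta>\<close> and \<open>c\<close>.\<close>
    have cosc: "u y * (1 + cos (y \<bullet> \<theta> + c)) * cos (s * (y \<bullet> k) + b)
        = u y * cos (y \<bullet> (s *\<^sub>R k) + b) + (u y * cos (y \<bullet> (\<theta> - s *\<^sub>R k) + (c - b)) / 2
          + u y * cos (y \<bullet> (\<theta> + s *\<^sub>R k) + (c + b)) / 2)" for y \<theta> c s b
    proof -
      have e: "cos (y \<bullet> \<theta> + c) * cos (s * (y \<bullet> k) + b)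
          = (cos (y \<bullet> (\<theta> - s *\<^sub>R k) + (c - b)) + cos (y \<bullet> (\<theta> + s *\<^sub>R k) + (c + b))) / 2"
        unfolding cos_times_cos by (simp add: inner_simps algebra_simps)
      have "u y * (1 + cos (y \<bullet> \<theta> + c)) * cos (s * (y \<bullet> k) + b)
          = u y * cos (s * (y \<bullet> k) + b) + u y * (cos (y \<bullet> \<theta> + c) * cos (s * (y \<bullet> k) + b))"
        by (simp add: distrib_left distrib_right mult.assoc)
      then show ?thesis unfolding e by (simp add: add_divide_distrib distrib_left)
    qed
    have char: "(\<integral>x. u (g x) * (1 + cos (g x \<bullet> \<theta> + c)) * cos (s * (g x \<bullet> k) + b) \<partial>M)
        = (\<integral>x. u (h x) * (1 + cos (h x \<bullet> \<theta> + c)) * cos (s * (h x \<bullet> k) + b) \<partial>N)" for \<theta> c s b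
      unfolding cosc using iM iN IH by (simp del: inner_scaleR_right)
    have sc: "sin a = cos (a + (- pi / 2))" for a :: real
      using sin_cos_eq[of a] cos_minus[of "pi / 2 - a"] by simp
    have w: "0 \<le> u y * (1 + cos a) \<and> u y * (1 + cos a) \<le> 2" for y a
    proof -
      have "-1 \<le> cos a" by (rule cos_ge_minus_one)
      then have "0 \<le> 1 + cos a" by linarith
      then show ?thesis using u[of y] mult_mono[of "u y" 1 "1 + cos a" 2] by simp
    qed
    have k: "(\<integral>x. u (g x) * (1 + cos (g x \<bullet> \<theta> + c)) * indicator (B k) (g x \<bullet> k) \<partial>M)
        = (\<integral>x. u (h x) * (1 + cos (h x \<bullet> \<theta> + c)) * indicator (B k) (h x \<bullet> k) \<partial>N)" for \<theta> c
      by (rule weighted_Levy_uniqueness[OF M N _ _ _ _ w w])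
         (use char[of \<theta> c _ 0] char[of \<theta> c _ "- pi / 2"] insert.prems in \<open>simp_all add: sc\<close>)
    have ub2: "\<bar>u y * indicator A a * cos b\<bar> \<le> 1" for y b and A :: "real set" and a
      using ub[of y b] by (auto split: split_indicator)
    have iM2: "integrable M (\<lambda>x. u (g x) * indicator (B k) (g x \<bullet> k) * cos (g x \<bullet> \<theta> + c))" for \<theta> c
      by (rule M.integrable_const_bound[of _ 1]) (use ub2 in auto)
    have iN2: "integrable N (\<lambda>x. u (h x) * indicator (B k) (h x \<bullet> k) * cos (h x \<bullet> \<theta> + c))" for \<theta> c
      by (rule N.integrable_const_bound[of _ 1]) (use ub2 in auto)
    \<comment> \<open>Frequency 0 with phase pi/2 makes the cosine vanish, which isolates the
      summand 1 of the weight 1 + cos, to be subtracted afterwards.\<close>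
    have k0: "(\<integral>x. u (g x) * indicator (B k) (g x \<bullet> k) \<partial>M) = (\<integral>x. u (h x) * indicator (B k) (h x \<bullet> k) \<partial>N)"
      using k[of 0 "pi / 2"] by simp
    have iM3: "integrable M (\<lambda>x. u (g x) * indicator (B k) (g x \<bullet> k))" using iM2[of 0 0] by simp
    have iN3: "integrable N (\<lambda>x. u (h x) * indicator (B k) (h x \<bullet> k))" using iN2[of 0 0] by simp
    have split: "u y * (1 + cos a) * i = u y * i + u y * i * cos a" for y a i by (simp add: algebra_simps)
    have "(\<integral>x. u (g x) * indicator (B k) (g x \<bullet> k) * cos (g x \<bullet> \<theta> + c) \<partial>M)
        = (\<integral>x. u (h x) * indicator (B k) (h x \<bullet> k) * cos (h x \<bullet> \<theta> + c) \<partial>N)"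
      using k[of \<theta> c] k0 iM2 iN2 iM3 iN3 unfolding split by simp
    then show ?case using insert.hyps by (simp add: u_def mult_ac)
  qed
  have box: "emeasure (distr M borel g) (box a b) = emeasure (distr N borel h) (box a b)" for a b
  proof -
    have ind: "(\<Prod>j\<in>Basis. indicator {a \<bullet> j<..<b \<bullet> j} (y \<bullet> j)) = (indicator (box a b) y :: real)" for y
      by (auto simp: indicator_def mem_box prod_zero_iff split: if_splits)
    have "(\<integral>x. indicator (box a b) (g x) \<partial>M) = (\<integral>x. indicator (box a b) (h x) \<partial>N :: real)"
      using main[OF finite_Basis, of "\<lambda>j. {a \<bullet> j<..<b \<bullet> j}" 0 0] by (simp add: ind)
    moreover have "indicator (box a b) (g x) = (indicator (g -` box a b) x :: real)"
      "indicator (box a b) (h y) = (indicator (h -` box a b) y :: real)" for x y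
      by (simp_all add: indicator_def)
    ultimately have "M.prob (g -` box a b \<inter> space M) = N.prob (h -` box a b \<inter> space N)"
      by (simp add: Int_commute)
    then show ?thesis by (simp add: emeasure_distr M.emeasure_eq_measure N.emeasure_eq_measure)
  qed
  let ?E = "range (\<lambda>(a, b). box a b :: 'e set)"
  have S: "sets (borel :: 'e measure) = sigma_sets UNIV ?E"
    unfolding borel_eq_box by simp
  interpret D: prob_space "distr M borel g" by (rule M.prob_space_distr) simp
  show ?thesis
  proof (rule measure_eqI_generator_eq[where \<Omega> = UNIV and E = ?E
      and A = "\<lambda>n. box (- real n *\<^sub>R One) (real n *\<^sub>R One :: 'e)"])
    show "Int_stable ?E" by (auto simp: Int_stable_def box_Int_box)
    show "range (\<lambda>n::nat. box (- real n *\<^sub>R One) (real n *\<^sub>R One :: 'e)) \<subseteq> ?E" by auto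
    show "(\<Union>n::nat. box (- real n *\<^sub>R One) (real n *\<^sub>R One :: 'e)) = UNIV"
      using UN_box_eq_UNIV by simp
    show "emeasure (distr M borel g) X = emeasure (distr N borel h) X" if "X \<in> ?E" for X
      using that box by auto
  qed (simp_all add: S)
qed

section \<open>Decoupled estimate for bounded summands\<close>

text \<open>Realizes an independent copy concretely: \<open>U\<close> lives on the first coordinate
  of the product space and \<open>V\<close> on the second.\<close>

lemma (in prob_space) indep_var_integral_pair:
  fixes F :: "'b \<times> 'b \<Rightarrow> real"
  assumes UV: "indep_var S U R V" and F: "F \<in> borel_measurable (S \<Otimes>\<^sub>M R)"
  shows "(\<integral>\<omega>. F (U \<omega>, V \<omega>) \<partial>M) = (\<integral>z. F (U (fst z), V (snd z)) \<partial>(M \<Otimes>\<^sub>M M))"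
proof -
  have U[measurable]: "U \<in> M \<rightarrow>\<^sub>M S" and V[measurable]: "V \<in> M \<rightarrow>\<^sub>M R"
    and D: "distr M S U \<Otimes>\<^sub>M distr M R V = distr M (S \<Otimes>\<^sub>M R) (\<lambda>\<omega>. (U \<omega>, V \<omega>))"
    using UV by (auto simp: indep_var_distribution_eq)
  note F[measurable]
  interpret V: prob_space "distr M R V" by (rule prob_space_distr) simp
  have "distr M S U \<Otimes>\<^sub>M distr M R V = distr (M \<Otimes>\<^sub>M M) (S \<Otimes>\<^sub>M R) (\<lambda>(x, y). (U x, V y))"
    by (rule pair_measure_distr) (auto intro: V.sigma_finite_measure_axioms)
  then have "integral\<^sup>L (distr M (S \<Otimes>\<^sub>M R) (\<lambda>\<omega>. (U \<omega>, V \<omega>))) F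
      = integral\<^sup>L (distr (M \<Otimes>\<^sub>M M) (S \<Otimes>\<^sub>M R) (\<lambda>(x, y). (U x, V y))) F"
    by (simp add: D)
  then show ?thesis
    by (subst (asm) (1 2) integral_distr) (simp_all add: case_prod_beta)
qed

lemma norm_matrix_component_le: "cmod ((A :: complex^'n^'m) $ a $ b) \<le> norm A"
  by (rule order_trans[OF Finite_Cartesian_Product.norm_nth_le Finite_Cartesian_Product.norm_nth_le])

lemma integrable_component_mult:
  fixes f :: "'w \<Rightarrow> complex^'n^'n"
  assumes f: "f \<in> borel_measurable M" and sq: "integrable M (\<lambda>\<omega>. (norm (f \<omega>))\<^sup>2)"
  shows "integrable M (\<lambda>\<omega>. f \<omega> $ a $ b * f \<omega> $ c $ d)"
proof (rule Bochner_Integration.integrable_bound[OF sq])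
  show "(\<lambda>\<omega>. f \<omega> $ a $ b * f \<omega> $ c $ d) \<in> borel_measurable M"
    by (rule borel_measurable_continuous_Pair[OF f f]) (intro continuous_intros)
  show "AE \<omega> in M. norm (f \<omega> $ a $ b * f \<omega> $ c $ d) \<le> norm ((norm (f \<omega>))\<^sup>2)"
    by (intro AE_I2) (simp add: norm_mult power2_eq_square mult_mono norm_matrix_component_le)
qed

section \<open>Continuity, crude bounds and integrability of the trace functionals\<close>

context resolvent_words
begin

lemma tr1_linear: "bounded_linear (tr1 a (A :: complex^'n^'n))"
  unfolding tr1_def
  by (rule bounded_linear_compose[OF bounded_linear_Re_trace matrix_mult.bounded_linear_right])

lemma dF_linear: "bounded_linear (dF p (A :: complex^'n^'n))"
  unfolding dF_def by (intro bounded_linear_sum tr1_linear)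

lemma continuous_Re_trace: "continuous_on S f \<Longrightarrow> continuous_on S (\<lambda>x. Re (trace (f x :: complex^'n^'n)))"
  by (rule bounded_linear.continuous_on[OF bounded_linear_Re_trace])

lemma continuous_word: "continuous_on S f \<Longrightarrow> continuous_on S (\<lambda>x. word a (f x :: complex^'n^'n))"
  by (rule continuous_on_compose2[OF continuous_on_word[of UNIV]]) auto

lemma continuous_tr0:
  fixes f :: "'x :: topological_space \<Rightarrow> complex^'n^'n"
  assumes "continuous_on S f"
  shows "continuous_on S (\<lambda>x. tr0 a (f x))"
  unfolding tr0_def by (intro continuous_Re_trace continuous_word assms)

lemma
  fixes f :: "'x :: topological_space \<Rightarrow> complex^'n^'n"
  assumes "continuous_on S f" "continuous_on S g"
  shows continuous_dF: "continuous_on S (\<lambda>x. dF p (f x) (g x))"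
    and continuous_d2F: "continuous_on S (\<lambda>x. d2F p (f x) (g x) (g x))"
    and continuous_tau: "continuous_on S (\<lambda>x. tau p \<kappa> (f x) (g x))"
  unfolding tr1_def dF_def d2F_def tr2_def T_def tau_def divide_inverse
  by (intro continuous_intros continuous_Re_trace continuous_word assms)+

lemma tr0_measurable [measurable]:
  fixes f :: "'x \<Rightarrow> complex^'n^'n"
  assumes "f \<in> borel_measurable K"
  shows "(\<lambda>x. tr0 a (f x)) \<in> borel_measurable K"
  by (rule measurable_compose[OF assms borel_measurable_continuous_onI[OF continuous_tr0[OF continuous_on_id]]])

lemma
  fixes f g :: "'x \<Rightarrow> complex^'n^'n"
  assumes f: "f \<in> borel_measurable K" and g: "g \<in> borel_measurable K"
  shows dF_measurable [measurable]: "(\<lambda>x. dF p (f x) (g x)) \<in> borel_measurable K"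
    and d2F_measurable [measurable]: "(\<lambda>x. d2F p (f x) (g x) (g x)) \<in> borel_measurable K"
    and tau_measurable [measurable]: "(\<lambda>x. tau p \<kappa> (f x) (g x)) \<in> borel_measurable K"
  by (rule borel_measurable_continuous_Pair[OF f g];
      intro continuous_dF continuous_d2F continuous_tau continuous_intros)+

lemma abs_tr1_le: "\<exists>C. \<forall>A V. \<bar>tr1 a (A :: complex^'n^'n) V\<bar> \<le> C * norm V"
proof (intro exI allI)
  fix A V :: "complex^'n^'n"
  have "\<bar>tr1 a A V\<bar> \<le> norm (word a A) * norm V"
    unfolding tr1_def by (rule abs_Re_trace_mult_le)
  also have "\<dots> \<le> (CARD('n) * (1 / \<eta>) ^ length a) * norm V"
    by (intro mult_right_mono norm_word_le) simp
  finally show "\<bar>tr1 a A V\<bar> \<le> (CARD('n) * (1 / \<eta>) ^ length a) * norm V" .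
qed

lemma abs_tr2_le: "\<exists>C. \<forall>A U V. \<bar>tr2 a b (A :: complex^'n^'n) U V\<bar> \<le> C * (norm U * norm V)"
proof (intro exI allI)
  fix A U V :: "complex^'n^'n"
  have "\<bar>tr2 a b A U V\<bar> \<le> norm (word a A ** U ** word b A) * norm V"
    unfolding tr2_def by (rule abs_Re_trace_mult_le)
  also have "\<dots> \<le> (norm (word a A) * norm U * norm (word b A)) * norm V"
    by (intro mult_right_mono order_trans[OF norm_matrix_mult_le] norm_matrix_mult_le) simp_all
  also have "\<dots> \<le> ((CARD('n) * (1 / \<eta>) ^ length a) * norm U * (CARD('n) * (1 / \<eta>) ^ length b)) * norm V"
    using \<eta>_pos by (intro mult_right_mono mult_mono norm_word_le) simp_all
  finally show "\<bar>tr2 a b A U V\<bar>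
      \<le> ((CARD('n) * (1 / \<eta>) ^ length a) * (CARD('n) * (1 / \<eta>) ^ length b)) * (norm U * norm V)"
    by (simp add: mult_ac)
qed

lemma sum_bound:
  assumes "\<And>i. i \<in> J \<Longrightarrow> \<exists>C. \<forall>x. \<bar>f i x\<bar> \<le> C * (b x :: real)"
  shows "\<exists>C. \<forall>x. \<bar>\<Sum>i\<in>J. f i x\<bar> \<le> C * b x"
proof -
  from assms have "\<forall>i. \<exists>C. i \<in> J \<longrightarrow> (\<forall>x. \<bar>f i x\<bar> \<le> C * b x)" by blast
  then obtain C where C: "\<And>i x. i \<in> J \<Longrightarrow> \<bar>f i x\<bar> \<le> C i * b x" by metis
  have "\<bar>\<Sum>i\<in>J. f i x\<bar> \<le> (\<Sum>i\<in>J. C i) * b x" for x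
    unfolding sum_distrib_right by (intro order_trans[OF sum_abs] sum_mono C)
  then show ?thesis by blast
qed

lemma abs_dF_le: "\<exists>C. \<forall>A V. \<bar>dF p (A :: complex^'n^'n) V\<bar> \<le> C * norm V"
proof -
  have "\<exists>C. \<forall>x. \<bar>\<Sum>l<2 * p. (\<lambda>(A :: complex^'n^'n, V). tr1 (rot p l) A V) x\<bar>
      \<le> C * (\<lambda>(A, V). norm V) x"
    by (intro sum_bound) (simp add: abs_tr1_le)
  then show ?thesis by (simp add: dF_def)
qed

lemma abs_d2F_le: "\<exists>C. \<forall>A U V. \<bar>d2F p (A :: complex^'n^'n) U V\<bar> \<le> C * (norm U * norm V)"
proof -
  have "\<exists>C. \<forall>x. \<bar>\<Sum>l<2 * p. \<Sum>k<2 * p + 1. (\<lambda>(A :: complex^'n^'n, U, V).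
      tr2 (take (Suc k) (rot p l)) (drop k (rot p l)) A U V) x\<bar> \<le> C * (\<lambda>(A, U, V). norm U * norm V) x"
    by (intro sum_bound) (simp add: abs_tr2_le)
  then show ?thesis by (simp add: d2F_def)
qed

lemma abs_T_le: "\<exists>C. \<forall>A V. \<bar>T m (A :: complex^'n^'n) V\<bar> \<le> C * (norm V)\<^sup>2"
proof -
  obtain C where C: "\<forall>A V. \<bar>tr1 (bal m) (A :: complex^'n^'n) V\<bar> \<le> C * norm V"
    using abs_tr1_le[of "bal m"] by blast
  have "\<bar>T m (A :: complex^'n^'n) V\<bar> \<le> \<bar>C\<bar> * (norm V)\<^sup>2" for A V
  proof -
    have "\<bar>T m A V\<bar> \<le> C * norm (V ** V)" unfolding T_def using C by blast
    also have "\<dots> \<le> \<bar>C\<bar> * (norm V * norm V)"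
      by (intro mult_mono norm_matrix_mult_le) auto
    finally show ?thesis by (simp add: power2_eq_square)
  qed
  then show ?thesis by blast
qed

lemma abs_tau_le: "\<exists>C. \<forall>A V. \<bar>tau p \<kappa> (A :: complex^'n^'n) V\<bar> \<le> C * (norm V)\<^sup>2"
proof -
  obtain C1 where C1: "\<forall>A V. \<bar>T p (A :: complex^'n^'n) V\<bar> \<le> C1 * (norm V)\<^sup>2"
    using abs_T_le[of p] by blast
  obtain C2 where C2: "\<forall>A V. \<bar>T (p - 1) (A :: complex^'n^'n) V\<bar> \<le> C2 * (norm V)\<^sup>2"
    using abs_T_le[of "p - 1"] by blast
  have "\<bar>tau p \<kappa> (A :: complex^'n^'n) V\<bar> \<le> (\<bar>\<kappa>\<bar> * C1 + C2 / \<bar>\<kappa>\<bar>) / 2 * (norm V)\<^sup>2" for A V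
  proof -
    have "\<bar>tau p \<kappa> A V\<bar> \<le> (\<bar>\<kappa>\<bar> * \<bar>T p A V\<bar> + \<bar>T (p - 1) A V\<bar> / \<bar>\<kappa>\<bar>) / 2"
      using abs_triangle_ineq[of "\<kappa> * T p A V" "T (p - 1) A V / \<kappa>"] by (simp add: tau_def abs_mult)
    also have "\<dots> \<le> (\<bar>\<kappa>\<bar> * (C1 * (norm V)\<^sup>2) + (C2 * (norm V)\<^sup>2) / \<bar>\<kappa>\<bar>) / 2"
      using C1 C2 by (intro divide_right_mono add_mono mult_left_mono) auto
    finally show ?thesis by (simp add: algebra_simps add_divide_distrib)
  qed
  then show ?thesis by blast
qed

lemma
  fixes f g :: "'x \<Rightarrow> complex^'n^'n"
  assumes K: "prob_space K" and f: "f \<in> borel_measurable K" and g: "g \<in> borel_measurable K"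
    and c: "\<And>x. x \<in> space K \<Longrightarrow> norm (g x) \<le> c"
  shows integrable_dF: "integrable K (\<lambda>x. dF p (f x) (g x))"
    and integrable_d2F: "integrable K (\<lambda>x. d2F p (f x) (g x) (g x))"
    and integrable_tau: "integrable K (\<lambda>x. tau p \<kappa> (f x) (g x))"
proof -
  interpret K: prob_space K by fact
  note [measurable] = f g
  obtain C1 where C1: "\<And>A V :: complex^'n^'n. \<bar>dF p A V\<bar> \<le> C1 * norm V" using abs_dF_le[of p] by blast
  obtain C2 where C2: "\<And>A U V :: complex^'n^'n. \<bar>d2F p A U V\<bar> \<le> C2 * (norm U * norm V)"
    using abs_d2F_le[of p] by blast
  obtain C3 where C3: "\<And>A V :: complex^'n^'n. \<bar>tau p \<kappa> A V\<bar> \<le> C3 * (norm V)\<^sup>2"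
    using abs_tau_le[of p \<kappa>] by blast
  have b: "\<bar>dF p A V\<bar> \<le> \<bar>C1\<bar> * c" "\<bar>d2F p A V V\<bar> \<le> \<bar>C2\<bar> * (c * c)" "\<bar>tau p \<kappa> A V\<bar> \<le> \<bar>C3\<bar> * c\<^sup>2"
    if "norm V \<le> c" for A V :: "complex^'n^'n"
    using that order_trans[OF norm_ge_zero that]
    by (auto intro!: order_trans[OF C1] order_trans[OF C2] order_trans[OF C3] mult_mono power_mono)
  show "integrable K (\<lambda>x. dF p (f x) (g x))"
    by (rule K.integrable_const_bound[of _ "\<bar>C1\<bar> * c"]) (use b(1) c in auto)
  show "integrable K (\<lambda>x. d2F p (f x) (g x) (g x))"
    by (rule K.integrable_const_bound[of _ "\<bar>C2\<bar> * (c * c)"]) (use b(2) c in auto)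
  show "integrable K (\<lambda>x. tau p \<kappa> (f x) (g x))"
    by (rule K.integrable_const_bound[of _ "\<bar>C3\<bar> * c\<^sup>2"]) (use b(3) c in auto)
qed

lemma abs_tr0_le: "\<exists>C. \<forall>A. \<bar>tr0 a (A :: complex^'n^'n)\<bar> \<le> C"
proof -
  obtain C where "\<forall>A V. \<bar>tr1 a (A :: complex^'n^'n) V\<bar> \<le> C * norm V" using abs_tr1_le by blast
  from this[rule_format, of _ "mat 1"] show ?thesis
    by (intro exI[of _ "C * norm (mat 1 :: complex^'n^'n)"]) (simp add: tr0_def tr1_def)
qed

end

section \<open>Independent bounded centred summands\<close>

lemma norm_le_spectral_norm: "norm (A :: complex^'n^'n) \<le> spectral_norm A * norm (mat 1 :: complex^'n^'n)"
  using norm_matrix_mult_le_left[of A "mat 1"] by simp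

text \<open>The bound is required at every point of the space, since the pathwise estimates are
  applied pointwise; an essential bound is brought to this form by modifying the summands on a null
  set.\<close>

locale bounded_summands = resolvent_words \<zeta> + prob_space M
  for \<zeta> :: complex and M :: "'a measure" +
  fixes Y :: "'i \<Rightarrow> 'a \<Rightarrow> complex^'n^'n" and I :: "'i set" and L :: real and p :: nat
  assumes finite_I: "finite I" and indep: "indep_vars (\<lambda>_. borel) Y I"
    and Y_self_adjoint: "\<And>i \<omega>. i \<in> I \<Longrightarrow> \<omega> \<in> space M \<Longrightarrow> self_adjoint (Y i \<omega>)"
    and Y_le: "\<And>i \<omega>. i \<in> I \<Longrightarrow> \<omega> \<in> space M \<Longrightarrow> spectral_norm (Y i \<omega>) \<le> L"
    and Y_centred: "\<And>i. i \<in> I \<Longrightarrow> (\<integral>\<omega>. Y i \<omega> \<partial>M) = 0"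
    and small: "4 * p * L \<le> \<eta>" and p_pos: "p \<ge> 1"
begin

sublocale MM: pair_prob_space M M ..

definition S :: "'a \<Rightarrow> complex^'n^'n" where "S \<omega> = (\<Sum>i\<in>I. Y i \<omega>)"

lemma Y_measurable: "i \<in> I \<Longrightarrow> Y i \<in> borel_measurable M"
  using indep by (auto simp: indep_vars_def2)

lemma S_measurable [measurable]: "S \<in> borel_measurable M"
  unfolding S_def using Y_measurable by (intro borel_measurable_sum)

lemma norm_Y_le: "i \<in> I \<Longrightarrow> \<omega> \<in> space M \<Longrightarrow> norm (Y i \<omega>) \<le> L * norm (mat 1 :: complex^'n^'n)"
  using norm_le_spectral_norm[of "Y i \<omega>"] mult_right_mono[OF Y_le[of i \<omega>], of "norm (mat 1 :: complex^'n^'n)"]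
  by simp

lemma integrable_Y: "i \<in> I \<Longrightarrow> integrable M (Y i)"
  using norm_Y_le[of i] Y_measurable[of i]
  by (intro integrable_const_bound[of _ "L * norm (mat 1 :: complex^'n^'n)"]) auto

text \<open>Origin of the factor 12: (E - 1) E^2 = 2205/4096 is below 1, so \<open>m\<close> can be
  absorbed and is at most about 2.843 \<open>h\<close>. The bracket is about 4.004, and the product
  is about 11.4.\<close>

lemma E_budget:
  assumes "m \<le> E * h + (E - 1) * E\<^sup>2 * m" and "0 \<le> h"
  shows "(3 / 4 * E\<^sup>2 + E + (E - 1 / 2) * E\<^sup>2) * m \<le> 12 * h"
  using assms by (simp add: E_def power2_eq_square)

text \<open>\<open>W\<close> omits summand \<open>i\<close> and is independent of it. Expanding at
  \<open>W\<close>, the constant term vanishes by centring and the remainder costs 3/4 E^2. In the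
  second derivative independence allows the copy on the second coordinate, after which the omitted
  summand is restored in the argument. All errors are multiples of the mean energy \<open>m\<close>
  at \<open>W\<close>, which is finally compared with the mean energy \<open>h\<close> at the full
  sum.\<close>

lemma summand_estimate:
  assumes i: "i \<in> I" and r: "r \<in> {0..1}" and \<kappa>: "0 < \<kappa>"
  shows "\<bar>(\<integral>\<omega>. dF p (B + r *\<^sub>R S \<omega>) (Y i \<omega>) \<partial>M)
      - r * (\<integral>z. d2F p (B + r *\<^sub>R S (fst z)) (Y i (snd z)) (Y i (snd z)) \<partial>(M \<Otimes>\<^sub>M M))\<bar>
    \<le> r\<^sup>2 * (words3 p * (L / \<eta> ^ 4)) *
      (12 * (\<integral>z. tau p \<kappa> (B + r *\<^sub>R S (fst z)) (Y i (snd z)) \<partial>(M \<Otimes>\<^sub>M M)))"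
proof -
  define U where "U \<omega> = (\<Sum>j\<in>I - {i}. Y j \<omega>)" for \<omega>
  define W where "W \<omega> = B + r *\<^sub>R U \<omega>" for \<omega>
  have SU: "S \<omega> = U \<omega> + Y i \<omega>" for \<omega>
    unfolding S_def U_def using i finite_I by (simp add: sum.remove add.commute)
  have WS: "B + r *\<^sub>R S \<omega> = W \<omega> + r *\<^sub>R Y i \<omega>" for \<omega>
    by (simp add: SU W_def scaleR_add_right)
  note [measurable] = Y_measurable[OF i]
  have [measurable]: "U \<in> borel_measurable M"
    unfolding U_def using Y_measurable by (intro borel_measurable_sum) auto
  have [measurable]: "W \<in> borel_measurable M" unfolding W_def by measurable
  have ind: "indep_var borel U borel (Y i)"
    using indep_var_sum_other[OF indep i finite_I] by (simp add: U_def[abs_def])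
  define c where "c = L * norm (mat 1 :: complex^'n^'n)"
  have Yc: "norm (Y i \<omega>) \<le> c" if "\<omega> \<in> space M" for \<omega>
    using norm_Y_le[OF i that] by (simp add: c_def)
  have sp: "fst z \<in> space M" "snd z \<in> space M" if "z \<in> space (M \<Otimes>\<^sub>M M)" for z
    using that by (auto simp: space_pair_measure)
  have Ys: "(\<lambda>z. Y i (snd z)) \<in> borel_measurable (M \<Otimes>\<^sub>M M)" "(\<lambda>z. Y i (fst z)) \<in> borel_measurable (M \<Otimes>\<^sub>M M)"
    by measurable
  note i1 = integrable_dF[OF prob_space_axioms _ Y_measurable[OF i] Yc]
    and i2 = integrable_d2F[OF prob_space_axioms _ Y_measurable[OF i] Yc]
    and i3 = integrable_tau[OF prob_space_axioms _ Y_measurable[OF i] Yc]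
    and j2 = integrable_d2F[OF MM.P.prob_space_axioms _ Ys(1) Yc[OF sp(2)]]
    and j3 = integrable_tau[OF MM.P.prob_space_axioms _ Ys(1) Yc[OF sp(2)]]
  have XS: "(\<lambda>\<omega>. B + r *\<^sub>R S \<omega>) \<in> borel_measurable M" and WM: "W \<in> borel_measurable M" by measurable
  have fs: "(\<lambda>z. B + r *\<^sub>R S (fst z)) \<in> borel_measurable (M \<Otimes>\<^sub>M M)" "(\<lambda>z. W (fst z)) \<in> borel_measurable (M \<Otimes>\<^sub>M M)"
    by measurable
  note i1s = i1[OF XS] i1[OF WM] and i2s = i2[OF WM] and i3s = i3[OF WM]
    and j2s = j2[OF fs(1)] j2[OF fs(2)] and j3s = j3[OF fs(1)] j3[OF fs(2)]
  note j3' = integrable_tau[OF MM.P.prob_space_axioms fs(2) Ys(2) Yc[OF sp(1)]]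
  define m where "m = (\<integral>\<omega>. tau p \<kappa> (W \<omega>) (Y i \<omega>) \<partial>M)"
  define h where "h = (\<integral>z. tau p \<kappa> (B + r *\<^sub>R S (fst z)) (Y i (snd z)) \<partial>(M \<Otimes>\<^sub>M M))"
  have m_pair: "(\<integral>z. tau p \<kappa> (W (fst z)) (Y i (snd z)) \<partial>(M \<Otimes>\<^sub>M M)) = m"
    unfolding m_def W_def
    using indep_var_integral_pair[OF ind, of "\<lambda>x. tau p \<kappa> (B + r *\<^sub>R fst x) (snd x)"] by simp
  have m_fst: "(\<integral>z. tau p \<kappa> (W (fst z)) (Y i (fst z)) \<partial>(M \<Otimes>\<^sub>M M)) = m"
    using MM.integral_fst'[OF j3'] by (simp add: m_def prob_space)
  have d2_pair: "(\<integral>\<omega>. d2F p (W \<omega>) (Y i \<omega>) (Y i \<omega>) \<partial>M)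
      = (\<integral>z. d2F p (W (fst z)) (Y i (snd z)) (Y i (snd z)) \<partial>(M \<Otimes>\<^sub>M M))"
    unfolding W_def
    using indep_var_integral_pair[OF ind, of "\<lambda>x. d2F p (B + r *\<^sub>R fst x) (snd x) (snd x)"] by simp
  have d1: "(\<integral>\<omega>. dF p (W \<omega>) (Y i \<omega>) \<partial>M) = 0"
  proof -
    have "(\<integral>\<omega>. dF p (W \<omega>) (Y i \<omega>) \<partial>M) = (\<integral>\<omega>. \<integral>\<omega>'. dF p (W \<omega>) (Y i \<omega>') \<partial>M \<partial>M)"
      unfolding W_def
      using indep_var_integral_decouple(1)[OF ind, of "\<lambda>x. dF p (B + r *\<^sub>R fst x) (snd x)"]
        i1[OF WM] by (simp add: W_def)
    moreover have "(\<integral>\<omega>'. dF p (W \<omega>) (Y i \<omega>') \<partial>M) = 0" for \<omega>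
      using integral_bounded_linear[OF dF_linear[of p "W \<omega>"] integrable_Y[OF i]] Y_centred[OF i]
        linear_0[OF bounded_linear.linear[OF dF_linear[of p "W \<omega>"]]] by simp
    ultimately show ?thesis by simp
  qed
  define K where "K = words3 p * (L / \<eta> ^ 4)"
  have sa: "self_adjoint (Y i \<omega>)" and nL: "spectral_norm (Y i \<omega>) \<le> L" if "\<omega> \<in> space M" for \<omega>
    using Y_self_adjoint[OF i that] Y_le[OF i that] by auto
  obtain \<omega>0 where "\<omega>0 \<in> space M" using not_empty by blast
  then have L0: "0 \<le> L" using nL spectral_norm_nonneg order_trans by metis
  have K0: "0 \<le> K" using L0 \<eta>_pos by (simp add: K_def words3_def)
  have h0: "0 \<le> h" unfolding h_def
    using sp by (intro integral_nonneg_AE AE_I2 tau_nonneg sa \<kappa>) auto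
  \<comment> \<open>The original summand moves the matrix, the copy is the tested direction. The
    energy of the original at \<open>W\<close> again has mean \<open>m\<close>, and this is how
    \<open>m\<close> comes to be bounded in terms of itself.\<close>
  have growth: "tau p \<kappa> (W (fst z)) (Y i (snd z))
      \<le> E * tau p \<kappa> (B + r *\<^sub>R S (fst z)) (Y i (snd z)) + (E - 1) * E\<^sup>2 * tau p \<kappa> (W (fst z)) (Y i (fst z))"
    if "z \<in> space (M \<Otimes>\<^sub>M M)" for z
    unfolding WS
    by (rule tau_start_le[OF sa[OF sp(1)[OF that]] sa[OF sp(2)[OF that]]
          nL[OF sp(1)[OF that]] nL[OF sp(2)[OF that]] small p_pos \<kappa> r])
  have "m \<le> (\<integral>z. E * tau p \<kappa> (B + r *\<^sub>R S (fst z)) (Y i (snd z))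
      + (E - 1) * E\<^sup>2 * tau p \<kappa> (W (fst z)) (Y i (fst z)) \<partial>(M \<Otimes>\<^sub>M M))"
    unfolding m_pair[symmetric] using growth j3s j3'
    by (intro integral_mono Bochner_Integration.integrable_add integrable_mult_right) auto
  also have "\<dots> = E * h + (E - 1) * E\<^sup>2 * m"
    using j3s j3' by (simp add: h_def m_fst)
  finally have budget: "(3 / 4 * E\<^sup>2 + E + (E - 1 / 2) * E\<^sup>2) * m \<le> 12 * h"
    using h0 by (rule E_budget)
  have first: "\<bar>(\<integral>\<omega>. dF p (B + r *\<^sub>R S \<omega>) (Y i \<omega>) \<partial>M) - r * (\<integral>\<omega>. d2F p (W \<omega>) (Y i \<omega>) (Y i \<omega>) \<partial>M)\<bar>
      \<le> r\<^sup>2 * K * (3 / 4 * E\<^sup>2 * m)"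
  proof -
    have "\<bar>\<integral>\<omega>. dF p (B + r *\<^sub>R S \<omega>) (Y i \<omega>) - dF p (W \<omega>) (Y i \<omega>) - r * d2F p (W \<omega>) (Y i \<omega>) (Y i \<omega>) \<partial>M\<bar>
        \<le> (\<integral>\<omega>. r\<^sup>2 * K * (3 / 4 * E\<^sup>2) * tau p \<kappa> (W \<omega>) (Y i \<omega>) \<partial>M)"
    proof (rule order_trans[OF integral_abs_bound], rule integral_mono)
      fix \<omega> assume \<omega>: "\<omega> \<in> space M"
      have "\<bar>dF p (B + r *\<^sub>R S \<omega>) (Y i \<omega>) - dF p (W \<omega>) (Y i \<omega>) - r * d2F p (W \<omega>) (Y i \<omega>) (Y i \<omega>)\<bar>
          \<le> r\<^sup>2 / 2 * (words3 p * (L / \<eta> ^ 4 * (3 / 2 * E\<^sup>2 * tau p \<kappa> (W \<omega>) (Y i \<omega>))))"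
        unfolding WS by (rule dF_remainder_le[OF sa[OF \<omega>] sa[OF \<omega>] nL[OF \<omega>] nL[OF \<omega>] small p_pos \<kappa> r])
      then show "\<bar>dF p (B + r *\<^sub>R S \<omega>) (Y i \<omega>) - dF p (W \<omega>) (Y i \<omega>) - r * d2F p (W \<omega>) (Y i \<omega>) (Y i \<omega>)\<bar>
          \<le> r\<^sup>2 * K * (3 / 4 * E\<^sup>2) * tau p \<kappa> (W \<omega>) (Y i \<omega>)"
        by (simp add: K_def field_simps)
    qed (use i1s i2s i3s in \<open>auto intro!: integrable_abs Bochner_Integration.integrable_diff integrable_mult_right\<close>)
    then show ?thesis using i1s i2s by (simp add: d1 m_def[symmetric] mult.assoc)
  qed
  \<comment> \<open>Only here are copy and original both present: the copy is the direction of the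
    second derivative, the original the increment of the argument.\<close>
  have second: "\<bar>(\<integral>z. d2F p (B + r *\<^sub>R S (fst z)) (Y i (snd z)) (Y i (snd z)) \<partial>(M \<Otimes>\<^sub>M M))
      - (\<integral>z. d2F p (W (fst z)) (Y i (snd z)) (Y i (snd z)) \<partial>(M \<Otimes>\<^sub>M M))\<bar>
      \<le> r * K * ((E + (E - 1 / 2) * E\<^sup>2) * m)"
  proof -
    have "\<bar>\<integral>z. d2F p (B + r *\<^sub>R S (fst z)) (Y i (snd z)) (Y i (snd z))
          - d2F p (W (fst z)) (Y i (snd z)) (Y i (snd z)) \<partial>(M \<Otimes>\<^sub>M M)\<bar>
        \<le> (\<integral>z. r * K * (E * tau p \<kappa> (W (fst z)) (Y i (snd z))
            + (E - 1 / 2) * E\<^sup>2 * tau p \<kappa> (W (fst z)) (Y i (fst z))) \<partial>(M \<Otimes>\<^sub>M M))"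
    proof (rule order_trans[OF integral_abs_bound], rule integral_mono)
      fix z assume z: "z \<in> space (M \<Otimes>\<^sub>M M)"
      show "\<bar>d2F p (B + r *\<^sub>R S (fst z)) (Y i (snd z)) (Y i (snd z))
          - d2F p (W (fst z)) (Y i (snd z)) (Y i (snd z))\<bar>
        \<le> r * K * (E * tau p \<kappa> (W (fst z)) (Y i (snd z))
            + (E - 1 / 2) * E\<^sup>2 * tau p \<kappa> (W (fst z)) (Y i (fst z)))"
        using d2F_difference_le[OF sa[OF sp(1)[OF z]] sa[OF sp(2)[OF z]] nL[OF sp(1)[OF z]] nL[OF sp(2)[OF z]]
            small p_pos \<kappa> r, of "W (fst z)"]
        by (simp add: WS K_def mult.assoc)
    qed (use j2s j3s j3' in \<open>auto intro!: integrable_abs Bochner_Integration.integrable_diff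
        Bochner_Integration.integrable_add integrable_mult_right\<close>)
    then show ?thesis using j2s j3s j3' by (simp add: m_pair m_fst algebra_simps)
  qed
  let ?a = "\<integral>\<omega>. dF p (B + r *\<^sub>R S \<omega>) (Y i \<omega>) \<partial>M"
  let ?b = "\<integral>z. d2F p (B + r *\<^sub>R S (fst z)) (Y i (snd z)) (Y i (snd z)) \<partial>(M \<Otimes>\<^sub>M M)"
  let ?c = "\<integral>z. d2F p (W (fst z)) (Y i (snd z)) (Y i (snd z)) \<partial>(M \<Otimes>\<^sub>M M)"
  have "\<bar>?a - r * ?b\<bar> \<le> \<bar>?a - r * ?c\<bar> + r * \<bar>?b - ?c\<bar>"
  proof -
    have "?a - r * ?b = (?a - r * ?c) + - (r * (?b - ?c))" by (simp add: algebra_simps)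
    then have "\<bar>?a - r * ?b\<bar> \<le> \<bar>?a - r * ?c\<bar> + \<bar>- (r * (?b - ?c))\<bar>"
      using abs_triangle_ineq[of "?a - r * ?c" "- (r * (?b - ?c))"] by simp
    then show ?thesis using r by (simp add: abs_mult)
  qed
  also have "\<dots> \<le> r\<^sup>2 * K * (3 / 4 * E\<^sup>2 * m) + r * (r * K * ((E + (E - 1 / 2) * E\<^sup>2) * m))"
    using r by (intro add_mono mult_left_mono first[unfolded d2_pair] second) auto
  also have "\<dots> = r\<^sup>2 * K * ((3 / 4 * E\<^sup>2 + E + (E - 1 / 2) * E\<^sup>2) * m)"
    by (simp add: power2_eq_square algebra_simps)
  also have "\<dots> \<le> r\<^sup>2 * K * (12 * h)"
    using budget K0 by (intro mult_left_mono) auto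
  finally show ?thesis by (simp only: K_def h_def)
qed

text \<open>By independence and centring this is the second moment of the sum \<open>S\<close>, so
  its spectral norm is the matrix variance.\<close>

definition Y2 :: "complex^'n^'n" where "Y2 = (\<Sum>i\<in>I. \<integral>\<omega>. Y i \<omega> ** Y i \<omega> \<partial>M)"

text \<open>The second-order term with decoupled directions; Gaussian integration by parts produces
  the same function from the covariance.\<close>

definition mean_d2F :: "complex^'n^'n \<Rightarrow> real"
  where "mean_d2F A = (\<Sum>i\<in>I. \<integral>\<omega>. d2F p A (Y i \<omega>) (Y i \<omega>) \<partial>M)"

lemma integrable_Y_sq:
  assumes i: "i \<in> I"
  shows "integrable M (\<lambda>\<omega>. Y i \<omega> ** Y i \<omega>)"
proof (rule integrable_const_bound)
  let ?c = "L * norm (mat 1 :: complex^'n^'n)"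
  show "AE \<omega> in M. norm (Y i \<omega> ** Y i \<omega>) \<le> ?c * ?c"
  proof (rule AE_I2)
    fix \<omega> assume "\<omega> \<in> space M"
    note le = norm_Y_le[OF i this]
    show "norm (Y i \<omega> ** Y i \<omega>) \<le> ?c * ?c"
      by (intro order_trans[OF norm_matrix_mult_le] mult_mono le order_trans[OF norm_ge_zero le] norm_ge_zero)
  qed
  show "(\<lambda>\<omega>. Y i \<omega> ** Y i \<omega>) \<in> borel_measurable M"
    by (rule borel_measurable_continuous_Pair[OF Y_measurable[OF i] Y_measurable[OF i]])
      (intro continuous_intros)
qed

text \<open>For fixed \<open>A\<close> the energy is linear in the square of the direction, so the
  averages add up to \<open>Y2\<close> before any norm is taken. The norm of the sum appears in
  place of a sum of norms.\<close>

lemma sum_tau_le: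
  assumes \<kappa>: "0 < \<kappa>"
  shows "(\<Sum>i\<in>I. \<integral>\<omega>. tau p \<kappa> A (Y i \<omega>) \<partial>M)
    \<le> spectral_norm Y2 * ((\<kappa> * tr0 (bal p) A + tr0 (bal (p - 1)) A / \<kappa>) / 2)"
proof -
  have T: "integrable M (\<lambda>\<omega>. T m A (Y i \<omega>)) \<and> (\<integral>\<omega>. T m A (Y i \<omega>) \<partial>M) = tr1 (bal m) A (\<integral>\<omega>. Y i \<omega> ** Y i \<omega> \<partial>M)"
    if "i \<in> I" for i m
    unfolding T_def
    using integrable_bounded_linear[OF tr1_linear integrable_Y_sq[OF that]]
      integral_bounded_linear[OF tr1_linear integrable_Y_sq[OF that]] by simp
  have lin: "(\<Sum>i\<in>I. tr1 (bal m) A (\<integral>\<omega>. Y i \<omega> ** Y i \<omega> \<partial>M)) = tr1 (bal m) A Y2" for m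
    unfolding Y2_def by (rule linear_sum[OF bounded_linear.linear[OF tr1_linear], symmetric])
  have "(\<Sum>i\<in>I. \<integral>\<omega>. tau p \<kappa> A (Y i \<omega>) \<partial>M)
      = (\<Sum>i\<in>I. (\<kappa> * tr1 (bal p) A (\<integral>\<omega>. Y i \<omega> ** Y i \<omega> \<partial>M)
          + tr1 (bal (p - 1)) A (\<integral>\<omega>. Y i \<omega> ** Y i \<omega> \<partial>M) / \<kappa>) / 2)"
    unfolding tau_def using T by (intro sum.cong refl) simp
  also have "\<dots> = (\<kappa> * tr1 (bal p) A Y2 + tr1 (bal (p - 1)) A Y2 / \<kappa>) / 2"
    by (simp add: lin[symmetric] sum_divide_distrib[symmetric] sum.distrib sum_distrib_left)
  also have "\<dots> \<le> (\<kappa> * (spectral_norm Y2 * tr0 (bal p) A) + (spectral_norm Y2 * tr0 (bal (p - 1)) A) / \<kappa>) / 2"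
    using \<kappa> by (intro divide_right_mono add_mono mult_left_mono tr1_bal_le) auto
  also have "\<dots> = spectral_norm Y2 * ((\<kappa> * tr0 (bal p) A + tr0 (bal (p - 1)) A / \<kappa>) / 2)"
    by (simp add: algebra_simps)
  finally show ?thesis .
qed

theorem non_gaussian_estimate:
  assumes r: "r \<in> {0..1}" and \<kappa>: "0 < \<kappa>"
  shows "\<bar>(\<integral>\<omega>. dF p (B + r *\<^sub>R S \<omega>) (S \<omega>) \<partial>M) - r * (\<integral>\<omega>. mean_d2F (B + r *\<^sub>R S \<omega>) \<partial>M)\<bar>
    \<le> r\<^sup>2 * (12 * words3 p * L / \<eta> ^ 4 * spectral_norm Y2) *
      (\<integral>\<omega>. (\<kappa> * tr0 (bal p) (B + r *\<^sub>R S \<omega>) + tr0 (bal (p - 1)) (B + r *\<^sub>R S \<omega>) / \<kappa>) / 2 \<partial>M)"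
proof -
  define c where "c = L * norm (mat 1 :: complex^'n^'n)"
  have Yc: "norm (Y i \<omega>) \<le> c" if "i \<in> I" "\<omega> \<in> space M" for i \<omega>
    using norm_Y_le[OF that] by (simp add: c_def)
  note [measurable] = Y_measurable
  let ?X = "\<lambda>\<omega>. B + r *\<^sub>R S \<omega>"
  have sp: "fst z \<in> space M" "snd z \<in> space M" if "z \<in> space (M \<Otimes>\<^sub>M M)" for z
    using that by (auto simp: space_pair_measure)
  have i1: "integrable M (\<lambda>\<omega>. dF p (?X \<omega>) (Y i \<omega>))" if [measurable]: "i \<in> I" for i
    by (rule integrable_dF[OF prob_space_axioms _ _ Yc[OF that]]) measurable
  have j2: "integrable (M \<Otimes>\<^sub>M M) (\<lambda>(\<omega>, \<omega>'). d2F p (?X \<omega>) (Y i \<omega>') (Y i \<omega>'))" if [measurable]: "i \<in> I" for i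
    unfolding case_prod_beta by (rule integrable_d2F[OF MM.P.prob_space_axioms _ _ Yc[OF that sp(2)]]) measurable
  have j3: "integrable (M \<Otimes>\<^sub>M M) (\<lambda>(\<omega>, \<omega>'). tau p \<kappa> (?X \<omega>) (Y i \<omega>'))" if [measurable]: "i \<in> I" for i
    unfolding case_prod_beta by (rule integrable_tau[OF MM.P.prob_space_axioms _ _ Yc[OF that sp(2)]]) measurable
  have 1: "(\<integral>\<omega>. dF p (?X \<omega>) (S \<omega>) \<partial>M) = (\<Sum>i\<in>I. \<integral>\<omega>. dF p (?X \<omega>) (Y i \<omega>) \<partial>M)"
  proof -
    have "dF p A (S \<omega>) = (\<Sum>i\<in>I. dF p A (Y i \<omega>))" for A \<omega>
      unfolding S_def by (rule linear_sum[OF bounded_linear.linear[OF dF_linear]])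
    then show ?thesis using i1 by simp
  qed
  have 2: "(\<integral>\<omega>. mean_d2F (?X \<omega>) \<partial>M)
      = (\<Sum>i\<in>I. \<integral>z. d2F p (?X (fst z)) (Y i (snd z)) (Y i (snd z)) \<partial>(M \<Otimes>\<^sub>M M))"
    unfolding mean_d2F_def
    using MM.integrable_fst[OF j2] MM.integral_fst[OF j2] by (simp add: case_prod_beta')
  have 3: "(\<Sum>i\<in>I. \<integral>z. tau p \<kappa> (?X (fst z)) (Y i (snd z)) \<partial>(M \<Otimes>\<^sub>M M))
      = (\<integral>\<omega>. (\<Sum>i\<in>I. \<integral>\<omega>'. tau p \<kappa> (?X \<omega>) (Y i \<omega>') \<partial>M) \<partial>M)"
    using MM.integrable_fst[OF j3] MM.integral_fst[OF j3] by (simp add: case_prod_beta')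
  have int0: "integrable M (\<lambda>\<omega>. tr0 a (?X \<omega>))" for a
  proof -
    obtain C where "\<forall>A :: complex^'n^'n. \<bar>tr0 a A\<bar> \<le> C" using abs_tr0_le by blast
    then show ?thesis by (intro integrable_const_bound[of _ C]) auto
  qed
  have "(\<integral>\<omega>. (\<Sum>i\<in>I. \<integral>\<omega>'. tau p \<kappa> (?X \<omega>) (Y i \<omega>') \<partial>M) \<partial>M)
      \<le> (\<integral>\<omega>. spectral_norm Y2 * ((\<kappa> * tr0 (bal p) (?X \<omega>) + tr0 (bal (p - 1)) (?X \<omega>) / \<kappa>) / 2) \<partial>M)"
    using int0 MM.integrable_fst[OF j3] by (intro integral_mono sum_tau_le \<kappa>) auto
  then have 4: "(\<Sum>i\<in>I. \<integral>z. tau p \<kappa> (?X (fst z)) (Y i (snd z)) \<partial>(M \<Otimes>\<^sub>M M))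
      \<le> spectral_norm Y2 * (\<integral>\<omega>. (\<kappa> * tr0 (bal p) (?X \<omega>) + tr0 (bal (p - 1)) (?X \<omega>) / \<kappa>) / 2 \<partial>M)"
    unfolding 3 by simp
  have L0: "0 \<le> L" if "I \<noteq> {}"
  proof -
    obtain \<omega>0 where "\<omega>0 \<in> space M" using not_empty by blast
    moreover obtain i where "i \<in> I" using \<open>I \<noteq> {}\<close> by blast
    ultimately show ?thesis using Y_le spectral_norm_nonneg order_trans by metis
  qed
  let ?K = "r\<^sup>2 * (words3 p * (L / \<eta> ^ 4))"
  have "\<bar>(\<integral>\<omega>. dF p (?X \<omega>) (S \<omega>) \<partial>M) - r * (\<integral>\<omega>. mean_d2F (?X \<omega>) \<partial>M)\<bar>
      \<le> (\<Sum>i\<in>I. ?K * (12 * (\<integral>z. tau p \<kappa> (?X (fst z)) (Y i (snd z)) \<partial>(M \<Otimes>\<^sub>M M))))"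
    unfolding 1 2 sum_distrib_left sum_subtractf[symmetric]
    by (intro order_trans[OF sum_abs] sum_mono summand_estimate r \<kappa>)
  also have "\<dots> = ?K * 12 * (\<Sum>i\<in>I. \<integral>z. tau p \<kappa> (?X (fst z)) (Y i (snd z)) \<partial>(M \<Otimes>\<^sub>M M))"
    by (simp add: sum_distrib_left mult.assoc)
  also have "\<dots> \<le> ?K * 12 * (spectral_norm Y2
      * (\<integral>\<omega>. (\<kappa> * tr0 (bal p) (?X \<omega>) + tr0 (bal (p - 1)) (?X \<omega>) / \<kappa>) / 2 \<partial>M))"
  \<comment> \<open>The sign of \<open>L\<close> is derived from an actual summand, so the empty
    family is settled by both sides being zero.\<close>
  proof (cases "I = {}")
    case True
    have s: "sum f I = 0" for f :: "'i \<Rightarrow> real" by (rule sum.neutral) (simp add: True)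
    have "Y2 = 0" unfolding Y2_def by (rule sum.neutral) (simp add: True)
    then have "spectral_norm Y2 = 0" by (simp add: spectral_norm_def onorm_zero)
    then show ?thesis by (simp only: s mult_zero_left)
  next
    case False
    then show ?thesis using 4 L0 \<eta>_pos by (intro mult_left_mono) (auto simp: words3_def)
  qed
  finally show ?thesis by (simp add: mult_ac)
qed

end

section \<open>Gaussian interpolation\<close>

text \<open>Weighted arithmetic-geometric mean inequality for integer exponents. It later plays the
  role of Jensen's inequality between the moments of orders 2p - 2 and 2p.\<close>

lemma Young_power:
  fixes x y :: real
  assumes "0 \<le> x" "0 \<le> y"
  shows "real (Suc n) * x ^ n * y \<le> real n * x ^ Suc n + y ^ Suc n"
proof (induction n)
  case (Suc n)
  have "0 \<le> (x ^ Suc n - y ^ Suc n) * (x - y)"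
  proof (cases "x \<le> y")
    case True
    then show ?thesis using assms power_mono[of x y "Suc n"] by (intro mult_nonpos_nonpos) auto
  next
    case False
    then show ?thesis using assms power_mono[of y x "Suc n"] by (intro mult_nonneg_nonneg) auto
  qed
  then have "x ^ Suc n * y + x * y ^ Suc n \<le> x ^ Suc (Suc n) + y ^ Suc (Suc n)"
    by (simp add: algebra_simps)
  moreover have "x * (real (Suc n) * x ^ n * y) \<le> x * (real n * x ^ Suc n + y ^ Suc n)"
    using Suc assms by (intro mult_left_mono)
  ultimately show ?case by (simp add: algebra_simps)
qed simp

section \<open>Standard Gaussian families and integration by parts\<close>

locale standard_gaussians = prob_space P for P :: "'b measure" +
  fixes \<xi> :: "'k \<Rightarrow> 'b \<Rightarrow> real" and K :: "'k set"
  assumes finite_K: "finite K" and \<xi>_indep: "indep_vars (\<lambda>_. borel) \<xi> K"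
    and \<xi>_distr: "\<And>k. k \<in> K \<Longrightarrow> distr P borel (\<xi> k) = std_normal_distribution"
begin

lemma \<xi>_measurable [measurable]: "k \<in> K \<Longrightarrow> \<xi> k \<in> borel_measurable P"
  using \<xi>_indep by (auto simp: indep_vars_def2)

lemma integral_\<xi>:
  fixes f :: "real \<Rightarrow> real"
  assumes k: "k \<in> K" and [measurable]: "f \<in> borel_measurable borel"
  shows "(\<integral>\<omega>. f (\<xi> k \<omega>) \<partial>P) = (\<integral>x. f x \<partial>std_normal_distribution)"
  unfolding \<xi>_distr[OF k, symmetric] using k by (subst integral_distr) auto

lemma integrable_\<xi>:
  assumes "k \<in> K"
  shows "integrable P (\<xi> k)"
proof -
  have "integrable (distr P borel (\<xi> k)) (\<lambda>x. x)"
    using integrable_std_normal_distribution_moment[of 1] by (simp add: \<xi>_distr[OF assms])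
  then show ?thesis using \<xi>_measurable[OF assms] by (subst (asm) integrable_distr_eq) auto
qed

definition G :: "('k \<Rightarrow> complex^'n^'n) \<Rightarrow> 'b \<Rightarrow> complex^'n^'n"
  where "G A \<omega> = (\<Sum>k\<in>K. \<xi> k \<omega> *\<^sub>R A k)"

lemma G_measurable [measurable]: "G A \<in> borel_measurable P"
  unfolding G_def[abs_def] by measurable

lemma integrable_G: "integrable P (G A)"
  unfolding G_def[abs_def] by (intro Bochner_Integration.integrable_sum integrable_scaleR_left integrable_\<xi>)

end

locale gaussian_words = resolvent_words \<zeta> + standard_gaussians P \<xi> K
  for \<zeta> and P :: "'b measure" and \<xi> :: "'k \<Rightarrow> 'b \<Rightarrow> real" and K
begin

text \<open>For each \<open>k\<close> the other terms form an independent background, and with it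
  frozen the one-dimensional Stein identity applies to the coordinate \<open>\<xi> k\<close>. The
  factor \<open>c\<close> is the inner derivative.\<close>

lemma gaussian_ibp:
  fixes A :: "'k \<Rightarrow> complex^'n^'n"
  assumes A: "\<And>k. k \<in> K \<Longrightarrow> self_adjoint (A k)"
  shows "(\<integral>\<omega>. dF p (B + c *\<^sub>R G A \<omega>) (G A \<omega>) \<partial>P)
    = c * (\<integral>\<omega>. (\<Sum>k\<in>K. d2F p (B + c *\<^sub>R G A \<omega>) (A k) (A k)) \<partial>P)"
proof -
  obtain C1 where C1: "\<And>A V :: complex^'n^'n. \<bar>dF p A V\<bar> \<le> C1 * norm V" using abs_dF_le[of p] by blast
  obtain C2 where C2: "\<And>A U V :: complex^'n^'n. \<bar>d2F p A U V\<bar> \<le> C2 * (norm U * norm V)" using abs_d2F_le[of p] by blast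
  have ib: "indep_vars (\<lambda>_. borel) (\<lambda>k \<omega>. \<xi> k \<omega> *\<^sub>R A k) K"
    by (rule indep_vars_compose2[OF \<xi>_indep]) simp
  have int1: "integrable P (\<lambda>\<omega>. dF p (B + c *\<^sub>R G A \<omega>) (\<xi> k \<omega> *\<^sub>R A k))" if k: "k \<in> K" for k
  proof (rule Bochner_Integration.integrable_bound)
    show "integrable P (\<lambda>\<omega>. C1 * norm (\<xi> k \<omega> *\<^sub>R A k))"
      using integrable_\<xi>[OF k] by (intro integrable_mult_right integrable_norm integrable_scaleR_left)
    show "(\<lambda>\<omega>. dF p (B + c *\<^sub>R G A \<omega>) (\<xi> k \<omega> *\<^sub>R A k)) \<in> borel_measurable P"
      using k by measurable
    show "AE \<omega> in P. norm (dF p (B + c *\<^sub>R G A \<omega>) (\<xi> k \<omega> *\<^sub>R A k)) \<le> norm (C1 * norm (\<xi> k \<omega> *\<^sub>R A k))"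
      unfolding real_norm_def by (intro AE_I2 order_trans[OF C1 abs_ge_self])
  qed
  have int2: "integrable P (\<lambda>\<omega>. d2F p (B + c *\<^sub>R G A \<omega>) (A k) (A k))" if k: "k \<in> K" for k
    by (rule integrable_const_bound[of _ "C2 * (norm (A k) * norm (A k))"]) (use C2 in auto)
  have main: "(\<integral>\<omega>. dF p (B + c *\<^sub>R G A \<omega>) (\<xi> k \<omega> *\<^sub>R A k) \<partial>P)
      = c * (\<integral>\<omega>. d2F p (B + c *\<^sub>R G A \<omega>) (A k) (A k) \<partial>P)" if k: "k \<in> K" for k
  proof -
    define U where "U \<omega> = (\<Sum>j\<in>K - {k}. \<xi> j \<omega> *\<^sub>R A j)" for \<omega>
    have GU: "G A \<omega> = U \<omega> + \<xi> k \<omega> *\<^sub>R A k" for \<omega>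
      unfolding G_def U_def using k finite_K by (simp add: sum.remove add.commute)
    have ind: "indep_var borel U borel (\<lambda>\<omega>. \<xi> k \<omega> *\<^sub>R A k)"
      using indep_var_sum_other[OF ib k finite_K] by (simp add: U_def[abs_def])
    have stein: "(\<integral>\<omega>. dF p (D + c *\<^sub>R (\<xi> k \<omega> *\<^sub>R A k)) (\<xi> k \<omega> *\<^sub>R A k) \<partial>P)
        = c * (\<integral>\<omega>. d2F p (D + c *\<^sub>R (\<xi> k \<omega> *\<^sub>R A k)) (A k) (A k) \<partial>P)" for D
    proof -
      define g where "g x = dF p (D + c *\<^sub>R (x *\<^sub>R A k)) (A k)" for x
      define g' where "g' x = c * d2F p (D + c *\<^sub>R (x *\<^sub>R A k)) (A k) (A k)" for x
      have der: "(g has_real_derivative g' x) (at x)" for x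
      proof -
        have X: "((\<lambda>x. D + c *\<^sub>R (x *\<^sub>R A k)) has_vector_derivative c *\<^sub>R A k) (at x)"
          by (auto intro!: derivative_eq_intros)
        have sa: "self_adjoint (c *\<^sub>R A k)"
          using A[OF k] by (simp add: self_adjoint_def conj_transpose_simps)
        have "d2F p (D + c *\<^sub>R (x *\<^sub>R A k)) (c *\<^sub>R A k) (A k) = g' x"
          unfolding g'_def d2F_def sum_distrib_left
          by (intro sum.cong refl) (simp add: tr2_def matrix_mult_scaleR trace_simps)
        then show ?thesis using has_derivative_dF[OF X sa, of p "A k"] by (simp add: g_def[abs_def])
      qed
      have cg': "continuous_on UNIV g'"
        unfolding g'_def by (intro continuous_intros continuous_d2F)
      have cg: "continuous_on UNIV g"
        unfolding g_def by (intro continuous_intros continuous_dF)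
      define C where "C = max (C1 * norm (A k)) (\<bar>c\<bar> * (C2 * (norm (A k) * norm (A k))))"
      have gC: "\<bar>g x\<bar> \<le> C" for x
        unfolding g_def C_def by (rule max.coboundedI1[OF C1])
      have g'C: "\<bar>g' x\<bar> \<le> C" for x
        unfolding g'_def C_def abs_mult by (rule max.coboundedI2[OF mult_left_mono[OF C2 abs_ge_zero]])
      have lin: "dF p D' (x *\<^sub>R A k) = x * dF p D' (A k)" for D' x
        using linear_scale[OF bounded_linear.linear[OF dF_linear[of p D']]] by simp
      have "(\<integral>\<omega>. dF p (D + c *\<^sub>R (\<xi> k \<omega> *\<^sub>R A k)) (\<xi> k \<omega> *\<^sub>R A k) \<partial>P) = (\<integral>\<omega>. \<xi> k \<omega> * g (\<xi> k \<omega>) \<partial>P)"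
        by (simp only: lin g_def)
      also have "\<dots> = (\<integral>x. x * g x \<partial>std_normal_distribution)"
        using borel_measurable_continuous_onI[OF cg] by (intro integral_\<xi>[OF k]) auto
      also have "\<dots> = (\<integral>x. g' x \<partial>std_normal_distribution)"
        by (rule std_normal_stein[OF der cg' gC g'C])
      also have "\<dots> = (\<integral>\<omega>. g' (\<xi> k \<omega>) \<partial>P)"
        using borel_measurable_continuous_onI[OF cg'] by (intro integral_\<xi>[OF k, symmetric]) auto
      also have "\<dots> = c * (\<integral>\<omega>. d2F p (D + c *\<^sub>R (\<xi> k \<omega> *\<^sub>R A k)) (A k) (A k) \<partial>P)"
        by (simp only: g'_def integral_mult_right_zero)
      finally show ?thesis .
    qed
    have BG: "B + c *\<^sub>R G A \<omega> = (B + c *\<^sub>R U \<omega>) + c *\<^sub>R (\<xi> k \<omega> *\<^sub>R A k)" for \<omega>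
      by (simp add: GU scaleR_add_right)
    have "(\<integral>\<omega>. dF p (B + c *\<^sub>R G A \<omega>) (\<xi> k \<omega> *\<^sub>R A k) \<partial>P)
        = (\<integral>\<omega>. \<integral>\<omega>'. dF p ((B + c *\<^sub>R U \<omega>) + c *\<^sub>R (\<xi> k \<omega>' *\<^sub>R A k)) (\<xi> k \<omega>' *\<^sub>R A k) \<partial>P \<partial>P)"
      unfolding BG
      using indep_var_integral_decouple(1)[OF ind, of "\<lambda>x. dF p ((B + c *\<^sub>R fst x) + c *\<^sub>R snd x) (snd x)"]
        int1[OF k, unfolded BG] by simp
    also have "\<dots> = (\<integral>\<omega>. c * (\<integral>\<omega>'. d2F p ((B + c *\<^sub>R U \<omega>) + c *\<^sub>R (\<xi> k \<omega>' *\<^sub>R A k)) (A k) (A k) \<partial>P) \<partial>P)"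
      unfolding stein ..
    also have "\<dots> = c * (\<integral>\<omega>. d2F p (B + c *\<^sub>R G A \<omega>) (A k) (A k) \<partial>P)"
      unfolding BG
      using indep_var_integral_decouple(1)[OF ind, of "\<lambda>x. d2F p ((B + c *\<^sub>R fst x) + c *\<^sub>R snd x) (A k) (A k)"]
        int2[OF k, unfolded BG] by simp
    finally show ?thesis .
  qed
  have "dF p D (G A \<omega>) = (\<Sum>k\<in>K. dF p D (\<xi> k \<omega> *\<^sub>R A k))" for D \<omega>
    unfolding G_def by (rule linear_sum[OF bounded_linear.linear[OF dF_linear]])
  then show ?thesis using int1 int2 main by (simp add: sum_distrib_left)
qed

end

context bounded_summands
begin

lemma integrable_Y_component:
  assumes i: "i \<in> I"
  shows "integrable M (\<lambda>\<omega>. Y i \<omega> $ a $ b * Y i \<omega> $ c $ d)"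
proof (rule integrable_component_mult[OF Y_measurable[OF i]], rule integrable_const_bound)
  show "AE \<omega> in M. norm ((norm (Y i \<omega>))\<^sup>2) \<le> (L * norm (mat 1 :: complex^'n^'n))\<^sup>2"
    using norm_Y_le[OF i] by (intro AE_I2) (simp add: power_mono)
qed (use Y_measurable[OF i] in measurable)

end

section \<open>The interpolation path and its derivative\<close>

locale gaussian_interpolation = bounded_summands \<zeta> M Y I L p + gauss: gaussian_words \<zeta> P \<xi> K
  for \<zeta> and M :: "'a measure" and Y :: "'i \<Rightarrow> 'a \<Rightarrow> complex^'n^'n" and I L p
    and P :: "'b measure" and \<xi> :: "'k \<Rightarrow> 'b \<Rightarrow> real" and K +
  fixes A :: "'k \<Rightarrow> complex^'n^'n" and A0 :: "complex^'n^'n"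
  assumes A_self_adjoint: "\<And>k. k \<in> K \<Longrightarrow> self_adjoint (A k)"
    and covariance: "\<And>a b c d. (\<Sum>k\<in>K. A k $ a $ b * A k $ c $ d)
      = (\<Sum>i\<in>I. \<integral>\<omega>. Y i \<omega> $ a $ b * Y i \<omega> $ c $ d \<partial>M)"
begin

sublocale MP: pair_prob_space M P ..

text \<open>A second derivative evaluated at equal directions is a linear functional of the products
  of pairs of entries, so it sees the directions only through the second moments that
  \<open>covariance\<close> equates.\<close>

lemma sum_d2F_eq_mean_d2F: "(\<Sum>k\<in>K. d2F p B (A k) (A k)) = mean_d2F B"
proof -
  \<comment> \<open>The linear functional in question; the order y, z, w, x follows the indices
    around the cyclic product of word \<open>a\<close>, direction, word \<open>b\<close>,
    direction.\<close>
  define q where "q a b f = Re (\<Sum>x\<in>UNIV. \<Sum>w\<in>UNIV. \<Sum>z\<in>UNIV. \<Sum>y\<in>UNIV.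
      (word a B $ x $ y * word b B $ z $ w) * f (y, z, w, x))" for a b and f :: "'n \<times> 'n \<times> 'n \<times> 'n \<Rightarrow> complex"
  have tr2: "tr2 a b B V V = q a b (\<lambda>(y, z, w, x). V $ y $ z * V $ w $ x)" for a b V
    unfolding tr2_def q_def
    by (rule arg_cong[where f = Re]) (simp add: trace_def matrix_mult_component sum_distrib_right, simp add: mult_ac)
  have q_sum: "q a b (\<lambda>x. \<Sum>j\<in>J. f j x) = (\<Sum>j\<in>J. q a b (f j))" if "finite J" for a b f and J :: "'j set"
    using that by (induction J rule: finite_induct) (simp_all add: q_def distrib_left sum.distrib)
  have q_int: "integrable M (\<lambda>\<omega>. q a b (f \<omega>)) \<and> (\<integral>\<omega>. q a b (f \<omega>) \<partial>M) = q a b (\<lambda>x. \<integral>\<omega>. f \<omega> x \<partial>M)"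
    if f: "\<And>x. integrable M (\<lambda>\<omega>. f \<omega> x)" for a b f
    unfolding q_def using f by (simp add: integrable_Re)
  have int: "integrable M (\<lambda>\<omega>. tr2 a b B (Y i \<omega>) (Y i \<omega>))"
    and mean: "(\<integral>\<omega>. tr2 a b B (Y i \<omega>) (Y i \<omega>) \<partial>M)
      = q a b (\<lambda>(y, z, w, x). \<integral>\<omega>. Y i \<omega> $ y $ z * Y i \<omega> $ w $ x \<partial>M)" if "i \<in> I" for a b i
    using q_int[of "\<lambda>\<omega> (y, z, w, x). Y i \<omega> $ y $ z * Y i \<omega> $ w $ x" a b] integrable_Y_component[OF that]
    unfolding tr2 by (auto simp: case_prod_beta')
  have tr2_eq: "(\<Sum>k\<in>K. tr2 a b B (A k) (A k)) = (\<Sum>i\<in>I. \<integral>\<omega>. tr2 a b B (Y i \<omega>) (Y i \<omega>) \<partial>M)" for a b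
  proof -
    have "(\<Sum>k\<in>K. tr2 a b B (A k) (A k)) = q a b (\<lambda>(y, z, w, x). \<Sum>k\<in>K. A k $ y $ z * A k $ w $ x)"
      unfolding tr2 q_sum[OF gauss.finite_K, symmetric] by (simp add: case_prod_beta')
    also have "\<dots> = q a b (\<lambda>(y, z, w, x). \<Sum>i\<in>I. \<integral>\<omega>. Y i \<omega> $ y $ z * Y i \<omega> $ w $ x \<partial>M)"
      by (simp only: covariance)
    also have "\<dots> = (\<Sum>i\<in>I. \<integral>\<omega>. tr2 a b B (Y i \<omega>) (Y i \<omega>) \<partial>M)"
      using mean q_sum[OF finite_I, of a b "\<lambda>i (y, z, w, x). \<integral>\<omega>. Y i \<omega> $ y $ z * Y i \<omega> $ w $ x \<partial>M"]
      by (simp add: case_prod_beta')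
    finally show ?thesis .
  qed
  have "(\<Sum>k\<in>K. d2F p B (A k) (A k))
      = (\<Sum>l<2 * p. \<Sum>j<2 * p + 1. \<Sum>k\<in>K. tr2 (take (Suc j) (rot p l)) (drop j (rot p l)) B (A k) (A k))"
    unfolding d2F_def by (subst sum.swap) (intro sum.cong refl sum.swap)
  also have "\<dots> = (\<Sum>l<2 * p. \<Sum>j<2 * p + 1. \<Sum>i\<in>I.
      \<integral>\<omega>. tr2 (take (Suc j) (rot p l)) (drop j (rot p l)) B (Y i \<omega>) (Y i \<omega>) \<partial>M)"
    unfolding tr2_eq ..
  also have "\<dots> = (\<Sum>i\<in>I. \<Sum>l<2 * p. \<Sum>j<2 * p + 1.
      \<integral>\<omega>. tr2 (take (Suc j) (rot p l)) (drop j (rot p l)) B (Y i \<omega>) (Y i \<omega>) \<partial>M)"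
    by (subst sum.swap[of _ I]) (intro sum.cong refl sum.swap)
  also have "\<dots> = mean_d2F B"
    unfolding mean_d2F_def d2F_def using int by (intro sum.cong refl) simp
  finally show ?thesis .
qed

text \<open>The squares of sine and cosine add up to 1, so mean and covariance are constant in time,
  and the velocity has no singularity at either end. Time 0 is Gaussian, time pi/2 is the
  sum.\<close>

definition path :: "real \<Rightarrow> 'a \<times> 'b \<Rightarrow> complex^'n^'n"
  where "path t z = A0 + sin t *\<^sub>R S (fst z) + cos t *\<^sub>R gauss.G A (snd z)"

definition \<Phi> :: "real \<Rightarrow> real"
  where "\<Phi> t = (\<integral>z. tr0 (bal p) (path t z) \<partial>(M \<Otimes>\<^sub>M P))"

lemma path_measurable [measurable]: "path t \<in> borel_measurable (M \<Otimes>\<^sub>M P)"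
  unfolding path_def[abs_def] by measurable

lemma self_adjoint_S: "\<omega> \<in> space M \<Longrightarrow> self_adjoint (S \<omega>)"
  using Y_self_adjoint unfolding self_adjoint_def S_def
  by (simp add: linear_sum[OF bounded_linear.linear[OF bounded_linear_conj_transpose]])

lemma self_adjoint_G: "self_adjoint (gauss.G A \<omega>)"
  using A_self_adjoint unfolding self_adjoint_def gauss.G_def
  by (simp add: linear_sum[OF bounded_linear.linear[OF bounded_linear_conj_transpose]] conj_transpose_simps)

lemma integrable_S: "integrable M S"
  unfolding S_def[abs_def] by (intro Bochner_Integration.integrable_sum integrable_Y)

lemma integrable_dominator: "integrable (M \<Otimes>\<^sub>M P) (\<lambda>z. norm (S (fst z)) + norm (gauss.G A (snd z)))"
  using integrable_S gauss.integrable_G[of A]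
  by (intro MP.Fubini_integrable) (simp_all add: gauss.prob_space abs_of_nonneg)

lemma integrable_tr0: "integrable (M \<Otimes>\<^sub>M P) (\<lambda>z. tr0 a (path t z))"
proof -
  obtain C where "\<forall>A :: complex^'n^'n. \<bar>tr0 a A\<bar> \<le> C" using abs_tr0_le by blast
  then show ?thesis by (intro MP.P.integrable_const_bound[of _ C]) auto
qed

lemma integrable_dF_path: "integrable (M \<Otimes>\<^sub>M P) (\<lambda>z. dF p (path t z) (S (fst z)))"
  "integrable (M \<Otimes>\<^sub>M P) (\<lambda>z. dF p (path t z) (gauss.G A (snd z)))"
proof -
  obtain C1 where C1: "\<And>A V :: complex^'n^'n. \<bar>dF p A V\<bar> \<le> C1 * norm V" using abs_dF_le[of p] by blast
  have *: "\<bar>dF p B V\<bar> \<le> \<bar>C1\<bar> * (a + b)" if "norm V \<le> a + b" for B V :: "complex^'n^'n" and a b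
    using that by (intro order_trans[OF C1] mult_mono) auto
  have i: "integrable (M \<Otimes>\<^sub>M P) (\<lambda>z. \<bar>C1\<bar> * (norm (S (fst z)) + norm (gauss.G A (snd z))))"
    by (intro integrable_mult_right integrable_dominator)
  show "integrable (M \<Otimes>\<^sub>M P) (\<lambda>z. dF p (path t z) (S (fst z)))"
    by (rule Bochner_Integration.integrable_bound[OF i]) (auto intro!: AE_I2 order_trans[OF *])
  show "integrable (M \<Otimes>\<^sub>M P) (\<lambda>z. dF p (path t z) (gauss.G A (snd z)))"
    by (rule Bochner_Integration.integrable_bound[OF i]) (auto intro!: AE_I2 order_trans[OF *])
qed

lemma has_derivative_\<Phi>:
  "(\<Phi> has_real_derivative (cos t * (\<integral>z. dF p (path t z) (S (fst z)) \<partial>(M \<Otimes>\<^sub>M P))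
    - sin t * (\<integral>z. dF p (path t z) (gauss.G A (snd z)) \<partial>(M \<Otimes>\<^sub>M P)))) (at t)"
proof -
  obtain C1 where C1: "\<And>A V :: complex^'n^'n. \<bar>dF p A V\<bar> \<le> C1 * norm V" using abs_dF_le[of p] by blast
  let ?X' = "\<lambda>t z. cos t *\<^sub>R S (fst z) - sin t *\<^sub>R gauss.G A (snd z)"
  have sp: "fst z \<in> space M" if "z \<in> space (M \<Otimes>\<^sub>M P)" for z
    using that by (auto simp: space_pair_measure)
  have "(\<Phi> has_real_derivative (\<integral>z. dF p (path t z) (?X' t z) \<partial>(M \<Otimes>\<^sub>M P))) (at t)"
    unfolding \<Phi>_def[abs_def]
  proof (rule has_real_derivative_integral)
    fix t z assume z: "z \<in> space (M \<Otimes>\<^sub>M P)"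
    have "((\<lambda>t. path t z) has_vector_derivative ?X' t z) (at t)"
      unfolding path_def by (auto intro!: derivative_eq_intros)
    moreover have "self_adjoint (?X' t z)"
      using self_adjoint_S[OF sp[OF z]] self_adjoint_G[of "snd z"]
      by (simp add: self_adjoint_def conj_transpose_simps)
    ultimately show "((\<lambda>t. tr0 (bal p) (path t z)) has_real_derivative dF p (path t z) (?X' t z)) (at t)"
      by (rule has_derivative_tr0_bal)
    have "norm (?X' t z) \<le> \<bar>cos t\<bar> * norm (S (fst z)) + \<bar>sin t\<bar> * norm (gauss.G A (snd z))"
      using norm_triangle_ineq4[of "cos t *\<^sub>R S (fst z)" "sin t *\<^sub>R gauss.G A (snd z)"] by simp
    also have "\<dots> \<le> 1 * norm (S (fst z)) + 1 * norm (gauss.G A (snd z))"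
      by (intro add_mono mult_right_mono) auto
    finally show "\<bar>dF p (path t z) (?X' t z)\<bar> \<le> \<bar>C1\<bar> * (norm (S (fst z)) + norm (gauss.G A (snd z)))"
      by (intro order_trans[OF C1] mult_mono) auto
  next
    show "integrable (M \<Otimes>\<^sub>M P) (\<lambda>z. \<bar>C1\<bar> * (norm (S (fst z)) + norm (gauss.G A (snd z))))"
      by (intro integrable_mult_right integrable_dominator)
  qed (auto intro: integrable_tr0)
  moreover have "dF p B (cos t *\<^sub>R V - sin t *\<^sub>R W) = cos t * dF p B V - sin t * dF p B W" for B V W :: "complex^'n^'n"
    by (simp add: linear_simps[OF dF_linear])
  ultimately show ?thesis using integrable_dF_path by simp
qed

text \<open>Integration by parts turns the Gaussian part into sin t cos t times the mean of
  \<open>mean_d2F\<close>, exactly the term subtracted in \<open>non_gaussian_estimate\<close> with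
  r = sin t. Only its error survives, multiplied by cos t.\<close>

lemma derivative_\<Phi>_le:
  assumes t: "t \<in> {0..pi / 2}" and \<kappa>: "0 < \<kappa>"
  shows "\<bar>cos t * (\<integral>z. dF p (path t z) (S (fst z)) \<partial>(M \<Otimes>\<^sub>M P))
      - sin t * (\<integral>z. dF p (path t z) (gauss.G A (snd z)) \<partial>(M \<Otimes>\<^sub>M P))\<bar>
    \<le> cos t * (sin t)\<^sup>2 * (12 * words3 p * L / \<eta> ^ 4 * spectral_norm Y2)
      * (\<integral>z. (\<kappa> * tr0 (bal p) (path t z) + tr0 (bal (p - 1)) (path t z) / \<kappa>) / 2 \<partial>(M \<Otimes>\<^sub>M P))"
proof -
  let ?K = "(sin t)\<^sup>2 * (12 * words3 p * L / \<eta> ^ 4 * spectral_norm Y2)"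
  have sc: "0 \<le> cos t" "sin t \<in> {0..1}"
    using t by (auto intro: cos_ge_zero sin_ge_zero)
  obtain C2 where C2: "\<And>A U V :: complex^'n^'n. \<bar>d2F p A U V\<bar> \<le> C2 * (norm U * norm V)" using abs_d2F_le[of p] by blast
  have mean_le: "\<bar>mean_d2F B\<bar> \<le> (\<Sum>k\<in>K. C2 * (norm (A k) * norm (A k)))" for B
    unfolding sum_d2F_eq_mean_d2F[symmetric] by (intro order_trans[OF sum_abs] sum_mono C2)
  have mean_measurable: "(\<lambda>z. mean_d2F (path t z)) \<in> borel_measurable (M \<Otimes>\<^sub>M P)"
    unfolding sum_d2F_eq_mean_d2F[symmetric] by measurable
  have int_mean: "integrable (M \<Otimes>\<^sub>M P) (\<lambda>z. mean_d2F (path t z))"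
    using mean_le mean_measurable by (intro MP.P.integrable_const_bound[of _ "\<Sum>k\<in>K. C2 * (norm (A k) * norm (A k))"]) auto
  have ibp: "(\<integral>z. dF p (path t z) (gauss.G A (snd z)) \<partial>(M \<Otimes>\<^sub>M P)) = cos t * (\<integral>z. mean_d2F (path t z) \<partial>(M \<Otimes>\<^sub>M P))"
  proof -
    have "(\<integral>z. dF p (path t z) (gauss.G A (snd z)) \<partial>(M \<Otimes>\<^sub>M P)) = (\<integral>\<omega>. \<integral>\<omega>'. dF p (path t (\<omega>, \<omega>')) (gauss.G A \<omega>') \<partial>P \<partial>M)"
      using MP.integral_fst'[OF integrable_dF_path(2)[of t]] by simp
    also have "\<dots> = (\<integral>\<omega>. cos t * (\<integral>\<omega>'. mean_d2F (path t (\<omega>, \<omega>')) \<partial>P) \<partial>M)"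
    proof -
      have "(\<integral>\<omega>'. dF p (path t (\<omega>, \<omega>')) (gauss.G A \<omega>') \<partial>P) = cos t * (\<integral>\<omega>'. mean_d2F (path t (\<omega>, \<omega>')) \<partial>P)" for \<omega>
        using gauss.gaussian_ibp[of A p "A0 + sin t *\<^sub>R S \<omega>" "cos t"] A_self_adjoint
        by (simp add: path_def sum_d2F_eq_mean_d2F)
      then show ?thesis by simp
    qed
    also have "\<dots> = cos t * (\<integral>z. mean_d2F (path t z) \<partial>(M \<Otimes>\<^sub>M P))"
      using MP.integral_fst'[OF int_mean] by simp
    finally show ?thesis .
  qed
  let ?d = "\<lambda>z. dF p (path t z) (S (fst z)) - sin t * mean_d2F (path t z)"
  let ?e = "\<lambda>z. (\<kappa> * tr0 (bal p) (path t z) + tr0 (bal (p - 1)) (path t z) / \<kappa>) / 2"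
  have int_d: "integrable (M \<Otimes>\<^sub>M P) ?d"
    using integrable_dF_path(1) int_mean by (intro Bochner_Integration.integrable_diff integrable_mult_right)
  have int_e: "integrable (M \<Otimes>\<^sub>M P) ?e"
    using integrable_tr0 by (intro integrable_divide_zero Bochner_Integration.integrable_add integrable_mult_right)
  \<comment> \<open>The Gaussian coordinate is integrated last: once it is frozen, the Gaussian part
    of the path belongs to the constant matrix in the estimate for the summands.\<close>
  have snd_d: "(\<integral>z. ?d z \<partial>(M \<Otimes>\<^sub>M P)) = (\<integral>\<omega>'. \<integral>\<omega>. ?d (\<omega>, \<omega>') \<partial>M \<partial>P)"
    using MP.integral_snd[of "\<lambda>x y. ?d (x, y)"] int_d by (simp add: case_prod_beta')
  have snd_e: "(\<integral>z. ?e z \<partial>(M \<Otimes>\<^sub>M P)) = (\<integral>\<omega>'. \<integral>\<omega>. ?e (\<omega>, \<omega>') \<partial>M \<partial>P)"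
    using MP.integral_snd[of "\<lambda>x y. ?e (x, y)"] int_e by (simp add: case_prod_beta')
  have "\<bar>\<integral>z. ?d z \<partial>(M \<Otimes>\<^sub>M P)\<bar> \<le> (\<integral>\<omega>'. ?K * (\<integral>\<omega>. ?e (\<omega>, \<omega>') \<partial>M) \<partial>P)"
    unfolding snd_d
  proof (rule order_trans[OF integral_abs_bound], rule integral_mono)
    show "integrable P (\<lambda>\<omega>'. \<bar>\<integral>\<omega>. ?d (\<omega>, \<omega>') \<partial>M\<bar>)"
      using MP.integrable_snd[of "\<lambda>x y. ?d (x, y)"] int_d by (intro integrable_abs) (simp add: case_prod_beta')
    show "integrable P (\<lambda>\<omega>'. ?K * (\<integral>\<omega>. ?e (\<omega>, \<omega>') \<partial>M))"
      using MP.integrable_snd[of "\<lambda>x y. ?e (x, y)"] int_e by (intro integrable_mult_right) (simp add: case_prod_beta')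
    fix \<omega>'
    let ?B = "A0 + cos t *\<^sub>R gauss.G A \<omega>'"
    have X: "path t (\<omega>, \<omega>') = ?B + sin t *\<^sub>R S \<omega>" for \<omega> by (simp add: path_def add_ac)
    have "integrable M (\<lambda>\<omega>. dF p (?B + sin t *\<^sub>R S \<omega>) (S \<omega>))"
    proof -
      obtain C1 where C1: "\<And>A V :: complex^'n^'n. \<bar>dF p A V\<bar> \<le> C1 * norm V" using abs_dF_le[of p] by blast
      show ?thesis
        by (rule Bochner_Integration.integrable_bound[of _ "\<lambda>\<omega>. C1 * norm (S \<omega>)"])
           (auto intro!: AE_I2 order_trans[OF C1 abs_ge_self] integrable_mult_right integrable_norm integrable_S)
    qed
    moreover have "integrable M (\<lambda>\<omega>. mean_d2F (?B + sin t *\<^sub>R S \<omega>))"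
    proof (rule integrable_const_bound)
      show "(\<lambda>\<omega>. mean_d2F (?B + sin t *\<^sub>R S \<omega>)) \<in> borel_measurable M"
        unfolding sum_d2F_eq_mean_d2F[symmetric] by measurable
    qed (use mean_le in auto)
    ultimately show "\<bar>\<integral>\<omega>. ?d (\<omega>, \<omega>') \<partial>M\<bar> \<le> ?K * (\<integral>\<omega>. ?e (\<omega>, \<omega>') \<partial>M)"
      using non_gaussian_estimate[OF sc(2) \<kappa>, of ?B] by (simp add: X)
  qed
  then have "cos t * \<bar>\<integral>z. ?d z \<partial>(M \<Otimes>\<^sub>M P)\<bar> \<le> cos t * (?K * (\<integral>z. ?e z \<partial>(M \<Otimes>\<^sub>M P)))"
    unfolding snd_e using sc by (intro mult_left_mono) auto
  moreover have "cos t * (\<integral>z. dF p (path t z) (S (fst z)) \<partial>(M \<Otimes>\<^sub>M P))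
      - sin t * (\<integral>z. dF p (path t z) (gauss.G A (snd z)) \<partial>(M \<Otimes>\<^sub>M P)) = cos t * (\<integral>z. ?d z \<partial>(M \<Otimes>\<^sub>M P))"
    using integrable_dF_path(1) int_mean by (simp add: ibp algebra_simps)
  ultimately show ?thesis using sc(1) by (simp only: abs_mult abs_of_nonneg mult.assoc)
qed

section \<open>From trace moments to norms\<close>

lemma \<Phi>_pos: "0 < \<Phi> t"
proof -
  have pos: "0 < tr0 (bal p) B" for B :: "complex^'n^'n"
  proof -
    obtain d :: "'n \<Rightarrow> real" where "\<forall>i. 0 < d i \<and> d i \<le> 1 / \<eta>" "\<forall>m. tr0 (bal m) B = (\<Sum>i\<in>UNIV. d i ^ (2 * m))"
      using tr0_bal_eq_sum[where M = B] .
    then show ?thesis by (simp add: sum_pos)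
  qed
  have "0 \<le> \<Phi> t" unfolding \<Phi>_def using pos by (intro integral_nonneg_AE AE_I2) (auto intro: less_imp_le)
  moreover have "\<Phi> t \<noteq> 0"
  proof
    assume "\<Phi> t = 0"
    then have "AE z in M \<Otimes>\<^sub>M P. tr0 (bal p) (path t z) = 0"
      using integral_nonneg_eq_0_iff_AE[OF integrable_tr0[of "bal p" t]] pos by (simp add: \<Phi>_def less_imp_le)
    then have "AE z in M \<Otimes>\<^sub>M P. False" using pos by (auto elim!: eventually_mono simp: less_imp_neq[symmetric])
    then show False by simp
  qed
  ultimately show ?thesis by simp
qed

text \<open>The norm of index 2p of the resolvent along the path, with the dimension supplying the
  normalized trace.\<close>

definition \<psi> :: "real \<Rightarrow> real"
  where "\<psi> t = (\<Phi> t / CARD('n)) powr (1 / (2 * p))"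

text \<open>With weight 1/\<psi> the first term is exactly d \<psi>^(2p-1), d the dimension. The
  second is at most as large because the mean trace of order 2p - 2 is bounded by d
  \<psi>^(2p-2).\<close>

lemma interpolation_integrand_le:
  "(\<integral>z. (1 / \<psi> t * tr0 (bal p) (path t z) + tr0 (bal (p - 1)) (path t z) / (1 / \<psi> t)) / 2 \<partial>(M \<Otimes>\<^sub>M P))
    \<le> CARD('n) * \<psi> t ^ (2 * p - 1)"
proof -
  define \<mu> where "\<mu> = \<psi> t"
  obtain r where r: "p = Suc r" using p_pos by (cases p) auto
  have p1: "real p = real r + 1" "2 * p - 1 = 2 * r + 1" and p2: "x ^ (2 * p) = x ^ (2 * r) * x\<^sup>2" for x :: real
    by (simp_all add: r power2_eq_square mult_ac)
  have \<mu>: "0 < \<mu>" using \<Phi>_pos[of t] by (simp add: \<mu>_def \<psi>_def)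
  have "\<mu> ^ (2 * p) = \<Phi> t / CARD('n)"
    using \<Phi>_pos[of t] p_pos by (simp add: \<mu>_def \<psi>_def powr_realpow[symmetric] powr_powr)
  then have \<Phi>: "\<Phi> t = CARD('n) * \<mu> ^ (2 * p)" by simp
  have pw: "tr0 (bal (p - 1)) B * (p * \<mu>\<^sup>2) \<le> r * tr0 (bal p) B + CARD('n) * \<mu> ^ (2 * p)" for B :: "complex^'n^'n"
  proof -
    obtain d :: "'n \<Rightarrow> real" where d: "\<forall>i. 0 < d i \<and> d i \<le> 1 / \<eta>" "\<forall>m. tr0 (bal m) B = (\<Sum>i\<in>UNIV. d i ^ (2 * m))"
      using tr0_bal_eq_sum[where M = B] .
    \<comment> \<open>Young's inequality with n = p - 1 for the squares of \<open>d i\<close> and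
      \<open>\<mu>\<close>; after integration the two terms on the right combine to p d \<mu>^(2p),
      d the dimension.\<close>
    have "d i ^ (2 * (p - 1)) * (p * \<mu>\<^sup>2) \<le> r * d i ^ (2 * p) + \<mu> ^ (2 * p)" for i
      using Young_power[of "(d i)\<^sup>2" "\<mu>\<^sup>2" r, unfolded power_mult[symmetric]]
      by (simp only: r diff_Suc_1 zero_le_power2 mult_ac simp_thms)
    then have "(\<Sum>i\<in>UNIV. d i ^ (2 * (p - 1)) * (p * \<mu>\<^sup>2)) \<le> (\<Sum>i\<in>(UNIV :: 'n set). r * d i ^ (2 * p) + \<mu> ^ (2 * p))"
      by (intro sum_mono)
    then show ?thesis by (simp add: d(2) sum.distrib sum_distrib_left sum_distrib_right)
  qed
  have "(\<integral>z. tr0 (bal (p - 1)) (path t z) * (p * \<mu>\<^sup>2) \<partial>(M \<Otimes>\<^sub>M P))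
      \<le> (\<integral>z. r * tr0 (bal p) (path t z) + CARD('n) * \<mu> ^ (2 * p) \<partial>(M \<Otimes>\<^sub>M P))"
    using pw integrable_tr0
    by (intro integral_mono integrable_mult_left Bochner_Integration.integrable_add integrable_mult_right) auto
  also have "\<dots> = r * \<Phi> t + CARD('n) * \<mu> ^ (2 * p)"
    using integrable_tr0 by (simp add: \<Phi>_def MP.P.prob_space)
  also have "\<dots> = p * (CARD('n) * \<mu> ^ (2 * p))" by (simp add: \<Phi> p1 algebra_simps)
  finally have "(\<integral>z. tr0 (bal (p - 1)) (path t z) \<partial>(M \<Otimes>\<^sub>M P)) * (p * \<mu>\<^sup>2) \<le> (CARD('n) * \<mu> ^ (2 * r)) * (p * \<mu>\<^sup>2)"
    unfolding p2 by (simp add: mult_ac)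
  then have le: "(\<integral>z. tr0 (bal (p - 1)) (path t z) \<partial>(M \<Otimes>\<^sub>M P)) \<le> CARD('n) * \<mu> ^ (2 * r)"
    using p_pos \<mu> by (subst (asm) mult_le_cancel_right) auto
  have "(\<integral>z. (1 / \<mu> * tr0 (bal p) (path t z) + tr0 (bal (p - 1)) (path t z) / (1 / \<mu>)) / 2 \<partial>(M \<Otimes>\<^sub>M P))
      = (1 / \<mu> * \<Phi> t + \<mu> * (\<integral>z. tr0 (bal (p - 1)) (path t z) \<partial>(M \<Otimes>\<^sub>M P))) / 2"
    using integrable_tr0 \<mu> by (simp add: \<Phi>_def mult.commute)
  also have "\<dots> \<le> (1 / \<mu> * \<Phi> t + \<mu> * (CARD('n) * \<mu> ^ (2 * r))) / 2"
    using le \<mu> by (intro divide_right_mono add_left_mono mult_left_mono) auto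
  also have "\<dots> = CARD('n) * \<mu> ^ (2 * p - 1)"
    using \<mu> unfolding \<Phi> p2 p1 by (simp add: power2_eq_square)
  finally show ?thesis by (simp add: \<mu>_def)
qed

lemma L_Y2_nonneg: "0 \<le> L * spectral_norm Y2"
proof (cases "I = {}")
  case True
  have "Y2 = 0" unfolding Y2_def by (rule sum.neutral) (simp add: True)
  then have "spectral_norm Y2 = 0" by (simp add: spectral_norm_def onorm_zero)
  then show ?thesis by (simp only: mult_zero_right)
next
  case False
  obtain \<omega>0 where "\<omega>0 \<in> space M" using not_empty by blast
  moreover obtain i where "i \<in> I" using False by blast
  ultimately have "0 \<le> L" using Y_le[of i \<omega>0] spectral_norm_nonneg[of "Y i \<omega>0"] by simp
  then show ?thesis by (intro mult_nonneg_nonneg spectral_norm_nonneg)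
qed

text \<open>Differentiating the root divides by \<psi>^(2p-1), the very power produced by
  \<open>interpolation_integrand_le\<close>. The speed of \<psi> is therefore bounded without
  reference to \<psi>, and plain integration suffices.\<close>

theorem interpolation_bound:
  "\<bar>\<psi> (pi / 2) - \<psi> 0\<bar> \<le> 48 * p ^ 2 * spectral_norm Y2 * L / \<eta> ^ 4"
proof -
  define C where "C = 6 * words3 p * L / \<eta> ^ 4 * spectral_norm Y2 / p"
  define D where "D t = cos t * (\<integral>z. dF p (path t z) (S (fst z)) \<partial>(M \<Otimes>\<^sub>M P))
    - sin t * (\<integral>z. dF p (path t z) (gauss.G A (snd z)) \<partial>(M \<Otimes>\<^sub>M P))" for t
  have \<psi>_pos: "0 < \<psi> t" for t using \<Phi>_pos[of t] by (simp add: \<psi>_def)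
  have \<psi>_pow: "\<psi> t ^ (2 * p) = \<Phi> t / CARD('n)" for t
    using \<Phi>_pos[of t] p_pos by (simp add: \<psi>_def powr_realpow[symmetric] powr_powr)
  have der: "(\<psi> has_real_derivative D t / (CARD('n) * (2 * p) * \<psi> t ^ (2 * p - 1))) (at t)" for t
  proof -
    have "((\<lambda>t. (\<Phi> t / CARD('n)) powr (1 / (2 * p))) has_real_derivative
        1 / (2 * p) * (\<Phi> t / CARD('n)) powr (1 / (2 * p) - 1) * (D t / CARD('n))) (at t)"
      unfolding D_def using \<Phi>_pos[of t]
      by (intro DERIV_chain2[OF has_real_derivative_powr DERIV_cdivide[OF has_derivative_\<Phi>]]) simp
    moreover have "(\<Phi> t / CARD('n)) powr (1 / (2 * p) - 1) = 1 / \<psi> t ^ (2 * p - 1)"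
    proof -
      have "(\<Phi> t / CARD('n)) powr (1 / (2 * p) - 1) = \<psi> t / (\<Phi> t / CARD('n))"
        using \<Phi>_pos[of t] by (simp add: \<psi>_def powr_diff)
      also have "\<dots> = \<psi> t / (\<psi> t * \<psi> t ^ (2 * p - 1))"
        using p_pos by (simp add: \<psi>_pow[symmetric] flip: power_Suc)
      finally show ?thesis using \<psi>_pos[of t] by simp
    qed
    ultimately show ?thesis by (simp add: \<psi>_def[abs_def] mult_ac)
  qed
  have bound: "\<bar>D t / (CARD('n) * (2 * p) * \<psi> t ^ (2 * p - 1))\<bar> \<le> C * (cos t * (sin t)\<^sup>2)" if t: "t \<in> {0..pi / 2}" for t
  proof -
    let ?K = "12 * words3 p * L / \<eta> ^ 4 * spectral_norm Y2"
    have sc: "0 \<le> cos t" using t by (auto intro: cos_ge_zero)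
    have L0: "0 \<le> ?K" using mult_nonneg_nonneg[OF _ L_Y2_nonneg, of "12 * words3 p / \<eta> ^ 4"] \<eta>_pos
      by (simp add: words3_def mult_ac)
    have "\<bar>D t\<bar> \<le> cos t * (sin t)\<^sup>2 * ?K * (\<integral>z. (1 / \<psi> t * tr0 (bal p) (path t z)
        + tr0 (bal (p - 1)) (path t z) / (1 / \<psi> t)) / 2 \<partial>(M \<Otimes>\<^sub>M P))"
      unfolding D_def using t \<psi>_pos by (intro derivative_\<Phi>_le) auto
    also have "\<dots> \<le> cos t * (sin t)\<^sup>2 * ?K * (CARD('n) * \<psi> t ^ (2 * p - 1))"
      by (intro mult_left_mono interpolation_integrand_le
          mult_nonneg_nonneg[OF mult_nonneg_nonneg[OF sc zero_le_power2] L0])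
    also have "\<dots> = C * (cos t * (sin t)\<^sup>2) * (CARD('n) * (2 * p) * \<psi> t ^ (2 * p - 1))"
      using p_pos by (simp add: C_def field_simps)
    finally show ?thesis
      using \<psi>_pos[of t] p_pos by (simp add: abs_mult abs_divide divide_le_eq)
  qed
  \<comment> \<open>cos t (sin t)^2 is the derivative of (sin t)^3 / 3, which increases by 1/3 over
    the interval; the two signs of \<open>c\<close> give the bounds from both sides.\<close>
  have mono: "c * \<psi> (pi / 2) - C * (sin (pi / 2)) ^ 3 / 3 \<le> c * \<psi> 0 - C * (sin 0) ^ 3 / 3" if c: "c = 1 \<or> c = -1" for c
  proof (rule DERIV_nonpos_imp_nonincreasing[where f = "\<lambda>t. c * \<psi> t - C * (sin t) ^ 3 / 3"])
    fix t assume t: "0 \<le> t" "t \<le> pi / 2"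
    define x where "x = D t / (CARD('n) * (2 * p) * \<psi> t ^ (2 * p - 1))"
    note der' = der[of t, folded x_def]
    have "\<bar>x\<bar> \<le> C * (cos t * (sin t)\<^sup>2)" unfolding x_def using t by (intro bound) auto
    then have "c * x - C * (cos t * (sin t)\<^sup>2) \<le> 0" using c by auto
    moreover have "((\<lambda>t. c * \<psi> t - C * (sin t) ^ 3 / 3) has_real_derivative c * x - C * (cos t * (sin t)\<^sup>2)) (at t)"
      by (auto intro!: derivative_eq_intros der')
    ultimately show "\<exists>y. ((\<lambda>t. c * \<psi> t - C * (sin t) ^ 3 / 3) has_real_derivative y) (at t) \<and> y \<le> 0" by blast
  qed simp
  have "\<bar>\<psi> (pi / 2) - \<psi> 0\<bar> \<le> C / 3"
    unfolding abs_le_iff using mono[of 1] mono[of "-1"] by simp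
  also have "\<dots> \<le> 48 * p ^ 2 * spectral_norm Y2 * L / \<eta> ^ 4"
  proof -
    \<comment> \<open>For p \<ge> 1 the three factors are at most 2p, 3p and 4p.\<close>
    have "words3 p \<le> (2 * p) * (3 * p) * (4 * p)"
      unfolding words3_def of_nat_le_iff using p_pos by (intro mult_mono) auto
    then have w: "words3 p / p \<le> 24 * p ^ 2"
      using p_pos by (simp add: divide_le_eq power2_eq_square mult_ac)
    have "C / 3 = 2 * (words3 p / p) * (L * spectral_norm Y2 / \<eta> ^ 4)"
      by (simp add: C_def)
    also have "\<dots> \<le> 2 * (24 * p ^ 2) * (L * spectral_norm Y2 / \<eta> ^ 4)"
      using w L_Y2_nonneg \<eta>_pos by (intro mult_right_mono mult_left_mono) auto
    finally show ?thesis by (simp add: mult_ac)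
  qed
  finally show ?thesis .
qed

end

section \<open>Gaussian representation and functional calculus\<close>

lemma (in prob_space) integral_cos_char:
  assumes [measurable]: "V \<in> borel_measurable M"
  shows "(\<integral>\<omega>. cos (V \<omega> + b) \<partial>M) = Re (iexp b * char (distr M borel V) 1)"
proof -
  have e: "iexp a = complex_of_real (cos a) + \<i> * complex_of_real (sin a)" for a
    by (simp add: cis_conv_exp[symmetric] complex_eq_iff)
  have int: "complex_integrable M (\<lambda>\<omega>. iexp (V \<omega>))"
    by (rule integrable_const_bound[of _ 1]) auto
  have "iexp b * char (distr M borel V) 1 = (CLINT \<omega>|M. iexp b * iexp (V \<omega>))"
    unfolding char_def by (simp add: integral_distr)
  moreover have "Re (CLINT \<omega>|M. iexp b * iexp (V \<omega>)) = (\<integral>\<omega>. Re (iexp b * iexp (V \<omega>)) \<partial>M)"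
    using int by (intro integral_Re[symmetric] integrable_mult_right)
  moreover have "Re (iexp b * iexp x) = cos (x + b)" for x
    unfolding e by (simp add: cos_add)
  ultimately show ?thesis by simp
qed

text \<open>The degenerate and the nondegenerate case obey one formula. Its value at frequency 1
  suffices, because it will be applied to every linear functional of a matrix, multiples
  included.\<close>

lemma (in prob_space) gaussian_rv_properties:
  assumes V: "gaussian_rv M V"
  shows "integrable M V" "integrable M (\<lambda>\<omega>. (V \<omega>)\<^sup>2)"
    and "char (distr M borel V) 1 = iexp (expectation V) * complex_of_real (exp (- variance V / 2))"
proof -
  have [measurable]: "V \<in> borel_measurable M" using V by (simp add: gaussian_rv_def)
  have "integrable M V \<and> integrable M (\<lambda>\<omega>. (V \<omega>)\<^sup>2)
    \<and> char (distr M borel V) 1 = iexp (expectation V) * complex_of_real (exp (- variance V / 2))"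
  proof (cases "\<exists>\<mu>. AE \<omega> in M. V \<omega> = \<mu>")
    case True
    then obtain \<mu> where \<mu>: "AE \<omega> in M. V \<omega> = \<mu>" by blast
    have "expectation V = \<mu>"
      using integral_cong_AE[of V M "\<lambda>_. \<mu>"] \<mu> by (simp add: prob_space)
    moreover have "integrable M V"
      using \<mu> by (subst integrable_cong_AE[where g = "\<lambda>_. \<mu>"]) auto
    moreover have "integrable M (\<lambda>\<omega>. (V \<omega>)\<^sup>2)"
      using \<mu> by (subst integrable_cong_AE[where g = "\<lambda>_. \<mu>\<^sup>2"]) (auto elim: eventually_mono)
    moreover have "variance V = 0"
      using \<mu> by (subst integral_cong_AE[where g = "\<lambda>_. 0"]) (auto simp: calculation(1) elim: eventually_mono)
    moreover have "char (distr M borel V) 1 = (CLINT \<omega>|M. iexp \<mu>)"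
    proof -
      have "(CLINT \<omega>|M. iexp (V \<omega>)) = (CLINT \<omega>|M. iexp \<mu>)"
        using \<mu> by (intro integral_cong_AE) (auto elim: eventually_mono)
      then show ?thesis unfolding char_def by (simp add: integral_distr)
    qed
    ultimately show ?thesis by (simp add: prob_space)
  next
    case False
    then obtain \<mu> \<sigma> where \<sigma>: "0 < \<sigma>" and D: "distributed M lborel V (normal_density \<mu> \<sigma>)"
      using V by (auto simp: gaussian_rv_def)
    have i1: "integrable M V"
      using distributed_integrable[OF D, of "\<lambda>x. x"] integrable_normal_moment_nz_1[OF \<sigma>, of \<mu>] by simp
    have i2: "integrable M (\<lambda>\<omega>. (V \<omega> - \<mu>)\<^sup>2)"
      using distributed_integrable[OF D, of "\<lambda>x. (x - \<mu>)\<^sup>2"] integrable_normal_moment[OF \<sigma>, of \<mu> 2] by simp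
    have "integrable M (\<lambda>\<omega>. (V \<omega> - \<mu>)\<^sup>2 + (2 * \<mu> * V \<omega> - \<mu>\<^sup>2))"
      using i1 i2 by (intro Bochner_Integration.integrable_add Bochner_Integration.integrable_diff) auto
    then have i3: "integrable M (\<lambda>\<omega>. (V \<omega>)\<^sup>2)" by (simp add: power2_eq_square algebra_simps)
    have S: "distributed M lborel (\<lambda>\<omega>. (V \<omega> - \<mu>) / \<sigma>) std_normal_density"
      using D normal_standard_normal_convert[OF \<sigma>] by simp
    have "char (distr M borel V) 1 = (CLINT \<omega>|M. iexp \<mu> * iexp (\<sigma> * ((V \<omega> - \<mu>) / \<sigma>)))"
    proof -
      have "\<sigma> * ((x - \<mu>) / \<sigma>) = x - \<mu>" for x using \<sigma> by simp
      moreover have "iexp \<mu> * iexp (x - \<mu>) = iexp x" for x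
        by (simp add: mult_exp_exp right_diff_distrib)
      ultimately have "iexp \<mu> * iexp (\<sigma> * ((x - \<mu>) / \<sigma>)) = iexp x" for x by (simp only:)
      then have "(CLINT \<omega>|M. iexp \<mu> * iexp (\<sigma> * ((V \<omega> - \<mu>) / \<sigma>))) = (CLINT \<omega>|M. iexp (V \<omega>))"
        by (simp only:)
      then show ?thesis unfolding char_def by (simp add: integral_distr)
    qed
    also have "\<dots> = iexp \<mu> * (CLINT \<omega>|M. iexp (\<sigma> * ((V \<omega> - \<mu>) / \<sigma>)))" by simp
    also have "(CLINT \<omega>|M. iexp (\<sigma> * ((V \<omega> - \<mu>) / \<sigma>)))
        = (CLINT x|distr M lborel (\<lambda>\<omega>. (V \<omega> - \<mu>) / \<sigma>). iexp (\<sigma> * x))"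
      by (subst integral_distr) simp_all
    also have "\<dots> = char std_normal_distribution \<sigma>"
      unfolding distributed_distr_eq_density[OF S] char_def by simp
    finally show ?thesis
      using i1 i3 by (simp add: char_std_normal_distribution normal_distributed_expectation[OF \<sigma> D]
          normal_distributed_variance[OF \<sigma> D, unfolded normal_distributed_expectation[OF \<sigma> D]])
  qed
  then show "integrable M V" "integrable M (\<lambda>\<omega>. (V \<omega>)\<^sup>2)"
    "char (distr M borel V) 1 = iexp (expectation V) * complex_of_real (exp (- variance V / 2))" by auto
qed

lemma (in standard_gaussians) char_linear_combination:
  "char (distr P borel (\<lambda>\<omega>. \<Sum>k\<in>K. a k * \<xi> k \<omega>)) 1 = complex_of_real (exp (- (\<Sum>k\<in>K. (a k)\<^sup>2) / 2))"
proof -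
  have "char (distr P borel (\<lambda>\<omega>. a k * \<xi> k \<omega>)) 1 = complex_of_real (exp (- (a k)\<^sup>2 / 2))" if k: "k \<in> K" for k
  proof -
    note [measurable] = \<xi>_measurable[OF k]
    have "char (distr P borel (\<lambda>\<omega>. a k * \<xi> k \<omega>)) 1 = char (distr P borel (\<xi> k)) (a k)"
      unfolding char_def by (simp add: integral_distr)
    then show ?thesis by (simp add: \<xi>_distr[OF k] char_std_normal_distribution)
  qed
  moreover have "indep_vars (\<lambda>_. borel) (\<lambda>k \<omega>. a k * \<xi> k \<omega>) K"
    by (rule indep_vars_compose2[OF \<xi>_indep]) simp
  ultimately show ?thesis
    by (simp add: char_distr_sum exp_sum[OF finite_K, symmetric] sum_negf sum_divide_distrib
        flip: of_real_prod)
qed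

section \<open>Gaussian families with a prescribed covariance\<close>

lemma standard_gaussians_PiM:
  fixes J :: "'k set"
  assumes "finite J" "J \<noteq> {}"
  shows "standard_gaussians (PiM J (\<lambda>_. std_normal_distribution)) (\<lambda>k \<omega>. \<omega> k) J"
proof -
  have p: "prob_space std_normal_distribution" using real_dist_normal_dist by (simp add: real_distribution_def)
  let ?P = "PiM J (\<lambda>_. std_normal_distribution)"
  interpret P: prob_space ?P by (rule prob_space_PiM) (rule p)
  have c: "distr ?P borel (\<lambda>\<omega>. \<omega> k) = std_normal_distribution" if "k \<in> J" for k
  proof -
    have "distr ?P borel (\<lambda>\<omega>. \<omega> k) = distr ?P std_normal_distribution (\<lambda>\<omega>. \<omega> k)"
      by (rule distr_cong) simp_all
    also have "\<dots> = std_normal_distribution" using p that by (intro distr_PiM_component) auto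
    finally show ?thesis .
  qed
  have m: "(\<lambda>\<omega>. \<omega> k) \<in> borel_measurable ?P" if "k \<in> J" for k
    using measurable_component_singleton[OF that, of "\<lambda>_. std_normal_distribution"] by simp
  have "P.indep_vars (\<lambda>_. borel) (\<lambda>k \<omega>. \<omega> k) J"
  proof (subst P.indep_vars_iff_distr_eq_PiM'[OF assms(2) m])
    have "distr ?P (PiM J (\<lambda>_. borel)) (\<lambda>\<omega>. \<lambda>k\<in>J. \<omega> k) = distr ?P ?P (\<lambda>\<omega>. \<omega>)"
      by (rule distr_cong) (auto simp: space_PiM intro!: sets_PiM_cong)
    also have "\<dots> = PiM J (\<lambda>k. distr ?P borel (\<lambda>\<omega>. \<omega> k))"
      by (simp add: c cong: PiM_cong)
    finally show "distr ?P (PiM J (\<lambda>_. borel)) (\<lambda>\<omega>. \<lambda>k\<in>J. \<omega> k) = PiM J (\<lambda>k. distr ?P borel (\<lambda>\<omega>. \<omega> k))" .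
  qed
  then show ?thesis
    using assms c by unfold_locales auto
qed

text \<open>The second moments, indexed by pairs, form a positive semidefinite matrix. Its
  eigenvectors, scaled by roots of eigenvalues and read as square matrices, factor it but need not
  be self-adjoint. Splitting each into two Hermitian parts repairs this, whence the
  \<open>bool\<close> in the index.\<close>

lemma covariance_factorization:
  fixes Y :: "'i \<Rightarrow> 'a \<Rightarrow> complex^'n^'n"
  assumes Y: "\<And>i \<omega>. i \<in> I \<Longrightarrow> \<omega> \<in> space M \<Longrightarrow> self_adjoint (Y i \<omega>)"
    and int: "\<And>i a b c d. i \<in> I \<Longrightarrow> integrable M (\<lambda>\<omega>. Y i \<omega> $ a $ b * Y i \<omega> $ c $ d)"
  obtains A :: "('n \<times> 'n) \<times> bool \<Rightarrow> complex^'n^'n"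
  where "\<forall>k. self_adjoint (A k)"
    "\<forall>a b c d. (\<Sum>k\<in>UNIV. A k $ a $ b * A k $ c $ d) = (\<Sum>i\<in>I. \<integral>\<omega>. Y i \<omega> $ a $ b * Y i \<omega> $ c $ d \<partial>M)"
proof -
  define q where "q a b c d = (\<Sum>i\<in>I. \<integral>\<omega>. Y i \<omega> $ a $ b * Y i \<omega> $ c $ d \<partial>M)" for a b c d
  have q_swap: "q a b c d = q c d a b" for a b c d by (simp add: q_def mult.commute)
  have q_cnj: "cnj (q a b c d) = q b a d c" for a b c d
  proof -
    have "cnj (\<integral>\<omega>. Y i \<omega> $ a $ b * Y i \<omega> $ c $ d \<partial>M) = (\<integral>\<omega>. Y i \<omega> $ b $ a * Y i \<omega> $ d $ c \<partial>M)" if i: "i \<in> I" for i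
    proof -
      have "cnj (\<integral>\<omega>. Y i \<omega> $ a $ b * Y i \<omega> $ c $ d \<partial>M) = (\<integral>\<omega>. cnj (Y i \<omega> $ a $ b * Y i \<omega> $ c $ d) \<partial>M)"
        by (simp del: complex_cnj_mult)
      also have "\<dots> = (\<integral>\<omega>. Y i \<omega> $ b $ a * Y i \<omega> $ d $ c \<partial>M)"
        using self_adjoint_component[OF Y[OF i], of _ b a] self_adjoint_component[OF Y[OF i], of _ d c]
        by (intro Bochner_Integration.integral_cong refl) simp
      finally show ?thesis .
    qed
    then show ?thesis by (simp add: q_def)
  qed
  \<comment> \<open>The second pair of indices is reversed: for self-adjoint matrices this
    conjugates the entry, so that \<open>Q\<close> is Hermitian and positive.\<close>
  define Q :: "complex^('n \<times> 'n)^('n \<times> 'n)"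
    where "Q = (\<chi> r s. q (fst r) (snd r) (snd s) (fst s))"
  have Q: "self_adjoint Q"
    unfolding self_adjoint_def by (simp add: vec_eq_iff Q_def q_cnj q_swap)
  obtain U v where U: "unitary U" and QU: "Q = U ** real_diag v ** conj_transpose U"
    using self_adjoint_diagonalization[OF Q] .
  have diag: "real_diag v = cdiag (\<lambda>k. of_real (v k))" by (simp add: real_diag_def cdiag_def)
  have Qrs: "Q $ r $ s = (\<Sum>k\<in>UNIV. U $ r $ k * of_real (v k) * cnj (U $ s $ k))" for r s
    unfolding QU diag by (simp add: matrix_mult_component[of "U ** cdiag _"] cdiag_mult_component)
  \<comment> \<open>An eigenvalue is the quadratic form of \<open>Q\<close> at a column of
    \<open>U\<close>, which is a sum of second moments of moduli of linear functionals of the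
    summands.\<close>
  have v: "0 \<le> v k" for k
  proof -
    have "conj_transpose U ** Q ** U = real_diag v"
      using unitaryD[OF U] unfolding QU by (metis matrix_mul_assoc matrix_mul_lid matrix_mul_rid)
    then have "of_real (v k) = (conj_transpose U ** Q ** U) $ k $ k" by (simp add: real_diag_def)
    also have "\<dots> = (\<Sum>s\<in>UNIV. \<Sum>r\<in>UNIV. cnj (U $ r $ k) * Q $ r $ s * U $ s $ k)"
      by (simp add: matrix_mult_component sum_distrib_right)
    also have "\<dots> = (\<Sum>i\<in>I. \<integral>\<omega>. (\<Sum>s\<in>UNIV. \<Sum>r\<in>UNIV. cnj (U $ r $ k) * (Y i \<omega> $ fst r $ snd r * Y i \<omega> $ snd s $ fst s) * U $ s $ k) \<partial>M)"
    proof -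
      have "(\<integral>\<omega>. (\<Sum>s\<in>UNIV. \<Sum>r\<in>UNIV. cnj (U $ r $ k) * (Y i \<omega> $ fst r $ snd r * Y i \<omega> $ snd s $ fst s) * U $ s $ k) \<partial>M)
        = (\<Sum>s\<in>UNIV. \<Sum>r\<in>UNIV. cnj (U $ r $ k) * (\<integral>\<omega>. Y i \<omega> $ fst r $ snd r * Y i \<omega> $ snd s $ fst s \<partial>M) * U $ s $ k)"
        if "i \<in> I" for i
        using int[OF that] by simp
      then show ?thesis
        by (simp add: Q_def q_def sum_distrib_left sum_distrib_right sum.swap[of _ I])
    qed
    also have "\<dots> = (\<Sum>i\<in>I. \<integral>\<omega>. of_real ((cmod (\<Sum>r\<in>UNIV. cnj (U $ r $ k) * Y i \<omega> $ fst r $ snd r))\<^sup>2) \<partial>M)"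
    proof (rule sum.cong[OF refl], rule Bochner_Integration.integral_cong[OF refl])
      fix i \<omega> assume i: "i \<in> I" "\<omega> \<in> space M"
      have "cnj (\<Sum>s\<in>UNIV. cnj (U $ s $ k) * Y i \<omega> $ fst s $ snd s) = (\<Sum>s\<in>UNIV. U $ s $ k * Y i \<omega> $ snd s $ fst s)"
        unfolding cnj_sum complex_cnj_mult complex_cnj_cnj
        by (intro sum.cong refl arg_cong2[where f = "(*)"] self_adjoint_component[OF Y[OF i], symmetric])
      then have "of_real ((cmod (\<Sum>r\<in>UNIV. cnj (U $ r $ k) * Y i \<omega> $ fst r $ snd r))\<^sup>2)
          = (\<Sum>r\<in>UNIV. cnj (U $ r $ k) * Y i \<omega> $ fst r $ snd r) * (\<Sum>s\<in>UNIV. U $ s $ k * Y i \<omega> $ snd s $ fst s)"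
        unfolding complex_norm_square by (simp only:)
      also have "\<dots> = (\<Sum>s\<in>UNIV. \<Sum>r\<in>UNIV. cnj (U $ r $ k) * (Y i \<omega> $ fst r $ snd r * Y i \<omega> $ snd s $ fst s) * U $ s $ k)"
        unfolding sum_product by (subst sum.swap) (simp add: mult_ac)
      finally show "(\<Sum>s\<in>UNIV. \<Sum>r\<in>UNIV. cnj (U $ r $ k) * (Y i \<omega> $ fst r $ snd r * Y i \<omega> $ snd s $ fst s) * U $ s $ k)
        = of_real ((cmod (\<Sum>r\<in>UNIV. cnj (U $ r $ k) * Y i \<omega> $ fst r $ snd r))\<^sup>2)" ..
    qed
    also have "\<dots> = of_real (\<Sum>i\<in>I. \<integral>\<omega>. (cmod (\<Sum>r\<in>UNIV. cnj (U $ r $ k) * Y i \<omega> $ fst r $ snd r))\<^sup>2 \<partial>M)"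
      by (simp only: integral_complex_of_real of_real_sum)
    finally have "v k = (\<Sum>i\<in>I. \<integral>\<omega>. (cmod (\<Sum>r\<in>UNIV. cnj (U $ r $ k) * Y i \<omega> $ fst r $ snd r))\<^sup>2 \<partial>M)"
      by (simp only: of_real_eq_iff)
    then show ?thesis by (simp add: sum_nonneg)
  qed
  define C :: "'n \<times> 'n \<Rightarrow> complex^'n^'n" where "C k = (\<chi> a b. of_real (sqrt (v k)) * U $ (a, b) $ k)" for k
  have CC: "(\<Sum>k\<in>UNIV. C k $ a $ b * cnj (C k $ d $ c)) = q a b c d" for a b c d
  proof -
    have "C k $ a $ b * cnj (C k $ d $ c) = U $ (a, b) $ k * of_real (v k) * cnj (U $ (d, c) $ k)" for k
    proof -
      have "C k $ a $ b * cnj (C k $ d $ c)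
          = U $ (a, b) $ k * (of_real (sqrt (v k)) * of_real (sqrt (v k))) * cnj (U $ (d, c) $ k)"
        by (simp add: C_def mult_ac)
      then show ?thesis using v[of k] by (simp flip: of_real_mult)
    qed
    then show ?thesis using Qrs[of "(a, b)" "(d, c)"] by (simp add: Q_def)
  qed
  text \<open>The Hermitian parts \<open>H, H'\<close> of \<open>C = H + i H'\<close> satisfy
    \<open>H \<otimes> H + H' \<otimes> H' = (C \<otimes> C\<^sup>* + C\<^sup>* \<otimes> C) / 2\<close>.\<close>
  define A where "A k = (if snd k then herm (C (fst k)) else herm (\<chi> a b. - \<i> * C (fst k) $ a $ b))" for k
  have herm_comp: "herm B $ a $ b = (B $ a $ b + cnj (B $ b $ a)) / 2" for B :: "complex^'n^'n" and a b
    by (simp add: herm_def scaleR_conv_of_real[where 'a = complex])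
  have "(\<Sum>k\<in>UNIV. A k $ a $ b * A k $ c $ d) = q a b c d" for a b c d
  proof -
    have "(\<Sum>k\<in>UNIV. A k $ a $ b * A k $ c $ d)
        = (\<Sum>k\<in>UNIV. \<Sum>t\<in>UNIV. A (k, t) $ a $ b * A (k, t) $ c $ d)"
      by (simp add: sum.cartesian_product)
    also have "\<dots> = (\<Sum>k\<in>UNIV. (C k $ a $ b * cnj (C k $ d $ c) + C k $ c $ d * cnj (C k $ b $ a)) / 2)"
      by (intro sum.cong refl) (simp add: UNIV_bool A_def herm_comp field_simps)
    also have "\<dots> = (q a b c d + q c d a b) / 2"
      by (simp add: sum_divide_distrib[symmetric] sum.distrib CC)
    finally show ?thesis using q_swap[of c d a b] by simp
  qed
  moreover have "self_adjoint (A k)" for k by (simp add: A_def self_adjoint_herm)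
  ultimately show ?thesis using that[of A] by (simp add: q_def)
qed

section \<open>Functional calculus and norms of resolvents\<close>

text \<open>Independence of the diagonalization: the transition matrix \<open>C\<close> between two
  eigenbases has a nonzero entry only where the eigenvalues agree, so it intertwines the images
  under \<open>f\<close> as well.\<close>

lemma matrix_fun_unitary_conj:
  assumes U: "unitary U"
  shows "matrix_fun f (U ** real_diag v ** conj_transpose U) = U ** real_diag (f \<circ> v) ** conj_transpose U"
  unfolding matrix_fun_def
proof (rule the_equality)
  show "\<exists>W w. unitary W \<and> U ** real_diag v ** conj_transpose U = W ** real_diag w ** conj_transpose W
      \<and> U ** real_diag (f \<circ> v) ** conj_transpose U = W ** real_diag (f \<circ> w) ** conj_transpose W"
    using U by blast
  fix B
  assume "\<exists>W w. unitary W \<and> U ** real_diag v ** conj_transpose U = W ** real_diag w ** conj_transpose W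
      \<and> B = W ** real_diag (f \<circ> w) ** conj_transpose W"
  then obtain W w where W: "unitary W"
    and eq: "U ** real_diag v ** conj_transpose U = W ** real_diag w ** conj_transpose W"
    and B: "B = W ** real_diag (f \<circ> w) ** conj_transpose W" by blast
  have diag: "real_diag x = cdiag (\<lambda>k. of_real (x k))" for x :: "'a \<Rightarrow> real"
    by (simp add: real_diag_def cdiag_def)
  define C where "C = conj_transpose W ** U"
  have UC: "U = W ** C" using unitaryD[OF W] unfolding C_def by (metis matrix_mul_assoc matrix_mul_lid)
  have "C ** real_diag v = conj_transpose W ** (U ** real_diag v ** conj_transpose U) ** U"
    using unitaryD[OF U] unfolding C_def by (metis matrix_mul_assoc matrix_mul_rid)
  also have "\<dots> = real_diag w ** C"
    unfolding eq C_def using unitaryD[OF W] by (metis matrix_mul_assoc matrix_mul_lid)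
  finally have "C $ i $ j * of_real (v j) = of_real (w i) * C $ i $ j" for i j
    by (metis diag cdiag_mult_component)
  then have "C $ i $ j = 0 \<or> v j = w i" for i j
    by (metis mult.commute mult_cancel_left of_real_eq_iff)
  then have "C ** real_diag (f \<circ> v) = real_diag (f \<circ> w) ** C"
    by (simp add: vec_eq_iff diag cdiag_mult_component) (metis mult.commute mult_zero_left)
  then have "U ** real_diag (f \<circ> v) = W ** real_diag (f \<circ> w) ** C"
    unfolding UC by (metis matrix_mul_assoc)
  then have "U ** real_diag (f \<circ> v) ** conj_transpose U = W ** real_diag (f \<circ> w) ** (C ** conj_transpose U)"
    by (metis matrix_mul_assoc)
  also have "C ** conj_transpose U = conj_transpose W"
    using unitaryD[OF U] unfolding C_def by (metis matrix_mul_assoc matrix_mul_rid)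
  finally show "B = U ** real_diag (f \<circ> v) ** conj_transpose U" unfolding B by (rule sym)
qed

context resolvent_words
begin

text \<open>The adjoint of the resolvent times the resolvent has eigenvalues (d i)^2 in the same
  eigenbasis, so both layers of functional calculus act on the positive numbers
  \<open>d i\<close>.\<close>

lemma trace_abs_resolvent_powr:
  fixes A :: "complex^'n^'n"
  assumes A: "self_adjoint A" and p: "p \<ge> 1"
  shows "Re (ntrace (matrix_fun (\<lambda>x. x powr (2 * real p)) (matrix_abs (resolvent \<zeta> A)))) = tr0 (bal p) A / CARD('n)"
proof -
  obtain U d w where U: "unitary U" and d: "\<forall>i. 0 < d i \<and> d i \<le> 1 / \<eta>"
    and W: "\<forall>bs. word bs A = U ** cdiag (w bs) ** conj_transpose U"
    and w: "\<forall>bs i. cmod (w bs i) = d i ^ length bs" "\<forall>m i. w (bal m) i = of_real (d i ^ (2 * m))"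
    using word_diagonalization[where M = A] .
  define r where "r = w [True]"
  have R: "resolvent \<zeta> A = U ** cdiag r ** conj_transpose U"
    using W[rule_format, of "[True]"] by (simp add: r_def res_def herm_self_adjoint[OF A])
  have rd: "cmod (r i) = d i" for i using w(1) by (simp add: r_def)
  have "conj_transpose (resolvent \<zeta> A) = U ** cdiag (\<lambda>i. cnj (r i)) ** conj_transpose U"
  proof -
    have "conj_transpose (cdiag r) = cdiag (\<lambda>i. cnj (r i))" by (auto simp: vec_eq_iff cdiag_component)
    then show ?thesis by (simp add: R conj_transpose_mult matrix_mul_assoc)
  qed
  then have "conj_transpose (resolvent \<zeta> A) ** resolvent \<zeta> A = U ** cdiag (\<lambda>i. cnj (r i) * r i) ** conj_transpose U"
    by (simp add: R unitary_conj_mult[OF U] cdiag_mult)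
  also have "cdiag (\<lambda>i. cnj (r i) * r i) = real_diag (\<lambda>i. (d i)\<^sup>2)"
    using complex_norm_square[of "r i" for i]
    by (auto simp: vec_eq_iff cdiag_def real_diag_def rd mult.commute)
  finally have "matrix_abs (resolvent \<zeta> A) = U ** real_diag (sqrt \<circ> (\<lambda>i. (d i)\<^sup>2)) ** conj_transpose U"
    unfolding matrix_abs_def by (simp add: matrix_fun_unitary_conj[OF U])
  also have "sqrt \<circ> (\<lambda>i. (d i)\<^sup>2) = d" using d by (auto simp: fun_eq_iff less_imp_le)
  finally have "matrix_fun (\<lambda>x. x powr (2 * real p)) (matrix_abs (resolvent \<zeta> A))
      = U ** real_diag ((\<lambda>x. x powr (2 * real p)) \<circ> d) ** conj_transpose U"
    by (simp add: matrix_fun_unitary_conj[OF U])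
  moreover have "(\<lambda>x. x powr (2 * real p)) \<circ> d = (\<lambda>i. d i ^ (2 * p))"
    using d powr_realpow[of "d i" "2 * p" for i] by (auto simp: fun_eq_iff)
  ultimately have "trace (matrix_fun (\<lambda>x. x powr (2 * real p)) (matrix_abs (resolvent \<zeta> A)))
      = (\<Sum>i\<in>UNIV. complex_of_real (d i ^ (2 * p)))"
    by (simp add: trace_unitary_conj[OF U]) (simp add: trace_def real_diag_def)
  moreover have "tr0 (bal p) A = (\<Sum>i\<in>UNIV. d i ^ (2 * p))"
    by (simp add: tr0_def W trace_unitary_conj[OF U] trace_cdiag w)
  ultimately show ?thesis by (simp add: ntrace_def)
qed

lemma tr0_bal_bounds:
  fixes A :: "complex^'n^'n"
  shows "0 \<le> tr0 (bal m) A" "tr0 (bal m) A \<le> CARD('n) * (1 / \<eta>) ^ (2 * m)"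
proof -
  obtain d :: "'n \<Rightarrow> real" where d: "\<forall>i. 0 < d i \<and> d i \<le> 1 / \<eta>" "\<forall>m. tr0 (bal m) A = (\<Sum>i\<in>UNIV. d i ^ (2 * m))"
    using tr0_bal_eq_sum[where M = A] .
  show "0 \<le> tr0 (bal m) A" using d by (simp add: sum_nonneg less_imp_le)
  have "(\<Sum>i\<in>UNIV. d i ^ (2 * m)) \<le> (\<Sum>i\<in>(UNIV :: 'n set). (1 / \<eta>) ^ (2 * m))"
    using d(1) by (intro sum_mono power_mono) (auto intro: less_imp_le)
  then show "tr0 (bal m) A \<le> CARD('n) * (1 / \<eta>) ^ (2 * m)" using d(2) by simp
qed

lemma Lq_norm_resolvent:
  fixes Y :: "'w \<Rightarrow> complex^'n^'n"
  assumes "\<And>\<omega>. \<omega> \<in> space K \<Longrightarrow> self_adjoint (Y \<omega>)" and p: "p \<ge> 1"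
  shows "Lq_norm K (2 * real p) (\<lambda>\<omega>. resolvent \<zeta> (Y \<omega>)) = ((\<integral>\<omega>. tr0 (bal p) (Y \<omega>) \<partial>K) / CARD('n)) powr (1 / (2 * p))"
proof -
  have "(\<integral>\<omega>. Re (ntrace (matrix_fun (\<lambda>x. x powr (2 * real p)) (matrix_abs (resolvent \<zeta> (Y \<omega>))))) \<partial>K)
      = (\<integral>\<omega>. tr0 (bal p) (Y \<omega>) / CARD('n) \<partial>K)"
    using assms by (intro Bochner_Integration.integral_cong refl trace_abs_resolvent_powr)
  then show ?thesis by (simp add: Lq_norm_def)
qed

text \<open>All singular values of the resolvent are at most 1/\<eta>. This trivial bound settles
  the range of large \<open>L\<close>.\<close>

lemma Lq_norm_resolvent_le:
  fixes Y :: "'w \<Rightarrow> complex^'n^'n"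
  assumes K: "prob_space K" and Y: "random_self_adjoint K Y" and p: "p \<ge> 1"
  shows "0 \<le> Lq_norm K (2 * real p) (\<lambda>\<omega>. resolvent \<zeta> (Y \<omega>)) \<and> Lq_norm K (2 * real p) (\<lambda>\<omega>. resolvent \<zeta> (Y \<omega>)) \<le> 1 / \<eta>"
proof -
  interpret K: prob_space K by fact
  have [measurable]: "Y \<in> borel_measurable K" and sa: "\<And>\<omega>. \<omega> \<in> space K \<Longrightarrow> self_adjoint (Y \<omega>)"
    using Y by (auto simp: random_self_adjoint_def)
  have b: "0 \<le> tr0 (bal p) (Y \<omega>)" "tr0 (bal p) (Y \<omega>) \<le> CARD('n) * (1 / \<eta>) ^ (2 * p)" for \<omega>
    by (rule tr0_bal_bounds)+
  have int: "integrable K (\<lambda>\<omega>. tr0 (bal p) (Y \<omega>))"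
    using b by (intro K.integrable_const_bound[of _ "CARD('n) * (1 / \<eta>) ^ (2 * p)"]) auto
  have "(\<integral>\<omega>. tr0 (bal p) (Y \<omega>) \<partial>K) \<le> (\<integral>\<omega>. CARD('n) * (1 / \<eta>) ^ (2 * p) \<partial>K)"
    using int b by (intro integral_mono) auto
  then have "(\<integral>\<omega>. tr0 (bal p) (Y \<omega>) \<partial>K) / CARD('n) \<le> (1 / \<eta>) ^ (2 * p)"
    by (simp add: K.prob_space divide_le_eq mult.commute)
  moreover have "0 \<le> (\<integral>\<omega>. tr0 (bal p) (Y \<omega>) \<partial>K)"
    using b by (intro integral_nonneg_AE) auto
  ultimately have "((\<integral>\<omega>. tr0 (bal p) (Y \<omega>) \<partial>K) / CARD('n)) powr (1 / (2 * p)) \<le> ((1 / \<eta>) ^ (2 * p)) powr (1 / (2 * p))"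
    by (intro powr_mono2) auto
  also have "((1 / \<eta>) ^ (2 * p)) powr (1 / (2 * p)) = 1 / \<eta>"
    using \<eta>_pos p by (simp add: powr_realpow[symmetric] powr_powr del: power_divide)
  finally show ?thesis using Lq_norm_resolvent[of K Y p, OF sa p] by simp
qed

end

section \<open>The comparison theorem\<close>

lemma integrable_euclidean:
  fixes f :: "'w \<Rightarrow> 'e :: euclidean_space"
  assumes "\<And>b. b \<in> Basis \<Longrightarrow> integrable M (\<lambda>x. f x \<bullet> b)"
  shows "integrable M f"
proof -
  have "integrable M (\<lambda>x. \<Sum>b\<in>Basis. (f x \<bullet> b) *\<^sub>R b)"
    using assms by (intro Bochner_Integration.integrable_sum integrable_scaleR_left)
  then show ?thesis by (simp add: euclidean_representation)
qed

lemma integral_matrix_component: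
  fixes f :: "'w \<Rightarrow> complex^'n^'m"
  assumes "integrable M f"
  shows "(\<integral>\<omega>. f \<omega> \<partial>M) $ a $ b = (\<integral>\<omega>. f \<omega> $ a $ b \<partial>M)"
  by (rule integral_bounded_linear[symmetric, OF bounded_linear_compose[OF bounded_linear_vec_nth bounded_linear_vec_nth] assms])

lemma integrable_matrixI:
  fixes f :: "'w \<Rightarrow> complex^'n^'m"
  assumes "\<And>a b. integrable M (\<lambda>\<omega>. f \<omega> $ a $ b)"
  shows "integrable M f"
proof (rule integrable_euclidean)
  fix \<theta> :: "complex^'n^'m"
  have "integrable M (\<lambda>\<omega>. \<Sum>a\<in>UNIV. \<Sum>b\<in>UNIV. f \<omega> $ a $ b \<bullet> \<theta> $ a $ b)"
    using assms by (intro Bochner_Integration.integrable_sum integrable_inner_left)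
  then show "integrable M (\<lambda>\<omega>. f \<omega> \<bullet> \<theta>)" by (simp add: inner_vec_def)
qed

lemma var_tensor_component:
  fixes Y :: "'w \<Rightarrow> complex^'n^'n"
  assumes "\<And>a b c d. integrable M (\<lambda>\<omega>. (Y \<omega> - integral\<^sup>L M Y) $ a $ b * (Y \<omega> - integral\<^sup>L M Y) $ c $ d)"
  shows "var_tensor M Y $ (a, c) $ (b, d)
    = (\<integral>\<omega>. (Y \<omega> - integral\<^sup>L M Y) $ a $ b * (Y \<omega> - integral\<^sup>L M Y) $ c $ d \<partial>M)"
proof -
  have "integrable M (\<lambda>\<omega>. kronecker (Y \<omega> - integral\<^sup>L M Y) (Y \<omega> - integral\<^sup>L M Y))"
    using assms by (intro integrable_matrixI) (simp add: kronecker_def)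
  then show ?thesis
    unfolding var_tensor_def Let_def by (simp add: integral_matrix_component) (simp add: kronecker_def)
qed

text \<open>The variance tensor contains products of entries without conjugates. This form expresses
  a real functional of \<open>V\<close> linearly in such entries.\<close>

lemma inner_self_adjoint_eq_sum:
  fixes V \<theta> :: "complex^'n^'n"
  assumes V: "self_adjoint V"
  shows "complex_of_real (V \<bullet> \<theta>) = (\<Sum>a\<in>UNIV. \<Sum>b\<in>UNIV. V $ a $ b * herm \<theta> $ b $ a)"
proof -
  define z where "z = trace (V ** conj_transpose \<theta>)"
  have "trace (V ** \<theta>) = cnj (trace (conj_transpose (V ** \<theta>)))" by (simp add: trace_conj_transpose)
  also have "trace (conj_transpose (V ** \<theta>)) = z"
    using V unfolding z_def conj_transpose_mult self_adjoint_def by (metis trace_mul_sym)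
  finally have "trace (V ** herm \<theta>) = (1/2) *\<^sub>R (cnj z + z)"
    by (simp add: herm_def matrix_mult_scaleR trace_simps matrix_mult.add_right z_def[symmetric])
  also have "\<dots> = complex_of_real (V \<bullet> \<theta>)"
    by (simp add: inner_matrix_eq_trace z_def[symmetric] complex_eq_iff)
  finally show ?thesis by (simp add: trace_def matrix_mult_component)
qed

section \<open>Laws of Gaussian matrices\<close>

lemma gaussian_matrix_inner:
  fixes Z :: "'w \<Rightarrow> complex^'n^'n"
  assumes "gaussian_matrix N Z"
  shows "gaussian_rv N (\<lambda>\<omega>. Z \<omega> \<bullet> \<theta>)"
proof -
  \<comment> \<open>The index set contains the functions \<open>Re\<close> and \<open>Im\<close>
    themselves; they must be distinct for the sum over it to have both parts.\<close>
  have "Re \<noteq> Im" by (metis one_complex.sel zero_neq_one)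
  moreover have "sum g (UNIV :: ('n \<times> 'n) set) = (\<Sum>i\<in>UNIV. \<Sum>j\<in>UNIV. g (i, j))" for g :: "'n \<times> 'n \<Rightarrow> real"
    by (simp add: sum.cartesian_product)
  ultimately have "(\<Sum>x\<in>{Re, Im} \<times> UNIV. (\<lambda>(part, i, j). part (\<theta> $ i $ j)) x * (\<lambda>(part, i, j). part (Z \<omega> $ i $ j)) x) = Z \<omega> \<bullet> \<theta>" for \<omega>
    by (simp add: sum.cartesian_product' inner_vec_def inner_complex_def sum.distrib mult.commute)
  moreover have "gaussian_rv N (\<lambda>\<omega>. \<Sum>x\<in>{Re, Im} \<times> UNIV.
      (\<lambda>(part, i, j). part (\<theta> $ i $ j)) x * (\<lambda>(part, i, j). part (Z \<omega> $ i $ j)) x)"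
    using assms unfolding gaussian_matrix_def jointly_gaussian_def
    by (auto dest!: spec[of _ "{Re, Im} \<times> UNIV"] spec[of _ "\<lambda>(part, i, j). part (\<theta> $ i $ j)"] simp: case_prod_beta')
  ultimately show ?thesis by simp
qed

lemma (in prob_space) gaussian_matrix_integrable:
  fixes Z :: "'a \<Rightarrow> complex^'n^'n"
  assumes Z: "gaussian_matrix M Z"
  shows "integrable M Z" "integrable M (\<lambda>\<omega>. (norm (Z \<omega> - C))\<^sup>2)"
proof -
  note g = gaussian_rv_properties[OF gaussian_matrix_inner[OF Z]]
  show "integrable M Z" by (rule integrable_euclidean) (rule g(1))
  have "(norm (Z \<omega> - C))\<^sup>2 = (\<Sum>b\<in>Basis. (Z \<omega> \<bullet> b)\<^sup>2 - 2 * (C \<bullet> b) * (Z \<omega> \<bullet> b) + (C \<bullet> b)\<^sup>2)" for \<omega>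
    unfolding power2_norm_eq_inner
    by (subst euclidean_inner) (simp add: inner_diff_left power2_eq_square algebra_simps)
  then show "integrable M (\<lambda>\<omega>. (norm (Z \<omega> - C))\<^sup>2)"
    using g(1,2) by simp
qed

text \<open>A law is determined by the cosine transforms of its real functionals. Those of
  \<open>Z\<close> are Gaussian, hence fixed by mean and variance, and both are read off from the
  mean matrix and the products in \<open>cov\<close>.\<close>

lemma (in standard_gaussians) gaussian_matrix_distr:
  fixes Z :: "'w \<Rightarrow> complex^'n^'n" and A :: "'k \<Rightarrow> complex^'n^'n"
  assumes N: "prob_space N" and Z: "random_self_adjoint N Z" "gaussian_matrix N Z"
    and A: "\<And>k. self_adjoint (A k)" and A0: "integral\<^sup>L N Z = A0" "self_adjoint A0"
    and cov: "\<And>a b c d. (\<integral>\<omega>. (Z \<omega> - A0) $ a $ b * (Z \<omega> - A0) $ c $ d \<partial>N) = (\<Sum>k\<in>K. A k $ a $ b * A k $ c $ d)"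
  shows "distr N borel Z = distr P borel (\<lambda>\<omega>. A0 + G A \<omega>)"
proof -
  interpret N: prob_space N by fact
  have Zm[measurable]: "Z \<in> borel_measurable N" and Zsa: "\<And>\<omega>. \<omega> \<in> space N \<Longrightarrow> self_adjoint (Z \<omega>)"
    using Z(1) by (auto simp: random_self_adjoint_def)
  note iZ = N.gaussian_matrix_integrable[OF Z(2)]
  have [measurable]: "(\<lambda>\<omega>. Z \<omega> - A0) \<in> borel_measurable N" by measurable
  have ic: "integrable N (\<lambda>\<omega>. (Z \<omega> - A0) $ a $ b * (Z \<omega> - A0) $ c $ d)" for a b c d
    by (rule integrable_component_mult[OF _ iZ(2)]) measurable
  show ?thesis
  proof (rule distr_eqI_cos[OF N prob_space_axioms Zm])
    show "(\<lambda>\<omega>. A0 + G A \<omega>) \<in> borel_measurable P" by measurable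
    fix \<theta> :: "complex^'n^'n" and c
    define H where "H = herm \<theta>"
    note g = N.gaussian_rv_properties(3)[OF gaussian_matrix_inner[OF Z(2), of \<theta>]]
    have m: "(\<integral>\<omega>. Z \<omega> \<bullet> \<theta> \<partial>N) = A0 \<bullet> \<theta>"
      using integral_inner_left[OF iZ(1), of \<theta>] by (simp add: A0)
    have sq: "complex_of_real ((V \<bullet> \<theta>)\<^sup>2)
        = (\<Sum>a\<in>UNIV. \<Sum>c\<in>UNIV. \<Sum>b\<in>UNIV. \<Sum>d\<in>UNIV. H $ b $ a * H $ d $ c * (V $ a $ b * V $ c $ d))"
      if "self_adjoint V" for V
    proof -
      have "complex_of_real ((V \<bullet> \<theta>)\<^sup>2) = complex_of_real (V \<bullet> \<theta>) * complex_of_real (V \<bullet> \<theta>)"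
        by (simp add: power2_eq_square)
      also have "\<dots> = (\<Sum>a\<in>UNIV. \<Sum>c\<in>UNIV. \<Sum>b\<in>UNIV. \<Sum>d\<in>UNIV. H $ b $ a * H $ d $ c * (V $ a $ b * V $ c $ d))"
        unfolding inner_self_adjoint_eq_sum[OF that] sum_product H_def by (simp add: mult_ac)
      finally show ?thesis .
    qed
    have "complex_of_real (\<integral>\<omega>. ((Z \<omega> - A0) \<bullet> \<theta>)\<^sup>2 \<partial>N) = (\<integral>\<omega>. complex_of_real (((Z \<omega> - A0) \<bullet> \<theta>)\<^sup>2) \<partial>N)"
      by (rule integral_complex_of_real[symmetric])
    also have "\<dots> = (\<integral>\<omega>. (\<Sum>a\<in>UNIV. \<Sum>c\<in>UNIV. \<Sum>b\<in>UNIV. \<Sum>d\<in>UNIV.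
        H $ b $ a * H $ d $ c * ((Z \<omega> - A0) $ a $ b * (Z \<omega> - A0) $ c $ d)) \<partial>N)"
    proof (rule Bochner_Integration.integral_cong[OF refl], rule sq)
      fix \<omega> assume "\<omega> \<in> space N"
      then show "self_adjoint (Z \<omega> - A0)"
        using Zsa A0(2) by (simp add: self_adjoint_def conj_transpose_simps)
    qed
    also have "\<dots> = (\<Sum>a\<in>UNIV. \<Sum>c\<in>UNIV. \<Sum>b\<in>UNIV. \<Sum>d\<in>UNIV.
        H $ b $ a * H $ d $ c * (\<Sum>k\<in>K. A k $ a $ b * A k $ c $ d))"
      using ic by (simp only: Bochner_Integration.integral_sum Bochner_Integration.integrable_sum
          integrable_mult_right integral_mult_right_zero cov)
    also have "\<dots> = (\<Sum>k\<in>K. complex_of_real ((A k \<bullet> \<theta>)\<^sup>2))"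
      unfolding sq[OF A] by (simp add: sum_distrib_left sum.swap[of _ K])
    finally have v: "(\<integral>\<omega>. ((Z \<omega> - A0) \<bullet> \<theta>)\<^sup>2 \<partial>N) = (\<Sum>k\<in>K. (A k \<bullet> \<theta>)\<^sup>2)"
      by (simp only: of_real_sum[symmetric] of_real_eq_iff)
    have "(\<integral>\<omega>. cos (Z \<omega> \<bullet> \<theta> + c) \<partial>N) = Re (iexp c * (iexp (A0 \<bullet> \<theta>) * complex_of_real (exp (- (\<Sum>k\<in>K. (A k \<bullet> \<theta>)\<^sup>2) / 2))))"
      using g v by (subst N.integral_cos_char) (simp_all add: m inner_diff_left)
    also have "\<dots> = Re (iexp (A0 \<bullet> \<theta> + c) * char (distr P borel (\<lambda>\<omega>. \<Sum>k\<in>K. (A k \<bullet> \<theta>) * \<xi> k \<omega>)) 1)"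
      unfolding char_linear_combination by (simp add: exp_add distrib_left mult_ac)
    also have "\<dots> = (\<integral>\<omega>. cos ((\<Sum>k\<in>K. (A k \<bullet> \<theta>) * \<xi> k \<omega>) + (A0 \<bullet> \<theta> + c)) \<partial>P)"
      by (rule integral_cos_char[symmetric]) measurable
    also have "\<dots> = (\<integral>\<omega>. cos ((A0 + G A \<omega>) \<bullet> \<theta> + c) \<partial>P)"
      by (simp add: G_def inner_add_left inner_sum_left algebra_simps)
    finally show "(\<integral>\<omega>. cos (Z \<omega> \<bullet> \<theta> + c) \<partial>N) = (\<integral>\<omega>. cos ((A0 + G A \<omega>) \<bullet> \<theta> + c) \<partial>P)" .
  qed
qed

section \<open>Covariance of the sum\<close>

context bounded_summands
begin

lemma norm_S_le: "\<omega> \<in> space M \<Longrightarrow> norm (S \<omega>) \<le> card I * (L * norm (mat 1 :: complex^'n^'n))"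
  unfolding S_def using norm_Y_le by (intro order_trans[OF norm_sum] sum_bounded_above) auto

lemma integrable_S_component: "integrable M (\<lambda>\<omega>. S \<omega> $ a $ b * S \<omega> $ c $ d)"
proof (rule integrable_component_mult[OF S_measurable], rule integrable_const_bound)
  show "AE \<omega> in M. norm ((norm (S \<omega>))\<^sup>2) \<le> (card I * (L * norm (mat 1 :: complex^'n^'n)))\<^sup>2"
    using norm_S_le by (intro AE_I2) (simp add: power_mono)
qed measurable

text \<open>Mixed terms factor by independence and vanish by centring.\<close>

lemma covariance_S:
  "(\<integral>\<omega>. S \<omega> $ a $ b * S \<omega> $ c $ d \<partial>M) = (\<Sum>i\<in>I. \<integral>\<omega>. Y i \<omega> $ a $ b * Y i \<omega> $ c $ d \<partial>M)"
proof -
  have main: "integrable M (\<lambda>\<omega>. Y i \<omega> $ a $ b * S \<omega> $ c $ d)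
      \<and> (\<integral>\<omega>. Y i \<omega> $ a $ b * S \<omega> $ c $ d \<partial>M) = (\<integral>\<omega>. Y i \<omega> $ a $ b * Y i \<omega> $ c $ d \<partial>M)" if i: "i \<in> I" for i
  proof -
    define U where "U \<omega> = (\<Sum>j\<in>I - {i}. Y j \<omega>)" for \<omega>
    have SU: "S \<omega> = U \<omega> + Y i \<omega>" for \<omega>
      unfolding S_def U_def using i finite_I by (simp add: sum.remove add.commute)
    have "indep_var borel U borel (Y i)"
      using indep_var_sum_other[OF indep i finite_I] by (simp add: U_def[abs_def])
    from indep_var_compose[OF this, of "\<lambda>A. A $ c $ d" borel "\<lambda>A. A $ a $ b" borel]
    have ind: "indep_var borel (\<lambda>\<omega>. U \<omega> $ c $ d) borel (\<lambda>\<omega>. Y i \<omega> $ a $ b)"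
      by (simp add: comp_def borel_measurable_continuous_onI continuous_intros)
    have lin: "bounded_linear (\<lambda>A :: complex^'n^'n. A $ x $ y)" for x y
      by (rule bounded_linear_compose[OF bounded_linear_vec_nth bounded_linear_vec_nth])
    have iU: "integrable M (\<lambda>\<omega>. U \<omega> $ c $ d)"
      unfolding U_def by (intro integrable_bounded_linear[OF lin] Bochner_Integration.integrable_sum integrable_Y) auto
    have iY: "integrable M (\<lambda>\<omega>. Y i \<omega> $ a $ b)"
      by (intro integrable_bounded_linear[OF lin] integrable_Y i)
    have "(\<integral>\<omega>. Y i \<omega> $ a $ b \<partial>M) = 0"
      using integral_matrix_component[OF integrable_Y[OF i], of a b] Y_centred[OF i] by simp
    then have 1: "(\<integral>\<omega>. Y i \<omega> $ a $ b * U \<omega> $ c $ d \<partial>M) = 0"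
      using indep_var_lebesgue_integral[OF ind iU iY] by (simp add: mult.commute)
    have 2: "integrable M (\<lambda>\<omega>. Y i \<omega> $ a $ b * U \<omega> $ c $ d)"
      using indep_var_integrable[OF ind iU iY] by (simp add: mult.commute)
    show ?thesis
      using 1 2 integrable_Y_component[OF i, of a b c d] by (simp add: SU distrib_left)
  qed
  have "S \<omega> $ a $ b * S \<omega> $ c $ d = (\<Sum>i\<in>I. Y i \<omega> $ a $ b * S \<omega> $ c $ d)" for \<omega>
    by (subst (1) S_def) (simp add: sum_distrib_right)
  then show ?thesis using main by simp
qed

lemma Y2_eq: "(\<integral>\<omega>. S \<omega> ** S \<omega> \<partial>M) = Y2"
proof -
  have "integrable M (\<lambda>\<omega>. S \<omega> ** S \<omega>)"
    by (rule integrable_matrixI)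
      (simp add: matrix_mult_component integrable_S_component)
  then have "(\<integral>\<omega>. S \<omega> ** S \<omega> \<partial>M) $ a $ b = Y2 $ a $ b" for a b
    using integrable_Y_component integrable_S_component
    by (simp add: integral_matrix_component Y2_def integrable_Y_sq matrix_mult_component covariance_S sum.swap[of _ I])
  then show ?thesis by (simp add: vec_eq_iff)
qed

end

text \<open>The spectral norm is 1-Lipschitz for the Frobenius norm. Its continuity makes the
  truncation at level \<open>L\<close> measurable.\<close>

lemma continuous_on_spectral_norm: "continuous_on UNIV (spectral_norm :: complex^'n^'n \<Rightarrow> real)"
proof -
  have tri: "spectral_norm A \<le> spectral_norm B + norm (A - B)" for A B :: "complex^'n^'n"
  proof (rule spectral_norm_le)
    fix x
    have "A *v x = B *v x + (A - B) *v x"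
      by (simp add: matrix_vector_mult_diff_rdistrib)
    then have "norm (A *v x) \<le> norm (B *v x) + norm ((A - B) *v x)"
      by (metis norm_triangle_ineq)
    also have "\<dots> \<le> spectral_norm B * norm x + norm (A - B) * norm x"
      by (intro add_mono norm_mult_vector_le order_trans[OF norm_mult_vector_le] mult_right_mono
          spectral_norm_le_norm norm_ge_zero)
    finally show "norm (A *v x) \<le> (spectral_norm B + norm (A - B)) * norm x"
      by (simp add: distrib_right)
  qed
  have "\<bar>spectral_norm A - spectral_norm B\<bar> \<le> norm (A - B)" for A B :: "complex^'n^'n"
    using tri[of A B] tri[of B A] by (simp add: norm_minus_commute abs_le_iff)
  then have "1-lipschitz_on UNIV (spectral_norm :: complex^'n^'n \<Rightarrow> real)"
    by (intro lipschitz_onI) (simp_all add: dist_norm)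
  then show ?thesis by (rule lipschitz_on_continuous_on)
qed

theorem theorem3:
  fixes M :: "'a measure" and N :: "'b measure"
    and n :: nat and S :: "nat \<Rightarrow> 'a \<Rightarrow> complex^'n^'n" and X :: "'a \<Rightarrow> complex^'n^'n"
    and Z :: "'b \<Rightarrow> complex^'n^'n"
    and \<zeta> :: complex and p :: nat
  assumes "prob_space M" and "prob_space N"
    and S_self_adjoint: "\<And>i. i \<in> {1..n} \<Longrightarrow> random_self_adjoint M (S i)"
    and S_square_integrable: "\<And>i. i \<in> {1..n} \<Longrightarrow> integrable M (\<lambda>\<omega>. (norm (S i \<omega>))\<^sup>2)"
    and S_indep: "prob_space.indep_vars M (\<lambda>_. borel) S {1..n}"
    and X_def: "X = (\<lambda>\<omega>. \<Sum>i=1..n. S i \<omega>)"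
    and Z_self_adjoint: "random_self_adjoint N Z"
    and Z_gaussian: "gaussian_matrix N Z"
    and mean_eq: "integral\<^sup>L N Z = integral\<^sup>L M X"
    and var_eq: "var_tensor N Z = var_tensor M X"
    and "\<zeta> \<notin> \<real>" and "p \<ge> 1"
  shows "ennreal \<bar>Lq_norm M (2 * real p) (\<lambda>\<omega>. resolvent \<zeta> (X \<omega>))
                - Lq_norm N (2 * real p) (\<lambda>\<omega>. resolvent \<zeta> (Z \<omega>))\<bar>
    \<le> (48 * of_nat p ^ 2 * ennreal (matrix_variance M X) * uniform_bound M {1..n} S
        + 72 * of_nat p ^ 3 * uniform_bound M {1..n} S ^ 3)
      / ennreal (\<bar>Im \<zeta>\<bar> ^ 4)"
proof -
  interpret M: prob_space M by fact
  interpret N: prob_space N by fact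
  have "Im \<zeta> \<noteq> 0" using \<open>\<zeta> \<notin> \<real>\<close> by (simp add: complex_is_Real_iff)
  then interpret resolvent_words \<zeta> by unfold_locales
  have Sm: "S i \<in> borel_measurable M" and Ssa: "\<And>\<omega>. \<omega> \<in> space M \<Longrightarrow> self_adjoint (S i \<omega>)" if "i \<in> {1..n}" for i
    using S_self_adjoint[OF that] by (auto simp: random_self_adjoint_def)
  have Xm[measurable]: "X \<in> borel_measurable M" unfolding X_def using Sm by (intro borel_measurable_sum)
  have Xsa: "self_adjoint (X \<omega>)" if "\<omega> \<in> space M" for \<omega>
    using Ssa that unfolding X_def self_adjoint_def
    by (simp add: linear_sum[OF bounded_linear.linear[OF bounded_linear_conj_transpose]])
  have Zm[measurable]: "Z \<in> borel_measurable N" and Zsa: "\<And>\<omega>. \<omega> \<in> space N \<Longrightarrow> self_adjoint (Z \<omega>)"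
    using Z_self_adjoint by (auto simp: random_self_adjoint_def)
  let ?dX = "Lq_norm M (2 * real p) (\<lambda>\<omega>. resolvent \<zeta> (X \<omega>))"
  let ?dZ = "Lq_norm N (2 * real p) (\<lambda>\<omega>. resolvent \<zeta> (Z \<omega>))"
  define v where "v = matrix_variance M X"
  have v0: "0 \<le> v" by (simp add: v_def matrix_variance_def Let_def spectral_norm_nonneg)
  show ?thesis
  proof (cases "uniform_bound M {1..n} S")
    \<comment> \<open>An infinite uniform bound makes the right-hand side infinite, because p \<ge>
      1 keeps the coefficient of the cubic term nonzero.\<close>
    case top
    have "of_nat p \<noteq> (0 :: ennreal)" using \<open>p \<ge> 1\<close> by simp
    then have "72 * of_nat p ^ 3 * (top :: ennreal) ^ 3 = top"
      by (simp add: ennreal_mult_top ennreal_top_mult power3_eq_cube)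
    then show ?thesis unfolding top by (simp add: ennreal_top_divide)
  next
    case (real L)
    have bound: "\<bar>?dX - ?dZ\<bar> \<le> (48 * p ^ 2 * v * L + 72 * p ^ 3 * L ^ 3) / \<eta> ^ 4"
    proof (cases "4 * p * L \<le> \<eta>")
      \<comment> \<open>Above the threshold, \<eta>^3 is at most (4pL)^3 = 64 p^3 L^3, so the
        trivial bound 1/\<eta> = \<eta>^3 / \<eta>^4 lies below the cubic term.\<close>
      case False
      have "\<bar>?dX - ?dZ\<bar> \<le> 1 / \<eta>"
        using Lq_norm_resolvent_le[OF \<open>prob_space M\<close> _ \<open>p \<ge> 1\<close>, of X]
          Lq_norm_resolvent_le[OF \<open>prob_space N\<close> Z_self_adjoint \<open>p \<ge> 1\<close>] Xm Xsa
        by (auto simp: random_self_adjoint_def abs_le_iff)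
      also have "\<dots> = \<eta> ^ 3 / \<eta> ^ 4" using \<eta>_pos by (simp add: field_simps power_numeral_reduce)
      also have "\<dots> \<le> (72 * p ^ 3 * L ^ 3) / \<eta> ^ 4"
      proof (rule divide_right_mono)
        have "\<eta> ^ 3 \<le> (4 * p * L) ^ 3" using False \<eta>_pos by (intro power_mono) auto
        also have "\<dots> = 64 * (p ^ 3 * L ^ 3)" by (simp add: power_mult_distrib)
        also have "\<dots> \<le> 72 * (p ^ 3 * L ^ 3)" using real by (intro mult_right_mono) auto
        finally show "\<eta> ^ 3 \<le> 72 * p ^ 3 * L ^ 3" by (simp add: mult.assoc)
      qed (use \<eta>_pos in simp)
      also have "\<dots> \<le> (48 * p ^ 2 * v * L + 72 * p ^ 3 * L ^ 3) / \<eta> ^ 4"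
        using real v0 \<eta>_pos by (intro divide_right_mono) auto
      finally show ?thesis .
    next
      case True
      define Es where "Es i = integral\<^sup>L M (S i)" for i
      \<comment> \<open>The essential bound becomes a bound at every point: \<open>cut i\<close>
        alters a centred summand only on a null set, hence neither its mean nor its second moments.
        It is a fixed measurable function of the summand, so independence persists.\<close>
      define cut where "cut i A = (if spectral_norm (A - Es i) \<le> L then A - Es i else 0)" for i and A :: "complex^'n^'n"
      define Y where "Y i \<omega> = cut i (S i \<omega>)" for i \<omega>
      have [measurable]: "(spectral_norm :: complex^'n^'n \<Rightarrow> real) \<in> borel_measurable borel"
        by (rule borel_measurable_continuous_onI[OF continuous_on_spectral_norm])
      have cut_m: "cut i \<in> borel_measurable borel" for i
        unfolding cut_def[abs_def] by measurable
      have int_S: "integrable M (S i)" if i: "i \<in> {1..n}" for i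
      proof (rule Bochner_Integration.integrable_bound)
        show "integrable M (\<lambda>\<omega>. 1 + (norm (S i \<omega>))\<^sup>2)" using S_square_integrable[OF i] by simp
        have "x \<le> 1 + x\<^sup>2" for x :: real
        proof -
          have "2 * x * 1 \<le> x\<^sup>2 + 1\<^sup>2" by (rule sum_squares_bound)
          then show ?thesis using zero_le_power2[of x] unfolding one_power2 by linarith
        qed
        then show "AE \<omega> in M. norm (S i \<omega>) \<le> norm (1 + (norm (S i \<omega>))\<^sup>2)" by simp
      qed (rule Sm[OF i])
      have Es_sa: "self_adjoint (Es i)" if i: "i \<in> {1..n}" for i
        unfolding self_adjoint_def Es_def integral_bounded_linear[OF bounded_linear_conj_transpose int_S[OF i], symmetric]
        using Ssa[OF i] by (intro Bochner_Integration.integral_cong refl) (simp add: self_adjoint_def)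
      have "AE \<omega> in M. (SUP i\<in>{1..n}. ennreal (spectral_norm (S i \<omega> - Es i))) \<le> ennreal L"
        using esssup_AE[of "\<lambda>\<omega>. SUP i\<in>{1..n}. ennreal (spectral_norm (S i \<omega> - Es i))" M] real
        by (simp add: uniform_bound_def Es_def)
      then have Y_AE: "AE \<omega> in M. \<forall>i\<in>{1..n}. Y i \<omega> = S i \<omega> - Es i"
      proof (rule eventually_mono)
        fix \<omega> assume le: "(SUP i\<in>{1..n}. ennreal (spectral_norm (S i \<omega> - Es i))) \<le> ennreal L"
        show "\<forall>i\<in>{1..n}. Y i \<omega> = S i \<omega> - Es i"
        proof
          fix i assume "i \<in> {1..n}"
          then have "ennreal (spectral_norm (S i \<omega> - Es i)) \<le> ennreal L"
            using le by (auto simp: SUP_le_iff)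
          then show "Y i \<omega> = S i \<omega> - Es i"
            using real by (simp add: Y_def cut_def spectral_norm_nonneg)
        qed
      qed
      have indep_Y: "M.indep_vars (\<lambda>_. borel) Y {1..n}"
        unfolding Y_def by (rule M.indep_vars_compose2[OF S_indep cut_m])
      interpret BS: bounded_summands \<zeta> M Y "{1..n}" L p
      proof
        show "finite {1..n}" by simp
        show "M.indep_vars (\<lambda>_. borel) Y {1..n}" by (rule indep_Y)
        fix i assume i: "i \<in> {1..n}"
        show "self_adjoint (Y i \<omega>)" if "\<omega> \<in> space M" for \<omega>
          using Ssa[OF i that] Es_sa[OF i]
          by (simp add: Y_def cut_def self_adjoint_def conj_transpose_simps)
        show "spectral_norm (Y i \<omega>) \<le> L" for \<omega>
          using real by (simp add: Y_def cut_def) (simp add: spectral_norm_def onorm_zero)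
        have "Y i \<in> borel_measurable M"
          unfolding Y_def[abs_def] by (rule measurable_compose[OF Sm[OF i] cut_m])
        then have "(\<integral>\<omega>. Y i \<omega> \<partial>M) = (\<integral>\<omega>. S i \<omega> - Es i \<partial>M)"
          using Y_AE i Sm[OF i] by (intro integral_cong_AE) (auto elim: eventually_mono)
        then show "(\<integral>\<omega>. Y i \<omega> \<partial>M) = 0"
          using int_S[OF i] by (simp add: Es_def M.prob_space)
      qed (use True \<open>p \<ge> 1\<close> in auto)
      define A0 where "A0 = integral\<^sup>L M X"
      have A0_sum: "A0 = (\<Sum>i=1..n. Es i)"
        unfolding A0_def X_def Es_def using int_S by (intro Bochner_Integration.integral_sum)
      have A0_sa: "self_adjoint A0"
        unfolding A0_sum using Es_sa
        by (simp add: self_adjoint_def linear_sum[OF bounded_linear.linear[OF bounded_linear_conj_transpose]])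
      have X_AE: "AE \<omega> in M. X \<omega> = A0 + BS.S \<omega>"
        using Y_AE
      proof (rule eventually_mono)
        fix \<omega> assume "\<forall>i\<in>{1..n}. Y i \<omega> = S i \<omega> - Es i"
        then have "BS.S \<omega> = (\<Sum>i=1..n. S i \<omega> - Es i)"
          unfolding BS.S_def by (intro sum.cong) auto
        then show "X \<omega> = A0 + BS.S \<omega>"
          by (simp only: X_def A0_sum sum_subtractf) simp
      qed
      obtain A :: "('n \<times> 'n) \<times> bool \<Rightarrow> complex^'n^'n" where A: "\<forall>k. self_adjoint (A k)"
        and cov: "\<forall>a b c d. (\<Sum>k\<in>UNIV. A k $ a $ b * A k $ c $ d)
          = (\<Sum>i=1..n. \<integral>\<omega>. Y i \<omega> $ a $ b * Y i \<omega> $ c $ d \<partial>M)"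
        using covariance_factorization[OF BS.Y_self_adjoint BS.integrable_Y_component] .
      \<comment> \<open>\<open>Z\<close> lives on an arbitrary space. Only its law matters, and it
        is realized from independent standard normal coordinates on this product space.\<close>
      define P where "P = PiM (UNIV :: (('n \<times> 'n) \<times> bool) set) (\<lambda>_. std_normal_distribution)"
      interpret GI: gaussian_interpolation \<zeta> M Y "{1..n}" L p P "\<lambda>k \<omega>. \<omega> k" UNIV A A0
      proof -
        have "standard_gaussians P (\<lambda>k \<omega>. \<omega> k) (UNIV :: (('n \<times> 'n) \<times> bool) set)"
          unfolding P_def by (rule standard_gaussians_PiM) auto
        then interpret standard_gaussians P "\<lambda>k \<omega>. \<omega> k" "UNIV :: (('n \<times> 'n) \<times> bool) set" .
        show "gaussian_interpolation \<zeta> M Y {1..n} L p P (\<lambda>k \<omega>. \<omega> k) UNIV A"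
          by unfold_locales (use A cov in auto)
      qed
      have cov_X: "(\<integral>\<omega>. (X \<omega> - A0) $ a $ b * (X \<omega> - A0) $ c $ d \<partial>M) = (\<Sum>k\<in>UNIV. A k $ a $ b * A k $ c $ d)"
        and int_X: "integrable M (\<lambda>\<omega>. (X \<omega> - A0) $ a $ b * (X \<omega> - A0) $ c $ d)" for a b c d
      proof -
        have m: "(\<lambda>\<omega>. (f \<omega>) $ a $ b * (f \<omega>) $ c $ d) \<in> borel_measurable M" if "f \<in> borel_measurable M" for f :: "'a \<Rightarrow> complex^'n^'n"
          by (rule borel_measurable_continuous_Pair[OF that that]) (intro continuous_intros)
        have ae: "AE \<omega> in M. (X \<omega> - A0) $ a $ b * (X \<omega> - A0) $ c $ d = BS.S \<omega> $ a $ b * BS.S \<omega> $ c $ d"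
          using X_AE by (rule eventually_mono) simp
        have mX: "(\<lambda>\<omega>. X \<omega> - A0) \<in> borel_measurable M" by measurable
        show "(\<integral>\<omega>. (X \<omega> - A0) $ a $ b * (X \<omega> - A0) $ c $ d \<partial>M) = (\<Sum>k\<in>UNIV. A k $ a $ b * A k $ c $ d)"
          using integral_cong_AE[OF m[OF mX] m[OF BS.S_measurable] ae] BS.covariance_S cov by simp
        show "integrable M (\<lambda>\<omega>. (X \<omega> - A0) $ a $ b * (X \<omega> - A0) $ c $ d)"
          using integrable_cong_AE[OF m[OF mX] m[OF BS.S_measurable] ae] BS.integrable_S_component by simp
      qed
      have cov_Z: "(\<integral>\<omega>. (Z \<omega> - A0) $ a $ b * (Z \<omega> - A0) $ c $ d \<partial>N) = (\<Sum>k\<in>UNIV. A k $ a $ b * A k $ c $ d)" for a b c d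
      proof -
        have mZ: "(\<lambda>\<omega>. Z \<omega> - A0) \<in> borel_measurable N" by measurable
        have "integrable N (\<lambda>\<omega>. (Z \<omega> - integral\<^sup>L N Z) $ a $ b * (Z \<omega> - integral\<^sup>L N Z) $ c $ d)" for a b c d
          using integrable_component_mult[OF mZ N.gaussian_matrix_integrable(2)[OF Z_gaussian]]
          by (simp add: mean_eq A0_def)
        from var_tensor_component[OF this, of a c b d] var_tensor_component[of M X a c b d] int_X cov_X
        show ?thesis by (simp add: var_eq mean_eq A0_def)
      qed
      have law: "distr N borel Z = distr P borel (\<lambda>\<omega>. A0 + GI.gauss.G A \<omega>)"
        by (rule GI.gauss.gaussian_matrix_distr[OF \<open>prob_space N\<close> Z_self_adjoint Z_gaussian _ _ A0_sa cov_Z])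
           (use A in \<open>auto simp: mean_eq A0_def\<close>)
      have v: "spectral_norm BS.Y2 = v"
      proof -
        have "(\<integral>\<omega>. (X \<omega> - A0) ** (X \<omega> - A0) \<partial>M) = (\<integral>\<omega>. BS.S \<omega> ** BS.S \<omega> \<partial>M)"
        proof (rule integral_cong_AE)
          have m: "(\<lambda>\<omega>. f \<omega> ** f \<omega>) \<in> borel_measurable M" if "f \<in> borel_measurable M" for f :: "'a \<Rightarrow> complex^'n^'n"
            by (rule borel_measurable_continuous_Pair[OF that that]) (intro continuous_intros)
          show "(\<lambda>\<omega>. (X \<omega> - A0) ** (X \<omega> - A0)) \<in> borel_measurable M" by (rule m) measurable
          show "(\<lambda>\<omega>. BS.S \<omega> ** BS.S \<omega>) \<in> borel_measurable M" by (rule m) measurable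
        qed (use X_AE in \<open>auto elim: eventually_mono\<close>)
        then show ?thesis by (simp only: v_def matrix_variance_def Let_def A0_def BS.Y2_eq)
      qed
      \<comment> \<open>At pi/2 the cosine vanishes and the path is an almost sure version of
        \<open>X\<close>; at 0 the sine vanishes and the path has the law of
        \<open>Z\<close>.\<close>
      have psi_1: "GI.\<psi> (pi / 2) = ?dX"
      proof -
        have "GI.\<Phi> (pi / 2) = (\<integral>\<omega>. tr0 (bal p) (A0 + BS.S \<omega>) \<partial>M)"
          using GI.MP.integral_fst'[OF GI.integrable_tr0[of "bal p" "pi / 2"]]
          by (simp add: GI.\<Phi>_def GI.path_def GI.gauss.prob_space del: One_nat_def)
        also have "\<dots> = (\<integral>\<omega>. tr0 (bal p) (X \<omega>) \<partial>M)"
        proof (rule integral_cong_AE)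
          show "(\<lambda>\<omega>. tr0 (bal p) (A0 + BS.S \<omega>)) \<in> borel_measurable M" by measurable
          show "AE \<omega> in M. tr0 (bal p) (A0 + BS.S \<omega>) = tr0 (bal p) (X \<omega>)"
            using X_AE by (rule eventually_mono) (simp only:)
        qed measurable
        finally show ?thesis using Lq_norm_resolvent[of M X p, OF Xsa \<open>p \<ge> 1\<close>] by (simp add: GI.\<psi>_def del: One_nat_def)
      qed
      have psi_0: "GI.\<psi> 0 = ?dZ"
      proof -
        have "GI.\<Phi> 0 = (\<integral>\<omega>. tr0 (bal p) (A0 + GI.gauss.G A \<omega>) \<partial>P)"
          using GI.MP.integral_fst'[OF GI.integrable_tr0[of "bal p" 0]]
          by (simp add: GI.\<Phi>_def GI.path_def M.prob_space del: One_nat_def)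
        also have "\<dots> = (\<integral>x. tr0 (bal p) x \<partial>distr P borel (\<lambda>\<omega>. A0 + GI.gauss.G A \<omega>))"
          by (subst integral_distr) auto
        also have "\<dots> = (\<integral>\<omega>. tr0 (bal p) (Z \<omega>) \<partial>N)"
          unfolding law[symmetric] by (subst integral_distr) auto
        finally show ?thesis using Lq_norm_resolvent[of N Z p, OF Zsa \<open>p \<ge> 1\<close>] by (simp add: GI.\<psi>_def del: One_nat_def)
      qed
      have "\<bar>?dX - ?dZ\<bar> \<le> 48 * p ^ 2 * v * L / \<eta> ^ 4"
        using GI.interpolation_bound unfolding psi_0 psi_1 v .
      also have "\<dots> \<le> (48 * p ^ 2 * v * L + 72 * p ^ 3 * L ^ 3) / \<eta> ^ 4"
        using real v0 \<eta>_pos by (intro divide_right_mono) auto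
      finally show ?thesis .
    qed
    have "ennreal (48 * p ^ 2 * v * L + 72 * p ^ 3 * L ^ 3)
        = 48 * of_nat p ^ 2 * ennreal v * ennreal L + 72 * of_nat p ^ 3 * ennreal L ^ 3"
      using real v0
      by (simp add: ennreal_plus ennreal_mult ennreal_power ennreal_of_nat_eq_real_of_nat flip: ennreal_numeral)
    then have "ennreal ((48 * p ^ 2 * v * L + 72 * p ^ 3 * L ^ 3) / \<eta> ^ 4)
        = (48 * of_nat p ^ 2 * ennreal v * ennreal L + 72 * of_nat p ^ 3 * ennreal L ^ 3) / ennreal (\<bar>Im \<zeta>\<bar> ^ 4)"
      using real v0 \<eta>_pos by (subst divide_ennreal[symmetric]) (simp_all add: \<eta>_def)
    then show ?thesis using ennreal_leI[OF bound] real by (simp add: v_def)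
  qed
qed

end
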